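(* Let $\mathcal M=(K_{i(e)},w_e,p_e)_{e\in E}$ be a Markov system on a complete metric space $(K,d)$ which is uniformly continuous, contractive with a contraction rate $0<a<1$, and satisfies the absolute continuity condition: $P_x\ll P_y$ for all $i\in N$ and $x,y\in K_i$. Let $M\in E(\mathcal M)$ and $I_M:=\{i\in I\mid F(M)(C_i)>0\}$. For each $e\in E$ let $f_e:K\to[0,\infty)$ be Borel measurable such that either (a) $\sum_{e\in E}p_ef_e$ is $(\mathcal M,\alpha)$-uniformly continuous for some $0<\alpha<1$ and $\sum_{e\in E}p_ef_e^2$ is bounded, or (b) for every $e\in E$, $f_e(z)=-\log p_e(z)$ if $z\in K_{i(e)}$ and $f_e(z)=0$ otherwise, and $-\sum_{e\in E}p_e\log p_e$ is bounded. Then the following holds. (i) $I_M\neq\emptyset$. For every $i\in I_M$ there exists a unique $\Lambda_i\in E(\mathcal M)$ with $F(\Lambda_i)(C_i)=1$. For every $i\in I_M$, $\Lambda_i$ is ergodic (with respect to the shift $S$), $F^{-1}(C_i)\in\mathcal I_M$, and $\{\mu\in P(\mathcal M)\mid\mu(C_i)=1\}=\{F(\Lambda_i)\}$. For every $B\in\mathcal B(\Sigma)$ and $Q\in\mathcal I_M$, $$M(B\cap Q)=\sum_{i\in I_M}M\left(F^{-1}(C_i)\cap Q\right)\Lambda_i(B).$$ (ii) For every $x\in\bigcup_{i\in I_M}C_i$, for $P_x$-a.e. $\sigma\in\Sigma^+$, $$\frac1n\sum_{k=1}^n f_{\sigma_{k+1}}\left(w_{\sigma_k}\circ\cdots\circ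 w_{\sigma_1}(x)\right)\longrightarrow\sum_{i\in I_M}1_{C_i}(x)\sum_{e\in E}\int_{K_{i(e)}}p_ef_e\,dF(\Lambda_i)\quad(n\to\infty).$$ (iii) $I_M\subset I_G$. If $\mathcal M$ has a single generating communication class (i.e. $I_G$ has exactly one element), then $M$ is ergodic and $E(\mathcal M)=\{M\}$.
   Context: Markov system. A Markov system $\mathcal M=(K_{i(e)},w_e,p_e)_{e\in E}$ on a complete metric space $(K,d)$ consists of: an at most countable set $E$; Borel measurable maps $w_e:K\to K$ and Borel measurable functions $p_e:K\to[0,1]$ ($e\in E$) with $\sum_{e\in E}p_e(x)=1$ for all $x\in K$; a partition $(K_i)_{i\in N}$ of $K$ into non-empty Borel sets (vertex sets; $N$ is the set of vertices); and maps $i,t:E\to N$, with $i$ surjective (so $N$ is at most countable), such that $\emptyset\neq\{p_e>0\}\subset K_{i(e)}$ and $w_e(K_{i(e)})\subset K_{t(e)}$ for all $e\in E$. It is positive if $p_e>0$ on $K_{i(e)}$ for all $e$ (this is implied by the absolute continuity condition); uniformly continuous if $w_e|_{K_{i(e)}}$ and $p_e|_{K_{i(e)}}$ are uniformly continuous for all $e$; contractive with contraction rate $a$ ($0<a<1$) if $\sum_{e\in E,\,i(e)=j}p_e(x)d(w_ex,w_ey)\le a\,d(x,y)$ for all $x,y\in K_j$, $j\in N$. Markov operator and invariant measures. For Borel $f\ge0$ on $K$, $Uf:=\sum_{e\in E}p_e\,f\circ w_e$; for $\nu$ a Borel probability measure on $K$, $U^*\nu(f):=\int Uf\,d\nu$.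 $P(\mathcal M)$ is the set of Borel probability measures $\mu$ on $K$ with $U^*\mu=\mu$. Communication classes. $(e_1,\dots,e_n)\in E^n$ is a path of length $n$ if $i(e_{m+1})=t(e_m)$ for $1\le m\le n-1$; it goes from $i(e_1)$ to $t(e_n)$. $j\in N$ is accessible from $i\in N$ if $i=j$ or there is a path from $i$ to $j$. Two vertices communicate if each is accessible from the other. $i$ is essential if it communicates with every vertex accessible from it. $(c_i)_{i\in I}$ is the partition of the set of essential vertices into communication equivalence classes and $C_i:=\bigcup_{j\in c_i}K_j$; both $c_i$ and $C_i$ are called communication classes. Generating classes. $x_0\in K$ is generating if the probability measures $\alpha_n^{x_0}$ on $N$, $\alpha_n^{x_0}\{j\}:=\frac1n\sum_{k=1}^n(U^* )^k\delta_{x_0}(K_j)$, $n\in\mathbb N$, are uniformly tight (for each $\epsilon>0$ there is a finite $V\subset N$ with $\alpha^{x_0}_n(N\setminus V)<\epsilon$ for all $n$). A vertex $i_0$ is generating if $K_{i_0}$ contains a generating point. For positive $\mathcal M$, the class $c_i$ (or $C_i$) is generating if some $j\in c_i$ is generating; $I_G\subset I$ is the set of indices of generating classes. Code space. $\bar E:=E\cup\{\infty\}$ is the one-point compactification of the discrete space $E$; $w_\infty:=\mathrm{id}$, $p_\infty:=0$, $f_\infty:=0$, $i(\infty)=t(\infty)=n_\infty$ for a fixed $n_\infty\in N$. $\Sigma:=\bar E^{\mathbb Z}$, $\Sigma^+:=\bar E^{\mathbb N}$ with product topologies and Borel $\sigma$-algebras; ${}_m[e_m,\dots,e_n]=\{\sigma\in\Sigma:\sigma_i=e_i,\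 m\le i\le n\}$, and ${}_m[e_m,\dots,e_n]^+$ denotes the analogous cylinder in $\Sigma^+$. $S$ is the left shift on $\Sigma$, $(S\sigma)_{i-1}=\sigma_i$; $P_S(\Sigma)$ is the set of $S$-invariant Borel probability measures. $\mathcal F$ is the $\sigma$-algebra on $\Sigma$ generated by all cylinders ${}_m[e_m,\dots,e_0]$, $m\le0$. $\Sigma_G:=\{\sigma\in\Sigma:\sigma_n\in E,\ i(\sigma_{n+1})=t(\sigma_n)\ \forall n\in\mathbb Z\}$. For $x\in K$, $P_x$ is the Borel probability measure on $\Sigma^+$ with $P_x({}_1[e_1,\dots,e_k]^+)=p_{e_1}(x)p_{e_2}(w_{e_1}x)\cdots p_{e_k}(w_{e_{k-1}}\circ\cdots\circ w_{e_1}x)$. Coding map and $E(\mathcal M)$. Fix $x_i\in K_i$ for each $i\in N$. $D:=\{\sigma\in\Sigma_G:\lim_{m\to-\infty}w_{\sigma_0}\circ w_{\sigma_{-1}}\circ\cdots\circ w_{\sigma_m}(x_{i(\sigma_m)})\text{ exists}\}$. The coding map $F:\Sigma\to K$ is $F(\sigma):=$ this limit if $\sigma\in D$, and $F(\sigma):=x_{t(\sigma_0)}$ otherwise. $E(\mathcal M):=\{\Lambda\in P_S(\Sigma):\Lambda(D)=1$ and $E_\Lambda(1_{{}_1[e]}|\mathcal F)=p_e\circ F$ $\Lambda$-a.e. for all $e\in E\}$. For a measure $\Lambda$ on $\Sigma$, $F(\Lambda)$ is the image measure $B\mapsto\Lambda(F^{-1}(B))$. For $M\in P_S(\Sigma)$,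 $\mathcal I_M:=\{B\in\mathcal B(\Sigma):M(S^{-1}B\,\Delta\,B)=0\}$ (a $\sigma$-algebra, not to be confused with the index set $I_M$). $(\mathcal M,\alpha)$-uniform continuity. For $f:K\to\mathbb R$, $j\in N$, $s\ge 0$, $\Delta_jf(s):=\sup\{|f(x)-f(y)|:x,y\in K_j,\ d(x,y)\le s\}$, and for $i\in N$, $k\in\mathbb N$, $\Delta_i^{(k)}f(s):=\sup\{\Delta_jf(s): j$ is accessible from $i$ by a path of length $k\}$. With $a$ the contraction rate and $0<\alpha<1$, $f$ is $(\mathcal M,\alpha)$-uniformly continuous if for every $i\in N$ and $\beta>0$, $\lim_{n\to\infty}\frac1n\sum_{k=1}^n\Delta_i^{(k)}f(\beta a^{\alpha k})=0$. Convention: $0\log0:=0$. *)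

theory Defs
  imports "HOL-Probability.Probability"
begin

text \<open>The space \<open>K\<close> is the whole type \<open>'k\<close>, the edge set \<open>E\<close> the whole type \<open>'e\<close> and the vertex
  set \<open>N\<close> the whole type \<open>'n\<close>.\<close>

record ('k, 'e, 'n) markov =
  cell :: "'n \<Rightarrow> 'k set"
  wmap :: "'e \<Rightarrow> 'k \<Rightarrow> 'k"
  wgt  :: "'e \<Rightarrow> 'k \<Rightarrow> real"
  src  :: "'e \<Rightarrow> 'n"
  tgt  :: "'e \<Rightarrow> 'n"

definition markov_system :: "('k::complete_space, 'e::countable, 'n) markov \<Rightarrow> bool" where
  "markov_system S \<longleftrightarrow>
     (\<forall>e. wmap S e \<in> borel \<rightarrow>\<^sub>M borel) \<and>
     (\<forall>e. wgt S e \<in> borel_measurable borel) \<and>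
     (\<forall>e x. 0 \<le> wgt S e x \<and> wgt S e x \<le> 1) \<and>
     (\<forall>x. ((\<lambda>e. wgt S e x) has_sum 1) UNIV) \<and>
     (\<forall>j. cell S j \<noteq> {} \<and> cell S j \<in> sets borel) \<and>
     disjoint_family (cell S) \<and> (\<Union>j. cell S j) = UNIV \<and>
     surj (src S) \<and>
     (\<forall>e. {x. 0 < wgt S e x} \<noteq> {} \<and> {x. 0 < wgt S e x} \<subseteq> cell S (src S e)) \<and>
     (\<forall>e. wmap S e ` cell S (src S e) \<subseteq> cell S (tgt S e))"

definition uniformly_continuous_system :: "('k::metric_space, 'e, 'n) markov \<Rightarrow> bool" where
  "uniformly_continuous_system S \<longleftrightarrow>
     (\<forall>e. uniformly_continuous_on (cell S (src S e)) (wmap S e) \<and>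
          uniformly_continuous_on (cell S (src S e)) (wgt S e))"

definition contractive :: "('k::metric_space, 'e, 'n) markov \<Rightarrow> real \<Rightarrow> bool" where
  "contractive S a \<longleftrightarrow> 0 < a \<and> a < 1 \<and>
     (\<forall>j. \<forall>x\<in>cell S j. \<forall>y\<in>cell S j.
        (\<Sum>\<^sub>\<infinity>e\<in>{e. src S e = j}. ennreal (wgt S e x * dist (wmap S e x) (wmap S e y)))
          \<le> ennreal (a * dist x y))"

definition markov_op :: "('k, 'e, 'n) markov \<Rightarrow> ('k \<Rightarrow> ennreal) \<Rightarrow> 'k \<Rightarrow> ennreal" where
  "markov_op S f x = (\<Sum>\<^sub>\<infinity>e. ennreal (wgt S e x) * f (wmap S e x))"

text \<open>The functional \<open>U\<^sup>*\<nu>\<close>, represented as the Borel measure with the same values on indicators.\<close>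

definition adj_op :: "('k::topological_space, 'e, 'n) markov \<Rightarrow> 'k measure \<Rightarrow> 'k measure" where
  "adj_op S \<nu> = measure_of UNIV (sets borel) (\<lambda>B. \<integral>\<^sup>+x. markov_op S (indicator B) x \<partial>\<nu>)"

definition invariant_measures :: "('k::topological_space, 'e, 'n) markov \<Rightarrow> 'k measure set" where
  "invariant_measures S = {\<mu>. sets \<mu> = sets borel \<and> prob_space \<mu> \<and> adj_op S \<mu> = \<mu>}"

definition is_path :: "('k, 'e, 'n) markov \<Rightarrow> 'e list \<Rightarrow> bool" where
  "is_path S es \<longleftrightarrow> es \<noteq> [] \<and> (\<forall>m. Suc m < length es \<longrightarrow> src S (es ! Suc m) = tgt S (es ! m))"

definition path_of_length :: "('k, 'e, 'n) markov \<Rightarrow> nat \<Rightarrow> 'n \<Rightarrow> 'n \<Rightarrow> bool" where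
  "path_of_length S k i j \<longleftrightarrow>
     (\<exists>es. is_path S es \<and> length es = k \<and> src S (hd es) = i \<and> tgt S (last es) = j)"

definition accessible :: "('k, 'e, 'n) markov \<Rightarrow> 'n \<Rightarrow> 'n \<Rightarrow> bool" where
  "accessible S i j \<longleftrightarrow> i = j \<or> (\<exists>k. path_of_length S k i j)"

definition communicate :: "('k, 'e, 'n) markov \<Rightarrow> 'n \<Rightarrow> 'n \<Rightarrow> bool" where
  "communicate S i j \<longleftrightarrow> accessible S i j \<and> accessible S j i"

definition essential :: "('k, 'e, 'n) markov \<Rightarrow> 'n set" where
  "essential S = {i. \<forall>j. accessible S i j \<longrightarrow> communicate S i j}"

text \<open>The family of communication classes is indexed by the classes themselves: the index set \<open>I\<close>
  is \<open>comm_classes S\<close>, \<open>c\<^sub>c = c\<close> and \<open>C\<^sub>c = class_cell S c\<close>.\<close>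

definition comm_classes :: "('k, 'e, 'n) markov \<Rightarrow> 'n set set" where
  "comm_classes S =
     essential S // {(i, j). i \<in> essential S \<and> j \<in> essential S \<and> communicate S i j}"

definition class_cell :: "('k, 'e, 'n) markov \<Rightarrow> 'n set \<Rightarrow> 'k set" where
  "class_cell S c = (\<Union>j\<in>c. cell S j)"

definition occupation :: "('k::topological_space, 'e, 'n) markov \<Rightarrow> 'k \<Rightarrow> nat \<Rightarrow> 'n measure" where
  "occupation S x n = point_measure UNIV
     (\<lambda>j. ennreal (1 / real n) * (\<Sum>k=1..n. emeasure ((adj_op S ^^ k) (return borel x)) (cell S j)))"

definition generating_point :: "('k::topological_space, 'e, 'n) markov \<Rightarrow> 'k \<Rightarrow> bool" where
  "generating_point S x \<longleftrightarrow>
     (\<forall>\<epsilon>>0. \<exists>V. finite V \<and> (\<forall>n\<ge>1. emeasure (occupation S x n) (UNIV - V) < ennreal \<epsilon>))"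

definition generating_vertex :: "('k::topological_space, 'e, 'n) markov \<Rightarrow> 'n \<Rightarrow> bool" where
  "generating_vertex S i \<longleftrightarrow> (\<exists>x\<in>cell S i. generating_point S x)"

definition generating_classes :: "('k::topological_space, 'e, 'n) markov \<Rightarrow> 'n set set" where
  "generating_classes S = {c \<in> comm_classes S. \<exists>j\<in>c. generating_vertex S j}"

text \<open>A point of the compactified alphabet is \<open>Some e\<close> for an edge \<open>e\<close>, or \<open>None\<close> for \<open>\<infinity>\<close>. The index
  set \<open>J\<close> below is \<open>UNIV :: int set\<close> for the two-sided code space \<open>\<Sigma>\<close>, and \<open>{1..} :: nat set\<close> for the
  one-sided code space \<open>\<Sigma>\<^sup>+\<close>, whose sequences thus start at index \<open>1\<close>.\<close>

definition code_top :: "'i set \<Rightarrow> ('i \<Rightarrow> 'e option) topology" where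
  "code_top J = product_topology (\<lambda>_. Alexandroff_compactification (discrete_topology UNIV)) J"

definition code_borel :: "'i set \<Rightarrow> ('i \<Rightarrow> 'e option) measure" where
  "code_borel J = sigma (topspace (code_top J)) {U. openin (code_top J) U}"

definition cylinder :: "'i set \<Rightarrow> 'i set \<Rightarrow> ('i \<Rightarrow> 'e option) \<Rightarrow> ('i \<Rightarrow> 'e option) set" where
  "cylinder J A e = {\<sigma> \<in> topspace (code_top J). \<forall>i\<in>A. \<sigma> i = e i}"

definition shift :: "(int \<Rightarrow> 'e option) \<Rightarrow> int \<Rightarrow> 'e option" where
  "shift \<sigma> = (\<lambda>i. \<sigma> (i + 1))"

definition shift_invariant :: "(int \<Rightarrow> 'e option) measure set" where
  "shift_invariant = {\<Lambda>. sets \<Lambda> = sets (code_borel UNIV) \<and> prob_space \<Lambda> \<and> distr \<Lambda> \<Lambda> shift = \<Lambda>}"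

definition invariant_sets :: "(int \<Rightarrow> 'e option) measure \<Rightarrow> (int \<Rightarrow> 'e option) set set" where
  "invariant_sets M = {B \<in> sets (code_borel UNIV). emeasure M (sym_diff (shift -` B) B) = 0}"

text \<open>Invariance of sets is meant modulo \<open>M\<close>-null sets, also in the definition of ergodicity.\<close>

definition ergodic :: "(int \<Rightarrow> 'e option) measure \<Rightarrow> bool" where
  "ergodic M \<longleftrightarrow> M \<in> shift_invariant \<and> (\<forall>B\<in>invariant_sets M. emeasure M B = 0 \<or> emeasure M B = 1)"

definition past :: "(int \<Rightarrow> 'e option) measure" where
  "past = sigma (topspace (code_top UNIV)) {cylinder UNIV {m..0} e | m e. m \<le> 0}"

fun wmap_ext :: "('k, 'e, 'n) markov \<Rightarrow> 'e option \<Rightarrow> 'k \<Rightarrow> 'k" where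
  "wmap_ext S None = id"
| "wmap_ext S (Some e) = wmap S e"

fun wgt_ext :: "('k, 'e, 'n) markov \<Rightarrow> 'e option \<Rightarrow> 'k \<Rightarrow> real" where
  "wgt_ext S None = (\<lambda>_. 0)"
| "wgt_ext S (Some e) = wgt S e"

fun fun_ext :: "('e \<Rightarrow> 'k \<Rightarrow> real) \<Rightarrow> 'e option \<Rightarrow> 'k \<Rightarrow> real" where
  "fun_ext f None = (\<lambda>_. 0)"
| "fun_ext f (Some e) = f e"

text \<open>In the following, \<open>z\<close> is the vertex \<open>n\<^sub>\<infinity>\<close> assigned to \<open>\<infinity>\<close>.\<close>

fun src_ext :: "('k, 'e, 'n) markov \<Rightarrow> 'n \<Rightarrow> 'e option \<Rightarrow> 'n" where
  "src_ext S z None = z"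
| "src_ext S z (Some e) = src S e"

fun tgt_ext :: "('k, 'e, 'n) markov \<Rightarrow> 'n \<Rightarrow> 'e option \<Rightarrow> 'n" where
  "tgt_ext S z None = z"
| "tgt_ext S z (Some e) = tgt S e"

text \<open>\<open>orbit S \<sigma> k x\<close> is \<open>w\<^bsub>\<sigma>(k)\<^esub> \<circ> \<dots> \<circ> w\<^bsub>\<sigma>(1)\<^esub> (x)\<close>.\<close>

fun orbit :: "('k, 'e, 'n) markov \<Rightarrow> (nat \<Rightarrow> 'e option) \<Rightarrow> nat \<Rightarrow> 'k \<Rightarrow> 'k" where
  "orbit S \<sigma> 0 x = x"
| "orbit S \<sigma> (Suc k) x = wmap_ext S (\<sigma> (Suc k)) (orbit S \<sigma> k x)"

text \<open>The cylinders form an intersection-stable generator, so there is at most one such measure;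
  existence holds for every Markov system (Kolmogorov extension).\<close>

definition path_measure :: "('k, 'e, 'n) markov \<Rightarrow> 'k \<Rightarrow> (nat \<Rightarrow> 'e option) measure" where
  "path_measure S x = (THE P. sets P = sets (code_borel {1..}) \<and> prob_space P \<and>
     (\<forall>k\<ge>1. \<forall>e. emeasure P (cylinder {1..} {1..k} e) =
        ennreal (\<Prod>j=1..k. wgt_ext S (e j) (orbit S e (j - 1) x))))"

definition absolutely_continuous_system :: "('k, 'e, 'n) markov \<Rightarrow> bool" where
  "absolutely_continuous_system S \<longleftrightarrow>
     (\<forall>i. \<forall>x\<in>cell S i. \<forall>y\<in>cell S i. absolutely_continuous (path_measure S y) (path_measure S x))"

text \<open>\<open>backward S \<sigma> n x\<close> is \<open>w\<^bsub>\<sigma>(0)\<^esub> \<circ> w\<^bsub>\<sigma>(-1)\<^esub> \<circ> \<dots> \<circ> w\<^bsub>\<sigma>(-n)\<^esub> (x)\<close>.\<close>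

fun backward :: "('k, 'e, 'n) markov \<Rightarrow> (int \<Rightarrow> 'e option) \<Rightarrow> nat \<Rightarrow> 'k \<Rightarrow> 'k" where
  "backward S \<sigma> 0 x = wmap_ext S (\<sigma> 0) x"
| "backward S \<sigma> (Suc n) x = backward S \<sigma> n (wmap_ext S (\<sigma> (- int (Suc n))) x)"

definition admissible :: "('k, 'e, 'n) markov \<Rightarrow> 'n \<Rightarrow> (int \<Rightarrow> 'e option) set" where
  "admissible S z =
     {\<sigma>. \<forall>n. \<sigma> n \<noteq> None \<and> src_ext S z (\<sigma> (n + 1)) = tgt_ext S z (\<sigma> n)}"

text \<open>\<open>b i\<close> is the base point \<open>x\<^sub>i\<close> chosen in the vertex set of \<open>i\<close>.\<close>

definition backward_seq ::
    "('k, 'e, 'n) markov \<Rightarrow> ('n \<Rightarrow> 'k) \<Rightarrow> 'n \<Rightarrow> (int \<Rightarrow> 'e option) \<Rightarrow> nat \<Rightarrow> 'k" where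
  "backward_seq S b z \<sigma> n = backward S \<sigma> n (b (src_ext S z (\<sigma> (- int n))))"

definition coding_domain ::
    "('k::metric_space, 'e, 'n) markov \<Rightarrow> ('n \<Rightarrow> 'k) \<Rightarrow> 'n \<Rightarrow> (int \<Rightarrow> 'e option) set" where
  "coding_domain S b z = {\<sigma> \<in> admissible S z. convergent (backward_seq S b z \<sigma>)}"

definition coding_map ::
    "('k::metric_space, 'e, 'n) markov \<Rightarrow> ('n \<Rightarrow> 'k) \<Rightarrow> 'n \<Rightarrow> (int \<Rightarrow> 'e option) \<Rightarrow> 'k" where
  "coding_map S b z \<sigma> =
     (if \<sigma> \<in> coding_domain S b z then lim (backward_seq S b z \<sigma>) else b (tgt_ext S z (\<sigma> 0)))"

text \<open>This is the set \<open>E(\<M>)\<close>.\<close>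

definition equilibrium_states ::
    "('k::metric_space, 'e, 'n) markov \<Rightarrow> ('n \<Rightarrow> 'k) \<Rightarrow> 'n \<Rightarrow> (int \<Rightarrow> 'e option) measure set" where
  "equilibrium_states S b z =
     {\<Lambda> \<in> shift_invariant. emeasure \<Lambda> (coding_domain S b z) = 1 \<and>
        (\<forall>e. AE \<sigma> in \<Lambda>. real_cond_exp \<Lambda> past (indicator (cylinder UNIV {1..1} (\<lambda>_. Some e))) \<sigma>
                          = wgt S e (coding_map S b z \<sigma>))}"

definition coded ::
    "('k::metric_space, 'e, 'n) markov \<Rightarrow> ('n \<Rightarrow> 'k) \<Rightarrow> 'n \<Rightarrow> (int \<Rightarrow> 'e option) measure \<Rightarrow> 'k measure" where
  "coded S b z \<Lambda> = distr \<Lambda> borel (coding_map S b z)"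

definition supported_classes ::
    "('k::metric_space, 'e, 'n) markov \<Rightarrow> ('n \<Rightarrow> 'k) \<Rightarrow> 'n \<Rightarrow> (int \<Rightarrow> 'e option) measure \<Rightarrow> 'n set set" where
  "supported_classes S b z M = {c \<in> comm_classes S. emeasure (coded S b z M) (class_cell S c) > 0}"

text \<open>The moduli are suprema in \<open>[0, \<infinity>]\<close>.\<close>

definition modulus :: "('k::metric_space, 'e, 'n) markov \<Rightarrow> 'n \<Rightarrow> ('k \<Rightarrow> real) \<Rightarrow> real \<Rightarrow> ennreal" where
  "modulus S j f s =
     (SUP (x, y)\<in>{(x, y). x \<in> cell S j \<and> y \<in> cell S j \<and> dist x y \<le> s}. ennreal \<bar>f x - f y\<bar>)"

definition path_modulus ::
    "('k::metric_space, 'e, 'n) markov \<Rightarrow> 'n \<Rightarrow> nat \<Rightarrow> ('k \<Rightarrow> real) \<Rightarrow> real \<Rightarrow> ennreal" where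
  "path_modulus S i k f s = (SUP j\<in>{j. path_of_length S k i j}. modulus S j f s)"

definition uniformly_continuous_along ::
    "('k::metric_space, 'e, 'n) markov \<Rightarrow> real \<Rightarrow> real \<Rightarrow> ('k \<Rightarrow> real) \<Rightarrow> bool" where
  "uniformly_continuous_along S a \<alpha> f \<longleftrightarrow>
     (\<forall>i. \<forall>\<beta>>0. (\<lambda>n. ennreal (1 / real n) *
        (\<Sum>k=1..n. path_modulus S i k f (\<beta> * a powr (\<alpha> * real k)))) \<longlonglongrightarrow> 0)"

end

theory Submission
  imports Defs "HOL-Library.Discrete_Functions"
begin

text \<open>Under \<open>M \<in> E(\<M>)\<close> the points \<open>F (S\<^sup>n \<sigma>)\<close> move along the edges \<open>\<sigma>\<^sub>1, \<sigma>\<^sub>2, \<dots>\<close>, and given the past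
  the future has law \<open>P\<^bsub>F \<sigma>\<^esub>\<close>; so \<open>F(M)\<close> is invariant and determines \<open>M\<close>. A shift-invariant set \<open>Q\<close>
  agrees, modulo null sets, with a set of the past and with a set \<open>R\<close> of the future. Its indicator
  is therefore \<open>P\<^bsub>F \<sigma>\<^esub>(R)\<close>, which by absolute continuity depends only on the cell of \<open>F \<sigma>\<close> and is
  constant along edges. Hence the invariant sets are the unions of the sets \<open>F\<^sup>-\<^sup>1(C\<^sub>i)\<close>, and the
  measures \<open>M\<close> conditioned on \<open>F\<^sup>-\<^sup>1(C\<^sub>i)\<close> are ergodic. Birkhoff's theorem gives the law of large
  numbers from almost every starting point; it carries over to every point of the class, because two
  starting points of one cell have equivalent path measures and asymptotically equal averages: by
  contraction for Lipschitz functions, by an additional martingale argument in case (a), and by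
  subexponential growth of the likelihood ratio in case (b). Applied to Lipschitz functions it gives
  the uniqueness of the invariant measure, and applied to the indicators of the cells the tightness
  of the occupation measures.\<close>

subsection \<open>The pointwise ergodic theorem\<close>

text \<open>Contraction holds only in the mean, with weights taken at one of two points, so two
  orbits driven by the same letters approach each other only almost surely under the path measure of
  the first starting point. Whatever is known under the path measure of the second point has to be
  transferred, and absolute continuity is what permits it. Rescaling the mean bound a^n by
  a^(-\<alpha> n) leaves a summable series, hence the almost sure rate a^(\<alpha> n) to which the
  continuity hypothesis in (a) refers. In (b) Birkhoff sums are minus logarithms of cylinder
  probabilities, and a likelihood ratio has mean at most one. No equilibrium state is built from
  nothing: the state on a class is M conditioned on the preimage of the class, again an equilibrium
  state because that preimage agrees modulo null sets with an event of the past. The ergodic theorem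
  and uniqueness are therefore proved for a state carried by a single class. An invariant set is
  approximated by sets that depend on the coordinates -n..n; by invariance the window may be moved
  to either side of the origin, which puts the set into the past and into the future.\<close>

context prob_space
begin

context
  fixes T :: "'a \<Rightarrow> 'a"
  assumes T[measurable]: "T \<in> M \<rightarrow>\<^sub>M M" and distr_T: "distr M M T = M"
begin

definition bsum :: "('a \<Rightarrow> real) \<Rightarrow> nat \<Rightarrow> 'a \<Rightarrow> real" where
  "bsum f n x = (\<Sum>k<n. f ((T ^^ k) x))"

lemma bsum_Suc: "bsum f (Suc n) x = f x + bsum f n (T x)"
  unfolding bsum_def by (subst sum.lessThan_Suc_shift) (simp add: funpow_swap1)

text \<open>The maximum of the partial sums \<open>bsum f 1 x\<close>, ...,
  \<open>bsum f (Suc n) x\<close>; the recursion exposes its increment along \<open>T\<close>, on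
  which the argument rests.\<close>

primrec bmax :: "('a \<Rightarrow> real) \<Rightarrow> nat \<Rightarrow> 'a \<Rightarrow> real" where
  "bmax f 0 x = f x"
| "bmax f (Suc n) x = f x + max 0 (bmax f n (T x))"

lemma measurable_bmax[measurable]:
  assumes [measurable]: "f \<in> borel_measurable M"
  shows "bmax f n \<in> borel_measurable M"
proof (induction n)
  case 0 then show ?case by simp
next
  case (Suc n)
  note Suc[measurable]
  have "bmax f (Suc n) = (\<lambda>x. f x + max 0 (bmax f n (T x)))" by auto
  then show ?case by simp
qed

lemma integrable_comp_T: "integrable M f \<Longrightarrow> integrable M (\<lambda>x. f (T x))"
  and integral_comp_T: "integrable M f \<Longrightarrow> (\<integral>x. f (T x) \<partial>M) = (\<integral>x. f x \<partial>M)"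
  for f :: "'a \<Rightarrow> real"
proof -
  assume f: "integrable M f"
  show "integrable M (\<lambda>x. f (T x))"
    using f distr_T by (intro integrable_distr[OF T]) simp
  show "(\<integral>x. f (T x) \<partial>M) = (\<integral>x. f x \<partial>M)"
    using integral_distr[OF T, of f] f distr_T by simp
qed

lemma integrable_bmax: "integrable M f \<Longrightarrow> integrable M (bmax f n)"
proof (induction n)
  case 0 then show ?case by simp
next
  case (Suc n)
  have "bmax f (Suc n) = (\<lambda>x. f x + max 0 (bmax f n (T x)))" by auto
  moreover have "integrable M (\<lambda>x. f x + max 0 (bmax f n (T x)))"
    using Suc integrable_comp_T[OF Suc.IH[OF Suc.prems]] by auto
  ultimately show ?case by simp
qed

lemma bmax_mono_Suc: "bmax f n x \<le> bmax f (Suc n) x"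
proof (induction n arbitrary: x)
  case (Suc n)
  from Suc[of "T x"] show ?case by simp
qed simp

lemma bmax_mono: "m \<le> n \<Longrightarrow> bmax f m x \<le> bmax f n x"
  by (rule lift_Suc_mono_le[of "\<lambda>n. bmax f n x"]) (auto intro: bmax_mono_Suc simp del: bmax.simps)

lemma bsum_le_bmax: "bsum f (Suc n) x \<le> bmax f n x"
proof (induction n arbitrary: x)
  case 0 then show ?case by (simp add: bsum_def)
next
  case (Suc n)
  from Suc[of "T x"] show ?case by (subst bsum_Suc) simp
qed

text \<open>The set where the partial sums are unbounded above is invariant, and on it the increments
  \<open>bmax f (Suc n) x - bmax f n (T x)\<close> decrease to \<open>f x\<close>.\<close>

lemma bmax_bounded_of_neg_integral:
  assumes f: "integrable M f" and neg: "(\<integral>x. f x \<partial>M) < 0"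
    and erg: "\<And>B. B \<in> sets M \<Longrightarrow> T -` B \<inter> space M = B \<Longrightarrow> emeasure M B = 0 \<or> emeasure M B = 1"
  shows "AE x in M. \<exists>m::nat. \<forall>n. bmax f n x \<le> real m"
proof -
  have [measurable]: "f \<in> borel_measurable M" using f by simp
  define A where "A = {x \<in> space M. \<not> (\<exists>m::nat. \<forall>n. bmax f n x \<le> real m)}"
  have A[measurable]: "A \<in> sets M" unfolding A_def by measurable
  have inv: "(\<exists>m::nat. \<forall>n. bmax f n (T x) \<le> real m) \<longleftrightarrow> (\<exists>m::nat. \<forall>n. bmax f n x \<le> real m)" for x
  proof
    assume "\<exists>m::nat. \<forall>n. bmax f n (T x) \<le> real m"
    then obtain m :: nat where m: "\<And>n. bmax f n (T x) \<le> real m" by blast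
    obtain m' :: nat where m': "\<bar>f x\<bar> + real m \<le> real m'" using real_arch_simple by blast
    have "bmax f n x \<le> real m'" for n
    proof (cases n)
      case 0 then show ?thesis using m' by simp
    next
      case (Suc k) then show ?thesis using m' m[of k] by simp
    qed
    then show "\<exists>m::nat. \<forall>n. bmax f n x \<le> real m" by blast
  next
    assume "\<exists>m::nat. \<forall>n. bmax f n x \<le> real m"
    then obtain m :: nat where m: "\<And>n. bmax f n x \<le> real m" by blast
    obtain m' :: nat where m': "\<bar>f x\<bar> + real m \<le> real m'" using real_arch_simple by blast
    have "bmax f n (T x) \<le> real m'" for n using m[of "Suc n"] m' by simp
    then show "\<exists>m::nat. \<forall>n. bmax f n (T x) \<le> real m" by blast
  qed
  have "T -` A \<inter> space M = A"
    using measurable_space[OF T] unfolding A_def by (simp only: vimage_def mem_Collect_eq inv) blast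
  with erg[OF A] consider "emeasure M A = 0" | "emeasure M A = 1" by auto
  then show ?thesis
  proof cases
    case 1
    then have "AE x in M. x \<notin> A" by (intro AE_not_in) auto
    with AE_space show ?thesis
    proof eventually_elim
      case (elim x)
      then show ?case unfolding A_def by blast
    qed
  next
    case 2
    then have AEA: "AE x in M. x \<in> A" using A by (simp add: emeasure_eq_measure prob_eq_1)
    define s where "s n x = bmax f (Suc n) x - bmax f n (T x)" for n x
    have s_eq: "s n x = f x + max 0 (- bmax f n (T x))" for n x
      by (auto simp: s_def)
    have "(\<lambda>n. \<integral>x. s n x \<partial>M) \<longlonglongrightarrow> (\<integral>x. f x \<partial>M)"
    proof (rule integral_dominated_convergence[where w="\<lambda>x. \<bar>f x\<bar> + \<bar>f (T x)\<bar>"])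
      show "f \<in> borel_measurable M" by measurable
      show "s n \<in> borel_measurable M" for n unfolding s_eq[abs_def] by measurable
      show "integrable M (\<lambda>x. \<bar>f x\<bar> + \<bar>f (T x)\<bar>)"
        using f integrable_comp_T[OF f] by auto
      show "AE x in M. norm (s n x) \<le> \<bar>f x\<bar> + \<bar>f (T x)\<bar>" for n
      proof (rule AE_I2)
        fix x
        have "bmax f 0 (T x) \<le> bmax f n (T x)" by (rule bmax_mono) simp
        then show "norm (s n x) \<le> \<bar>f x\<bar> + \<bar>f (T x)\<bar>" unfolding s_eq by auto
      qed
      show "AE x in M. (\<lambda>n. s n x) \<longlonglongrightarrow> f x"
        using AEA
      proof eventually_elim
        fix x assume "x \<in> A"
        then have "\<not> (\<exists>m::nat. \<forall>n. bmax f n (T x) \<le> real m)" unfolding inv A_def by auto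
        then obtain n where "\<not> bmax f n (T x) \<le> real 0" by blast
        then have "bmax f k (T x) > 0" if "k \<ge> n" for k
          using bmax_mono[OF that, of f "T x"] by simp
        then have "s k x = f x" if "k \<ge> n" for k unfolding s_eq using that by (simp add: less_imp_le)
        then show "(\<lambda>n. s n x) \<longlonglongrightarrow> f x"
          by (intro tendsto_eventually eventually_sequentiallyI)
      qed
    qed
    \<comment> \<open>\<open>T\<close> preserves \<open>M\<close> and \<open>bmax f n\<close> grows
      with \<open>n\<close>, so these integrals are nonnegative; their limit would be the negative
      integral of \<open>f\<close>.\<close>
    moreover have "0 \<le> (\<integral>x. s n x \<partial>M)" for n
    proof -
      have "(\<integral>x. s n x \<partial>M) = (\<integral>x. bmax f (Suc n) x \<partial>M) - (\<integral>x. bmax f n (T x) \<partial>M)"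
        unfolding s_def by (intro Bochner_Integration.integral_diff integrable_bmax integrable_comp_T f)
      also have "(\<integral>x. bmax f n (T x) \<partial>M) = (\<integral>x. bmax f n x \<partial>M)"
        by (intro integral_comp_T integrable_bmax f)
      also have "(\<integral>x. bmax f (Suc n) x \<partial>M) - \<dots> \<ge> 0"
        using integral_mono[OF integrable_bmax[OF f] integrable_bmax[OF f] bmax_mono_Suc] by simp
      finally show ?thesis by simp
    qed
    ultimately have "0 \<le> (\<integral>x. f x \<partial>M)" by (intro LIMSEQ_le_const) auto
    with neg show ?thesis by simp
  qed
qed

text \<open>Subtracting a level d strictly between the mean and c gives a negative mean. The partial
  sums of \<open>f x - d\<close> are then bounded above by a constant depending on x, and the gap
  between d and c absorbs that constant after division by n.\<close>

lemma ergodic_limsup: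
  assumes f: "integrable M f" and c: "(\<integral>x. f x \<partial>M) < c"
    and erg: "\<And>B. B \<in> sets M \<Longrightarrow> T -` B \<inter> space M = B \<Longrightarrow> emeasure M B = 0 \<or> emeasure M B = 1"
  shows "AE x in M. \<forall>\<^sub>F n in sequentially. bsum f n x / n \<le> c"
proof -
  obtain d where d: "(\<integral>x. f x \<partial>M) < d" "d < c" using c dense by blast
  have "integrable M (\<lambda>x. f x - d)" using f by auto
  moreover have "(\<integral>x. f x - d \<partial>M) < 0" using f d by (simp add: prob_space)
  ultimately have "AE x in M. \<exists>m::nat. \<forall>n. bmax (\<lambda>x. f x - d) n x \<le> real m"
    by (rule bmax_bounded_of_neg_integral) (rule erg)
  then show ?thesis
  proof eventually_elim
    fix x assume "\<exists>m::nat. \<forall>n. bmax (\<lambda>x. f x - d) n x \<le> real m"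
    then obtain m :: nat where "\<And>n. bmax (\<lambda>x. f x - d) n x \<le> real m" by blast
    then have "bsum (\<lambda>x. f x - d) (Suc n) x \<le> real m" for n
      using bsum_le_bmax order_trans by blast
    then have b: "bsum f (Suc n) x \<le> real m + (Suc n) * d" for n
      unfolding bsum_def by (simp add: sum_subtractf algebra_simps)
    obtain N :: nat where N: "real m / (c - d) \<le> real N" using real_arch_simple by blast
    show "\<forall>\<^sub>F n in sequentially. bsum f n x / n \<le> c"
    proof (rule eventually_sequentiallyI[of "Suc N"])
      fix n assume n: "Suc N \<le> n"
      then have "real m / (c - d) \<le> real n" using N by linarith
      then have "real m \<le> real n * (c - d)" using d by (simp add: divide_simps)
      moreover have "bsum f n x \<le> real m + n * d" using b[of "n - 1"] n by (cases n) auto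
      ultimately have "bsum f n x \<le> c * n" by (simp add: algebra_simps)
      then show "bsum f n x / n \<le> c" using n by (simp add: divide_simps)
    qed
  qed
qed

text \<open>Both one-sided bounds come from \<open>ergodic_limsup\<close>, for \<open>f\<close> and
  for \<open>- f\<close>; the countably many margins \<open>1 / Suc j\<close> allow one common null
  set.\<close>

theorem pointwise_ergodic:
  assumes f: "integrable M f"
    and erg: "\<And>B. B \<in> sets M \<Longrightarrow> T -` B \<inter> space M = B \<Longrightarrow> emeasure M B = 0 \<or> emeasure M B = 1"
  shows "AE x in M. (\<lambda>n. (\<Sum>k<n. f ((T ^^ k) x)) / n) \<longlonglongrightarrow> (\<integral>x. f x \<partial>M)"
proof -
  let ?I = "\<integral>x. f x \<partial>M"
  have up: "AE x in M. \<forall>j::nat. \<forall>\<^sub>F n in sequentially. bsum f n x / n \<le> ?I + 1 / Suc j"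
    unfolding AE_all_countable by (rule allI, rule ergodic_limsup[OF f _ erg]) auto
  have lo: "AE x in M. \<forall>j::nat. \<forall>\<^sub>F n in sequentially. bsum (\<lambda>x. - f x) n x / n \<le> - ?I + 1 / Suc j"
    unfolding AE_all_countable
    by (rule allI, rule ergodic_limsup[OF _ _ erg]) (use f in auto)
  from up lo show ?thesis
  proof eventually_elim
    case (elim x)
    have neg: "bsum (\<lambda>x. - f x) n x = - bsum f n x" for n by (simp add: bsum_def sum_negf)
    have "(\<lambda>n. bsum f n x / n) \<longlonglongrightarrow> ?I"
    proof (rule tendstoI)
      fix e :: real assume "e > 0"
      then obtain j where j: "1 / Suc j < e" using nat_approx_posE by blast
      from elim(1)[rule_format, of j] elim(2)[rule_format, of j]
      show "\<forall>\<^sub>F n in sequentially. dist (bsum f n x / n) ?I < e"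
      proof eventually_elim
        case (elim n)
        then have "bsum f n x / n \<le> ?I + 1 / Suc j" "- (bsum f n x / n) \<le> - ?I + 1 / Suc j"
          unfolding neg by simp_all
        then show ?case using j unfolding dist_real_def by linarith
      qed
    qed
    then show ?case by (simp add: bsum_def)
  qed
qed

end

end

subsection \<open>Code spaces\<close>

text \<open>Turns sums over edges or classes into integrals over counting measures, so that Tonelli
  and the convergence theorems apply to them.\<close>

lemma infsum_ennreal_eq_nn_integral:
  fixes f :: "'a \<Rightarrow> ennreal"
  assumes "countable A"
  shows "infsum f A = (\<integral>\<^sup>+x. f x \<partial>count_space A)"
proof -
  let ?B = "to_nat_on A ` A"
  let ?g = "\<lambda>n. f (from_nat_into A n) * indicator ?B n"
  have bij: "bij_betw (from_nat_into A) ?B A"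
    using assms by (intro bij_betwI[where g="to_nat_on A"]) (auto simp: from_nat_into_to_nat_on)
  have "infsum f A = infsum (\<lambda>n. f (from_nat_into A n)) ?B"
    using infsum_reindex_bij_betw[OF bij, of f] by simp
  also have "\<dots> = infsum ?g UNIV"
    by (rule infsum_cong_neutral) (auto split: split_indicator)
  also have "\<dots> = suminf ?g"
    using has_sum_imp_sums[OF has_sum_infsum[OF nonneg_summable_on_complete, of UNIV ?g]] by (simp add: sums_iff)
  also have "\<dots> = (\<integral>\<^sup>+n. ?g n \<partial>count_space UNIV)"
    by (simp add: nn_integral_count_space_nat)
  also have "\<dots> = (\<integral>\<^sup>+n. f (from_nat_into A n) \<partial>count_space ?B)"
    by (subst nn_integral_count_space_indicator) auto
  also have "\<dots> = (\<integral>\<^sup>+x. f x \<partial>count_space A)"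
    by (rule nn_integral_bij_count_space[OF bij])
  finally show ?thesis .
qed

lemma topspace_code_top: "topspace (code_top J) = PiE J (\<lambda>_. UNIV)"
  unfolding code_top_def by (auto simp: UNIV_option_conv)

lemma cylinder_eq: "cylinder J A e = {\<sigma> \<in> PiE J (\<lambda>_. UNIV). \<forall>i\<in>A. \<sigma> i = e i}"
  unfolding cylinder_def topspace_code_top ..

abbreviation "code_space J \<equiv> PiM J (\<lambda>_. count_space (UNIV :: 'e option set))"

text \<open>The alphabet is countable, so its compactification has a countable base and every open
  set of the product is a countable union of boxes over finitely many coordinates. Conversely the
  point at infinity is the complement of the open set of all edges, so every condition on one
  coordinate is Borel.\<close>

lemma sets_code_borel:
  assumes J: "countable J"
  shows "sets (code_borel J :: ('i \<Rightarrow> 'e::countable option) measure) = sets (code_space J)"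
proof -
  let ?X = "Alexandroff_compactification (discrete_topology (UNIV :: 'e set))"
  let ?O = "PiE J (\<lambda>_. UNIV) :: ('i \<Rightarrow> 'e option) set"
  let ?G = "{U. openin (code_top J :: ('i \<Rightarrow> 'e option) topology) U}"
  have GP: "?G \<subseteq> Pow ?O"
    unfolding topspace_code_top[symmetric] using openin_subset by blast
  have sets_code: "sets (code_borel J :: ('i \<Rightarrow> 'e option) measure) = sigma_sets ?O ?G"
    unfolding code_borel_def topspace_code_top using GP by simp
  interpret sa: sigma_algebra ?O "sigma_sets ?O ?G"
    using GP by (rule sigma_algebra_sigma_sets)
  have sub1: "sets (code_space J :: ('i \<Rightarrow> 'e option) measure) \<subseteq> sigma_sets ?O ?G"
    unfolding sets_PiM_single space_count_space
  proof (rule sa.sigma_sets_subset, safe)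
    fix i and A :: "'e option set" assume i: "i \<in> J"
    have op: "{f \<in> ?O. f i \<in> Some ` B} \<in> sigma_sets ?O ?G" for B
    proof -
      have "openin ?X (Some ` B)" by (simp add: openin_Alexandroff_compactification) blast
      then have "openin (code_top J) {f \<in> topspace (code_top J). f i \<in> Some ` B}"
        unfolding code_top_def by (intro openin_continuous_map_preimage[OF continuous_map_product_projection] i)
      then show ?thesis unfolding topspace_code_top by (intro sigma_sets.Basic) simp
    qed
    have none: "{f \<in> ?O. f i = None} \<in> sigma_sets ?O ?G"
    proof -
      have "f i = None \<longleftrightarrow> f i \<notin> range Some" for f :: "'i \<Rightarrow> 'e option" by (cases "f i") auto
      then have "{f \<in> ?O. f i = None} = ?O - {f \<in> ?O. f i \<in> range Some}" by blast
      then show ?thesis using op[of UNIV] by (simp add: sa.compl_sets)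
    qed
    have "{f \<in> ?O. f i \<in> A} = {f \<in> ?O. f i \<in> Some ` {e. Some e \<in> A}}
        \<union> (if None \<in> A then {f \<in> ?O. f i = None} else {})" (is "?l = ?r")
    proof (rule set_eqI)
      show "f \<in> ?l \<longleftrightarrow> f \<in> ?r" for f by (cases "f i") auto
    qed
    also have "\<dots> \<in> sigma_sets ?O ?G" using op none by auto
    finally show "{f \<in> PiE J (\<lambda>_. UNIV). f i \<in> A} \<in> sigma_sets ?O ?G" by simp
  qed
  \<comment> \<open>A countable base: single edges, and the cofinite neighbourhoods of
    \<open>None\<close>.\<close>
  define \<B> :: "'e option set set" where
    "\<B> = range (\<lambda>e. {Some e}) \<union> (\<lambda>C. insert None (Some ` (UNIV - C))) ` {C. finite C}"
  have cB: "countable \<B>" unfolding \<B>_def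
    using countable_Collect_finite[where 'a='e] by auto
  have tX: "topspace ?X = UNIV" by (auto simp: UNIV_option_conv)
  have base: "\<exists>B\<in>\<B>. x \<in> B \<and> B \<subseteq> V" if V: "openin ?X V" "x \<in> V" for x V
  proof -
    consider U where "V = Some ` U" | C where "finite C" "V = insert None (Some ` (UNIV - C))"
      using V(1) unfolding openin_Alexandroff_compactification compactin_discrete_topology by auto
    then show ?thesis
    proof cases
      case 1 then show ?thesis using V(2) unfolding \<B>_def by auto
    next
      case 2 then show ?thesis using V(2) unfolding \<B>_def by auto
    qed
  qed
  \<comment> \<open>Indexing the boxes by finite lists makes their family countable.\<close>
  define box :: "('i \<times> 'e option set) list \<Rightarrow> ('i \<Rightarrow> 'e option) set" where
    "box l = {f \<in> ?O. \<forall>(i, B)\<in>set l. f i \<in> B}" for l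
  have "?G \<subseteq> sets (code_space J)"
  proof safe
    fix U assume U: "openin (code_top J :: ('i \<Rightarrow> 'e option) topology) U"
    have "U = (\<Union>l\<in>{l\<in>lists (J \<times> \<B>). box l \<subseteq> U}. box l)"
    proof (intro equalityI subsetI)
      fix f assume f: "f \<in> U"
      then have fO: "f \<in> ?O" using U GP by auto
      obtain V where V: "finite {i \<in> J. V i \<noteq> topspace ?X}" "\<And>i. i \<in> J \<Longrightarrow> openin ?X (V i)"
        "f \<in> PiE J V" "PiE J V \<subseteq> U"
        using U f unfolding code_top_def openin_product_topology_alt by fast
      have "\<forall>i\<in>J. \<exists>B\<in>\<B>. f i \<in> B \<and> B \<subseteq> V i"
        using base V(2,3) by (metis PiE_mem)
      then obtain b where b: "\<And>i. i \<in> J \<Longrightarrow> b i \<in> \<B> \<and> f i \<in> b i \<and> b i \<subseteq> V i" by metis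
      obtain js where js: "set js = {i \<in> J. V i \<noteq> topspace ?X}" using finite_list[OF V(1)] by blast
      let ?l = "map (\<lambda>i. (i, b i)) js"
      have "?l \<in> lists (J \<times> \<B>)" using b js by auto
      moreover have "f \<in> box ?l" unfolding box_def using fO b js by auto
      moreover have "box ?l \<subseteq> PiE J V"
      proof (rule subsetI, rule PiE_I)
        fix g i assume g: "g \<in> box ?l" and i: "i \<in> J"
        show "g i \<in> V i"
        proof (cases "V i = topspace ?X")
          case True then show ?thesis unfolding tX by simp
        next
          case False
          then have "i \<in> set js" using i js by simp
          then have "g i \<in> b i" using g unfolding box_def by auto
          then show ?thesis using b[OF i] by blast
        qed
      next
        fix g i assume "g \<in> box ?l" "i \<notin> J" then show "g i = undefined"
          unfolding box_def by (auto simp: PiE_def extensional_def)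
      qed
      ultimately have "?l \<in> {l\<in>lists (J \<times> \<B>). box l \<subseteq> U}" "f \<in> box ?l" using V(4) by simp_all
      then show "f \<in> (\<Union>l\<in>{l\<in>lists (J \<times> \<B>). box l \<subseteq> U}. box l)" by (rule UN_I)
    next
      fix f assume "f \<in> (\<Union>l\<in>{l\<in>lists (J \<times> \<B>). box l \<subseteq> U}. box l)"
      then show "f \<in> U" by fast
    qed
    also have "\<dots> \<in> sets (code_space J)"
    proof (rule sets.countable_UN'')
      show "countable {l \<in> lists (J \<times> \<B>). box l \<subseteq> U}"
        using J cB by (intro countable_subset[OF _ countable_lists[of "J \<times> \<B>"]]) auto
      fix l assume "l \<in> {l \<in> lists (J \<times> \<B>). box l \<subseteq> U}"
      then have l: "set l \<subseteq> J \<times> UNIV" by auto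
      have "box l = {f \<in> space (code_space J). \<forall>p\<in>set l. f (fst p) \<in> snd p}"
        unfolding box_def by (auto simp: space_PiM split_beta')
      also have "\<dots> \<in> sets (code_space J)"
      proof (rule sets.sets_Collect_finite_All)
        fix p assume p: "p \<in> set l"
        then have "fst p \<in> J" using l by auto
        then show "{f \<in> space (code_space J). f (fst p) \<in> snd p} \<in> sets (code_space J)"
          by (intro measurable_sets_Collect[OF measurable_component_singleton]) auto
      qed auto
      finally show "box l \<in> sets (code_space J)" .
    qed
    finally show "U \<in> sets (code_space J)" .
  qed
  then have "sigma_sets ?O ?G \<subseteq> sets (code_space J)"
    using sets.sigma_sets_subset[of ?G "code_space J :: ('i \<Rightarrow> 'e option) measure"] by (simp add: space_PiM)
  with sub1 sets_code show ?thesis by blast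
qed

lemma cylinder_in_sets:
  assumes "A \<subseteq> J" "finite A"
  shows "cylinder J A e \<in> sets (code_space J :: ('i \<Rightarrow> 'e::countable option) measure)"
proof -
  have "{\<sigma> \<in> space (code_space J). \<forall>i\<in>A. \<sigma> i = e i} \<in> sets (code_space J :: ('i \<Rightarrow> 'e option) measure)"
  proof (rule sets.sets_Collect_finite_All)
    fix i assume "i \<in> A"
    then show "{\<sigma> \<in> space (code_space J). \<sigma> i = e i} \<in> sets (code_space J :: ('i \<Rightarrow> 'e option) measure)"
      using assms by (intro measurable_sets_Collect[OF measurable_component_singleton, of _ _ _ "\<lambda>x. x = e i"]) auto
  qed (use assms in auto)
  then show ?thesis by (simp add: cylinder_eq space_PiM)
qed

text \<open>All functions are quantified over, not only those extensional on an index set; hence the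
  intersections with \<open>PiE\<close> in the lemmas below.\<close>

definition depends_on :: "'i set \<Rightarrow> ('i \<Rightarrow> 'c) set \<Rightarrow> bool" where
  "depends_on A B \<longleftrightarrow> (\<forall>\<sigma> \<tau>. (\<forall>i\<in>A. \<sigma> i = \<tau> i) \<longrightarrow> (\<sigma> \<in> B \<longleftrightarrow> \<tau> \<in> B))"

lemma countable_cylinders:
  assumes "finite A"
  shows "countable {cylinder J A e | e :: 'i \<Rightarrow> 'e::countable option. P e}"
proof -
  have *: "cylinder J A e \<in> cylinder J A ` (PiE A (\<lambda>_. UNIV))" for e :: "'i \<Rightarrow> 'e option"
    by (rule image_eqI[of _ _ "restrict e A"]) (auto simp: cylinder_eq)
  have "{cylinder J A e | e. P e} \<subseteq> cylinder J A ` (PiE A (\<lambda>_. UNIV :: 'e option set))"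
    using * by blast
  moreover have "countable (PiE A (\<lambda>_. UNIV :: 'e option set))"
    using assms by (intro countable_PiE) auto
  ultimately show ?thesis by (rule countable_subset[OF _ countable_image])
qed

lemma depends_on_eq_Union_cylinders:
  "depends_on A B \<Longrightarrow> B \<inter> PiE J (\<lambda>_. UNIV) = \<Union>{cylinder J A e | e. e \<in> B}"
  by (auto simp: cylinder_eq depends_on_def)

lemma depends_on_in_sigma:
  fixes B :: "('i \<Rightarrow> 'e::countable option) set"
  assumes "finite A" "depends_on A B" "\<And>e. e \<in> B \<Longrightarrow> cylinder J A e \<in> sets N"
  shows "B \<inter> PiE J (\<lambda>_. UNIV) \<in> sets N"
  unfolding depends_on_eq_Union_cylinders[OF assms(2)]
  using assms(3) by (intro sets.countable_Union countable_cylinders[OF assms(1)]) auto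

lemma depends_on_in_sets:
  fixes B :: "('i \<Rightarrow> 'e::countable option) set"
  assumes "finite A" "A \<subseteq> J" "depends_on A B"
  shows "B \<inter> PiE J (\<lambda>_. UNIV) \<in> sets (code_space J)"
  using assms by (intro depends_on_in_sigma[of A] cylinder_in_sets)

text \<open>Over increasing windows two cylinders are nested or disjoint, so adding the empty set
  makes them intersection-stable. The windows stay general in order to serve both {1..k} and
  {-k..k}.\<close>

lemma code_generator:
  fixes A :: "nat \<Rightarrow> 'i set" and J :: "'i set"
  assumes A: "\<And>k. finite (A k)" "incseq A" "(\<Union>k. A k) = J"
  defines "E \<equiv> insert {} {cylinder J (A k) e | k e. True} :: ('i \<Rightarrow> 'e::countable option) set set"
  shows code_generator_stable: "Int_stable E" and code_generator_Pow: "E \<subseteq> Pow (PiE J (\<lambda>_. UNIV))"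
    and code_generator_sets: "sets (code_space J) = sigma_sets (PiE J (\<lambda>_. UNIV)) E"
proof -
  let ?O = "PiE J (\<lambda>_. UNIV) :: ('i \<Rightarrow> 'e option) set"
  have cap: "cylinder J (A k) e \<inter> cylinder J (A l) e' \<in> E" if "k \<le> l" for k l and e e' :: "'i \<Rightarrow> 'e option"
  proof -
    have kl: "A k \<subseteq> A l" using A(2) that by (auto simp: incseq_def)
    show ?thesis
    proof (cases "\<forall>i\<in>A k. e i = e' i")
      case True
      then have "cylinder J (A k) e \<inter> cylinder J (A l) e' = cylinder J (A l) e'"
        using kl by (auto simp: cylinder_eq)
      then show ?thesis unfolding E_def by auto
    next
      case False
      then have "cylinder J (A k) e \<inter> cylinder J (A l) e' = {}"
        using kl by (force simp: cylinder_eq)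
      then show ?thesis unfolding E_def by auto
    qed
  qed
  show "Int_stable E"
  proof (rule Int_stableI)
    fix X Y :: "('i \<Rightarrow> 'e option) set" assume XY: "X \<in> E" "Y \<in> E"
    show "X \<inter> Y \<in> E"
    proof (cases "X = {} \<or> Y = {}")
      case True then show ?thesis unfolding E_def by auto
    next
      case False
      then obtain k e l e' where X: "X = cylinder J (A k) e" and Y: "Y = cylinder J (A l) e'"
        using XY unfolding E_def by blast
      show ?thesis
      proof (cases "k \<le> l")
        case True then show ?thesis unfolding X Y by (rule cap)
      next
        case False then show ?thesis unfolding X Y using cap[of l k e' e] by (simp add: Int_commute)
      qed
    qed
  qed
  show EP: "E \<subseteq> Pow ?O" unfolding E_def by (auto simp: cylinder_eq)
  have AJ: "A k \<subseteq> J" for k using A(3) by auto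
  show "sets (code_space J) = sigma_sets ?O E"
  proof (rule antisym)
    have "E \<subseteq> sets (code_space J)" unfolding E_def using AJ A(1) by (auto intro!: cylinder_in_sets)
    then show "sigma_sets ?O E \<subseteq> sets (code_space J)"
      using sets.sigma_sets_subset[of E "code_space J :: ('i \<Rightarrow> 'e option) measure"] by (simp add: space_PiM)
    interpret sa: sigma_algebra ?O "sigma_sets ?O E" by (rule sigma_algebra_sigma_sets[OF EP])
    show "sets (code_space J :: ('i \<Rightarrow> 'e option) measure) \<subseteq> sigma_sets ?O E"
      unfolding sets_PiM_single space_count_space
    proof (rule sa.sigma_sets_subset, safe)
      fix i and B :: "'e option set" assume "i \<in> J"
      then obtain k where k: "i \<in> A k" using A(3) by auto
      have "{f. f i \<in> B} \<inter> ?O \<in> sets (sigma ?O E)"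
        using EP k by (intro depends_on_in_sigma[OF A(1)[of k]]) (auto simp: depends_on_def E_def)
      then show "{f \<in> PiE J (\<lambda>_. UNIV). f i \<in> B} \<in> sigma_sets ?O E"
        using EP by (simp add: Int_def conj_commute)
    qed
  qed
qed

lemma code_measure_eqI:
  fixes P Q :: "('i \<Rightarrow> 'e::countable option) measure"
  assumes P: "sets P = sets (code_space J)" and Q: "sets Q = sets (code_space J)"
    and fin: "finite_measure P"
    and A: "\<And>k. finite (A k)" "incseq A" "(\<Union>k. A k) = J"
    and eq: "\<And>k e. emeasure P (cylinder J (A k) e) = emeasure Q (cylinder J (A k) e)"
  shows "P = Q"
proof (rule measure_eqI_generator_eq_countable
    [OF code_generator_stable[OF A] code_generator_Pow[OF A]])
  let ?E = "insert {} {cylinder J (A k) e | k e. True} :: ('i \<Rightarrow> 'e option) set set"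
  let ?O = "PiE J (\<lambda>_. UNIV) :: ('i \<Rightarrow> 'e option) set"
  show "emeasure P X = emeasure Q X" if "X \<in> ?E" for X using that eq by auto
  show "sets P = sigma_sets ?O ?E" "sets Q = sigma_sets ?O ?E"
    using P Q code_generator_sets[OF A] by simp_all
  let ?C = "{cylinder J (A 0) e | e. True} :: ('i \<Rightarrow> 'e option) set set"
  show "countable ?C" by (rule countable_cylinders) (rule A)
  show "?C \<subseteq> ?E" by auto
  show "\<Union>?C = ?O" by (auto simp: cylinder_eq)
  show "emeasure P a \<noteq> \<infinity>" if "a \<in> ?C" for a
    using finite_measure.emeasure_finite[OF fin] by simp
qed

subsection \<open>The path measures\<close>

lemma nn_integral_count_space_eq_infsum:
  assumes "countable A" and fA: "f summable_on A" "\<And>x. x \<in> A \<Longrightarrow> 0 \<le> f x"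
  shows "(\<integral>\<^sup>+x. ennreal (f x) \<partial>count_space A) = ennreal (infsum f A)"
proof -
  have "(\<integral>\<^sup>+x. ennreal (f x) \<partial>count_space A) = infsum (\<lambda>x. ennreal (f x)) A"
    using infsum_ennreal_eq_nn_integral[OF assms(1)] by simp
  also have "\<dots> = (SUP F\<in>{F. finite F \<and> F \<subseteq> A}. (\<Sum>x\<in>F. ennreal (f x)))"
    by (rule nonneg_infsum_complete) simp
  also have "\<dots> = (SUP F\<in>{F. finite F \<and> F \<subseteq> A}. ennreal (sum f F))"
    using fA(2) by (intro SUP_cong refl) (auto intro!: sum_ennreal)
  also have "\<dots> = ennreal (infsum f A)"
    by (rule infsum_nonneg_is_SUPREMUM_ennreal[symmetric, OF fA])
  finally show ?thesis .
qed

abbreviation future :: "(nat \<Rightarrow> 'e option) measure" where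
  "future \<equiv> code_space {1..}"

text \<open>The restriction to {1..} keeps the value inside the extensional space of
  \<open>future\<close>.\<close>

definition lcons :: "'e \<Rightarrow> (nat \<Rightarrow> 'e option) \<Rightarrow> nat \<Rightarrow> 'e option" where
  "lcons e \<tau> = (\<lambda>n\<in>{1..}. if n = 1 then Some e else \<tau> (n - 1))"

lemma lcons_1[simp]: "lcons e \<tau> (Suc 0) = Some e"
  and lcons_Suc_Suc[simp]: "lcons e \<tau> (Suc (Suc n)) = \<tau> (Suc n)"
  by (auto simp: lcons_def)

lemma measurable_future_apply[measurable]:
  "1 \<le> i \<Longrightarrow> (\<lambda>\<tau>. \<tau> i) \<in> future \<rightarrow>\<^sub>M count_space UNIV"
  by (rule measurable_component_singleton) simp

lemma measurable_lcons[measurable]: "lcons e \<in> future \<rightarrow>\<^sub>M future"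
  unfolding lcons_def[abs_def]
proof (rule measurable_restrict)
  fix n :: nat assume "n \<in> {1..}"
  then show "(\<lambda>\<tau>. if n = 1 then Some e else \<tau> (n - 1)) \<in> future \<rightarrow>\<^sub>M count_space UNIV"
    using measurable_future_apply[of "n - 1"] by (cases "n = 1") simp_all
qed

lemma orbit_cong: "(\<And>j. 1 \<le> j \<Longrightarrow> j \<le> k \<Longrightarrow> \<sigma> j = \<tau> j) \<Longrightarrow> orbit S \<sigma> k x = orbit S \<tau> k x"
  by (induction k) auto

lemma orbit_Suc_shift:
  "orbit S \<tau> (Suc k) x = orbit S (\<lambda>n. \<tau> (Suc n)) k (wmap_ext S (\<tau> 1) x)"
  by (induction k) auto

lemma orbit_lcons: "orbit S (lcons e \<tau>) (Suc k) x = orbit S \<tau> k (wmap S e x)"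
proof -
  have "orbit S (lcons e \<tau>) (Suc k) x = orbit S (\<lambda>n. lcons e \<tau> (Suc n)) k (wmap S e x)"
    by (subst orbit_Suc_shift) simp
  also have "\<dots> = orbit S \<tau> k (wmap S e x)"
  proof (rule orbit_cong)
    fix j :: nat assume "1 \<le> j" then show "lcons e \<tau> (Suc j) = \<tau> j" by (cases j) auto
  qed
  finally show ?thesis .
qed

lemma future_windows:
  "finite {1..Suc k}" "incseq (\<lambda>k. {1..Suc k})" "(\<Union>k. {1..Suc k}) = {1..}"
proof -
  show "(\<Union>k. {1..Suc k}) = {1..}"
  proof (intro equalityI subsetI)
    fix x :: nat assume "x \<in> {1..}" then have "x \<in> {1..Suc x}" by simp
    then show "x \<in> (\<Union>k. {1..Suc k})" by blast
  qed auto
qed (auto simp: incseq_def)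

locale msys =
  fixes S :: "('k::complete_space, 'e::countable, 'n) markov"
  assumes msys: "markov_system S"
begin

lemma measurable_wmap[measurable]: "wmap S e \<in> borel \<rightarrow>\<^sub>M borel"
  and measurable_wgt[measurable]: "wgt S e \<in> borel_measurable borel"
  and wgt_nonneg[simp]: "0 \<le> wgt S e x" and wgt_le_1[simp]: "wgt S e x \<le> 1"
  and wgt_has_sum: "((\<lambda>e. wgt S e x) has_sum 1) UNIV"
  and sets_cell[measurable]: "cell S j \<in> sets borel"
  and disjoint_cells: "disjoint_family (cell S)" and Union_cells: "(\<Union>j. cell S j) = UNIV"
  and surj_src: "surj (src S)"
  and wgt_pos_ex: "\<exists>x. 0 < wgt S e x"
  and wgt_pos_cell: "0 < wgt S e x \<Longrightarrow> x \<in> cell S (src S e)"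
  and wmap_cell: "x \<in> cell S (src S e) \<Longrightarrow> wmap S e x \<in> cell S (tgt S e)"
  using msys unfolding markov_system_def by (auto simp: image_subset_iff simp del: ex_in_conv)

lemma cell_unique: "x \<in> cell S i \<Longrightarrow> x \<in> cell S j \<Longrightarrow> i = j"
  using disjoint_cells by (auto simp: disjoint_family_on_def)

lemma ex_cell: "\<exists>j. x \<in> cell S j" using Union_cells by auto

lemma wgt_0: "x \<notin> cell S (src S e) \<Longrightarrow> wgt S e x = 0"
  using wgt_pos_cell[of e x] wgt_nonneg[of e x] by linarith

lemma countable_vertices: "countable (UNIV :: 'n set)"
  using surj_src countable_image[of "UNIV :: 'e set" "src S"] by simp

lemma nn_integral_wgt: "(\<integral>\<^sup>+e. ennreal (wgt S e x) \<partial>count_space UNIV) = 1"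
  using nn_integral_count_space_eq_infsum[of UNIV "\<lambda>e. wgt S e x"] wgt_has_sum[of x]
  by (simp add: infsumI has_sum_imp_summable)

definition edge_pmf :: "'k \<Rightarrow> 'e pmf" where
  "edge_pmf x = embed_pmf (\<lambda>e. wgt S e x)"

lemma pmf_edge_pmf[simp]: "pmf (edge_pmf x) e = wgt S e x"
  unfolding edge_pmf_def by (rule pmf_embed_pmf) (auto simp: nn_integral_wgt)

lemma wgt_ext_nonneg[simp]: "0 \<le> wgt_ext S e x" by (cases e) auto

lemma measurable_wmap_ext[measurable]: "wmap_ext S e \<in> borel \<rightarrow>\<^sub>M borel" by (cases e) auto
lemma measurable_wgt_ext[measurable]: "wgt_ext S e \<in> borel_measurable borel" by (cases e) auto

lemma measurable_orbit:
  assumes g: "g \<in> N \<rightarrow>\<^sub>M borel" and s: "\<And>i. 1 \<le> i \<Longrightarrow> i \<le> k \<Longrightarrow> (\<lambda>\<omega>. s \<omega> i) \<in> N \<rightarrow>\<^sub>M count_space UNIV"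
  shows "(\<lambda>\<omega>. orbit S (s \<omega>) k (g \<omega>)) \<in> N \<rightarrow>\<^sub>M borel"
  using s
proof (induction k)
  case 0 then show ?case using g by simp
next
  case (Suc k)
  have [measurable]: "(\<lambda>\<omega>. orbit S (s \<omega>) k (g \<omega>)) \<in> N \<rightarrow>\<^sub>M borel" using Suc by auto
  have [measurable]: "(\<lambda>\<omega>. s \<omega> (Suc k)) \<in> N \<rightarrow>\<^sub>M count_space UNIV" using Suc by auto
  have "(\<lambda>\<omega>. wmap_ext S (s \<omega> (Suc k)) (orbit S (s \<omega>) k (g \<omega>))) \<in> N \<rightarrow>\<^sub>M borel"
    by (rule measurable_compose_countable[of "\<lambda>e \<omega>. wmap_ext S e (orbit S (s \<omega>) k (g \<omega>))"]) measurable
  then show ?case by simp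
qed

section \<open>Cylinder probabilities and existence of the path measures\<close>

definition cyl_prob :: "'k \<Rightarrow> (nat \<Rightarrow> 'e option) \<Rightarrow> nat \<Rightarrow> real" where
  "cyl_prob x e k = (\<Prod>j=1..k. wgt_ext S (e j) (orbit S e (j - 1) x))"

lemma cyl_prob_0[simp]: "cyl_prob x e 0 = 1"
  and cyl_prob_Suc[simp]: "cyl_prob x e (Suc k) = cyl_prob x e k * wgt_ext S (e (Suc k)) (orbit S e k x)"
  by (auto simp: cyl_prob_def)

lemma cyl_prob_nonneg[simp]: "0 \<le> cyl_prob x e k" by (induction k) auto

text \<open>The definition splits off the last letter, as the Ionescu-Tulcea extension does;
  inductions that vary the starting point need the first letter instead.\<close>

lemma cyl_prob_Suc_shift:
  "cyl_prob x e (Suc k) = wgt_ext S (e 1) x * cyl_prob (wmap_ext S (e 1) x) (\<lambda>n. e (Suc n)) k"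
proof (induction k)
  case (Suc k)
  have "cyl_prob x e (Suc (Suc k)) = cyl_prob x e (Suc k) * wgt_ext S (e (Suc (Suc k))) (orbit S e (Suc k) x)"
    by (rule cyl_prob_Suc)
  also have "\<dots> = wgt_ext S (e 1) x * cyl_prob (wmap_ext S (e 1) x) (\<lambda>n. e (Suc n)) (Suc k)"
    unfolding Suc orbit_Suc_shift[of S e k x] by (simp add: mult_ac)
  finally show ?case .
qed simp

lemma cyl_prob_cong: "(\<And>j. 1 \<le> j \<Longrightarrow> j \<le> k \<Longrightarrow> e j = e' j) \<Longrightarrow> cyl_prob x e k = cyl_prob x e' k"
  unfolding cyl_prob_def by (intro prod.cong refl arg_cong2[of _ _ _ _ "wgt_ext S"] orbit_cong) auto

lemma measurable_cyl_prob[measurable]: "(\<lambda>x. cyl_prob x e k) \<in> borel_measurable borel"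
proof (induction k)
  case (Suc k)
  note [measurable] = this measurable_orbit[OF measurable_ident, of k "\<lambda>_. e" for k]
  have "(\<lambda>x. orbit S e k x) \<in> borel \<rightarrow>\<^sub>M borel"
    using measurable_orbit[of "\<lambda>x. x" borel k "\<lambda>_. e"] by simp
  note [measurable] = measurable_compose[OF this measurable_wgt_ext]
  show ?case by simp
qed simp

text \<open>Histories in the Ionescu-Tulcea construction start at index 0, codes at index 1; hence
  the shift \<open>n - 1\<close>.\<close>

definition step_kernel :: "'k \<Rightarrow> nat \<Rightarrow> (nat \<Rightarrow> 'e option) \<Rightarrow> 'e option measure" where
  "step_kernel x i \<omega> = measure_pmf (map_pmf Some (edge_pmf (orbit S (\<lambda>n. \<omega> (n - 1)) i x)))"

lemma emeasure_step_kernel: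
  "emeasure (step_kernel x i \<omega>) {c} = ennreal (wgt_ext S c (orbit S (\<lambda>n. \<omega> (n - 1)) i x))"
proof (cases c)
  case None
  then show ?thesis by (simp add: step_kernel_def vimage_def)
next
  case (Some e)
  then have "Some -` {c} = {e}" by auto
  with Some show ?thesis by (simp add: step_kernel_def emeasure_pmf_single)
qed

lemma Ionescu_Tulcea_step_kernel: "Ionescu_Tulcea (step_kernel x) (\<lambda>_. count_space UNIV)"
proof (rule Ionescu_Tulcea.intro)
  fix i :: nat
  have "PiM {0..<i} (\<lambda>_. count_space (UNIV::'e option set)) = count_space (PiE {0..<i} (\<lambda>_. UNIV))"
    by (rule count_space_PiM_finite) auto
  then show "step_kernel x i \<in> PiM {0..<i} (\<lambda>_. count_space UNIV) \<rightarrow>\<^sub>M subprob_algebra (count_space UNIV)"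
    by (auto simp: step_kernel_def space_subprob_algebra intro!: prob_space_imp_subprob_space measure_pmf.prob_space_axioms)
  show "prob_space (step_kernel x i \<omega>)" for \<omega>
    by (simp add: step_kernel_def measure_pmf.prob_space_axioms)
qed

lemma ex_path_measure:
  "\<exists>P. sets P = sets (future :: (nat \<Rightarrow> 'e option) measure) \<and> prob_space P \<and>
     (\<forall>k e. emeasure P (cylinder {1..} {1..k} e) = ennreal (cyl_prob x e k))"
proof -
  interpret IT: Ionescu_Tulcea "step_kernel x" "\<lambda>_. count_space UNIV" by (rule Ionescu_Tulcea_step_kernel)
  let ?U = "\<lambda>_::nat. undefined :: 'e option"
  have U: "?U \<in> space (PiM {0..<0} (\<lambda>_. count_space UNIV))" by (simp add: space_PiM)
  have sing: "{restrict e {0..<k}} \<in> sets (PiM {0..<k} (\<lambda>_. count_space UNIV))" for e :: "nat \<Rightarrow> 'e option" and k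
    by (subst count_space_PiM_finite) auto
  have C: "emeasure (IT.C 0 k ?U) {restrict e {0..<k}} = ennreal (cyl_prob x (\<lambda>n. e (n - 1)) k)" for k e
  proof (induction k)
    case 0
    have "restrict e {0..<0} = ?U" by auto
    moreover have "{?U} \<in> sets (PiM {} (\<lambda>_. count_space (UNIV :: 'e option set)))"
      by (simp add: sets_PiM_empty)
    ultimately show ?case by simp
  next
    case (Suc k)
    have K: "IT.eP k \<in> IT.C 0 k ?U \<rightarrow>\<^sub>M subprob_algebra (PiM {0..<Suc k} (\<lambda>_. count_space UNIV))"
      using IT.measurable_eP[of k] IT.sets_C[OF U, of k]
      by (subst measurable_cong_sets[OF _ refl, where M'="PiM {0..<k} (\<lambda>_. count_space UNIV)"]) simp_all
    have "emeasure (IT.C 0 (Suc k) ?U) {restrict e {0..<Suc k}} =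
      (\<integral>\<^sup>+\<omega>. emeasure (IT.eP k \<omega>) {restrict e {0..<Suc k}} \<partial>IT.C 0 k ?U)"
      unfolding IT.C.simps add_0
      by (rule emeasure_bind[OF IT.prob_space_C[OF U, THEN prob_space.not_empty] K sing])
    also have "\<dots> = (\<integral>\<^sup>+\<omega>. ennreal (wgt_ext S (e k) (orbit S (\<lambda>n. e (n - 1)) k x)) * indicator {restrict e {0..<k}} \<omega> \<partial>IT.C 0 k ?U)"
    proof (rule nn_integral_cong)
      fix \<omega> assume "\<omega> \<in> space (IT.C 0 k ?U)"
      then have \<omega>: "\<omega> \<in> space (PiM {0..<k} (\<lambda>_. count_space UNIV))" using IT.space_C[OF U, of k] by simp
      then have ext: "\<omega> \<in> PiE {0..<k} (\<lambda>_. UNIV)" by (simp add: space_PiM)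
      have "emeasure (IT.eP k \<omega>) {restrict e {0..<Suc k}} = emeasure (step_kernel x k \<omega>) {c. fun_upd \<omega> k c = restrict e {0..<Suc k}}"
        using IT.emeasure_eP[OF \<omega> sing[of e "Suc k"]] by (simp add: vimage_def)
      also have "{c. fun_upd \<omega> k c = restrict e {0..<Suc k}} = (if \<omega> = restrict e {0..<k} then {e k} else {})"
      proof (cases "\<omega> = restrict e {0..<k}")
        case True then show ?thesis by (auto simp: fun_eq_iff)
      next
        case False
        have "fun_upd \<omega> k c \<noteq> restrict e {0..<Suc k}" for c
        proof
          assume eq: "fun_upd \<omega> k c = restrict e {0..<Suc k}"
          have "\<omega> i = restrict e {0..<k} i" for i
            using fun_cong[OF eq, of i] ext by (cases "i < k") (auto simp: PiE_def extensional_def split: if_splits)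
          with False show False by auto
        qed
        with False show ?thesis by auto
      qed
      also have "emeasure (step_kernel x k \<omega>) \<dots> = ennreal (wgt_ext S (e k) (orbit S (\<lambda>n. e (n - 1)) k x)) * indicator {restrict e {0..<k}} \<omega>"
      proof (cases "\<omega> = restrict e {0..<k}")
        case True
        have "orbit S (\<lambda>n. restrict e {0..<k} (n - 1)) k x = orbit S (\<lambda>n. e (n - 1)) k x"
          by (rule orbit_cong) auto
        then show ?thesis using True by (simp add: emeasure_step_kernel)
      qed simp
      finally show "emeasure (IT.eP k \<omega>) {restrict e {0..<Suc k}} = \<dots>" .
    qed
    also have "\<dots> = ennreal (wgt_ext S (e k) (orbit S (\<lambda>n. e (n - 1)) k x)) * ennreal (cyl_prob x (\<lambda>n. e (n - 1)) k)"
      using sing[of e k] IT.sets_C[OF U, of k] by (subst nn_integral_cmult_indicator) (simp_all only: Suc add_0)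
    also have "\<dots> = ennreal (cyl_prob x (\<lambda>n. e (n - 1)) (Suc k))" by (simp add: ennreal_mult' mult.commute)
    finally show ?case .
  qed
  \<comment> \<open>Moves the sequence from indices 0, 1, ... to 1, 2, ... and makes it extensional
    on {1..}.\<close>
  let ?h = "\<lambda>\<omega>. \<lambda>n\<in>{1..}. \<omega> (n - 1)"
  have h[measurable]: "?h \<in> IT.PF.lim \<rightarrow>\<^sub>M (future :: (nat \<Rightarrow> 'e option) measure)"
    by (auto intro!: measurable_restrict simp: measurable_cong_sets[OF IT.PF.sets_lim refl])
  define P where "P = distr IT.PF.lim (future :: (nat \<Rightarrow> 'e option) measure) ?h"
  have cylP: "emeasure P (cylinder {1..} {1..k} e) = ennreal (cyl_prob x e k)" for k e
  proof -
    let ?e = "\<lambda>n. e (Suc n)"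
    have "emeasure P (cylinder {1..} {1..k} e) = emeasure IT.PF.lim (?h -` cylinder {1..} {1..k} e \<inter> space IT.PF.lim)"
      unfolding P_def by (rule emeasure_distr[OF h cylinder_in_sets]) auto
    also have "?h -` cylinder {1..} {1..k} e \<inter> space IT.PF.lim
        = prod_emb UNIV (\<lambda>_. count_space UNIV) {0..<k} {restrict ?e {0..<k}}"
    proof -
      have "(\<forall>i\<in>{1..k}. ?h \<omega> i = e i) \<longleftrightarrow> restrict \<omega> {0..<k} = restrict ?e {0..<k}" for \<omega> :: "nat \<Rightarrow> 'e option"
      proof
        assume *: "\<forall>i\<in>{1..k}. ?h \<omega> i = e i"
        have "\<omega> i = ?e i" if "i < k" for i using *[rule_format, of "Suc i"] that by simp
        then show "restrict \<omega> {0..<k} = restrict ?e {0..<k}" by (intro restrict_ext) auto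
      next
        assume *: "restrict \<omega> {0..<k} = restrict ?e {0..<k}"
        show "\<forall>i\<in>{1..k}. ?h \<omega> i = e i"
        proof
          fix i assume i: "i \<in> {1..k}"
          then show "?h \<omega> i = e i" using fun_cong[OF *, of "i - 1"] by (cases i) auto
        qed
      qed
      then show ?thesis by (auto simp: prod_emb_def cylinder_eq space_PiM)
    qed
    also have "emeasure IT.PF.lim \<dots> = emeasure (IT.CI {0..<k}) {restrict ?e {0..<k}}"
      by (rule IT.lim[OF _ sing]) simp
    also have "\<dots> = emeasure (IT.C 0 k ?U) (prod_emb {0..<k} (\<lambda>_. count_space UNIV) {0..<k} {restrict ?e {0..<k}})"
      by (rule IT.emeasure_CI[OF order_refl sing])
    also have "prod_emb {0..<k} (\<lambda>_. count_space UNIV) {0..<k} {restrict ?e {0..<k}} = {restrict ?e {0..<k}}"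
      by (rule prod_emb_id) auto
    also have "emeasure (IT.C 0 k ?U) \<dots> = ennreal (cyl_prob x (\<lambda>n. ?e (n - 1)) k)" by (rule C)
    also have "cyl_prob x (\<lambda>n. ?e (n - 1)) k = cyl_prob x e k" by (rule cyl_prob_cong) auto
    finally show ?thesis .
  qed
  have setsP: "sets P = sets (future :: (nat \<Rightarrow> 'e option) measure)" by (simp add: P_def)
  have "cylinder {1..} {1..0} (\<lambda>_. None :: 'e option) = space P"
    by (auto simp: P_def cylinder_eq space_PiM)
  then have "prob_space P" using cylP[of 0 "\<lambda>_. None"] by (auto intro: prob_spaceI)
  with cylP setsP show ?thesis by blast
qed

lemma future_measure_eqI:
  assumes "sets P = sets (future :: (nat \<Rightarrow> 'e option) measure)" "sets Q = sets (future :: (nat \<Rightarrow> 'e option) measure)"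
    "finite_measure P" "\<And>k e. 1 \<le> k \<Longrightarrow> emeasure P (cylinder {1..} {1..k} e) = emeasure Q (cylinder {1..} {1..k} e)"
  shows "P = Q"
  by (rule code_measure_eqI[OF assms(1-3) future_windows]) (rule assms(4), simp)

text \<open>Existence and uniqueness on cylinders resolve the definite description; later proofs
  rely on these facts instead of the definition.\<close>

lemma path_measure: 
  shows sets_path_measure[simp, measurable_cong]: "sets (path_measure S x) = sets future"
  and prob_space_path_measure: "prob_space (path_measure S x)"
  and emeasure_path_cylinder: "emeasure (path_measure S x) (cylinder {1..} {1..k} e) = ennreal (cyl_prob x e k)"
proof -
  let ?P = "\<lambda>P. sets P = sets (code_borel {1..}) \<and> prob_space P \<and>
     (\<forall>k\<ge>1. \<forall>e. emeasure P (cylinder {1..} {1..k} e) =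
        ennreal (\<Prod>j=1..k. wgt_ext S (e j) (orbit S e (j - 1) x)))"
  have sc: "sets (code_borel {1..} :: (nat \<Rightarrow> 'e option) measure) = sets future" by (rule sets_code_borel) simp
  obtain P where P: "sets P = sets (future :: (nat \<Rightarrow> 'e option) measure)" "prob_space P"
     "\<And>k e. emeasure P (cylinder {1..} {1..k} e) = ennreal (cyl_prob x e k)" using ex_path_measure by blast
  have "path_measure S x = P"
    unfolding path_measure_def
  proof (rule the_equality)
    show "?P P" using P sc by (auto simp: cyl_prob_def)
    fix Q assume Q: "?P Q"
    then interpret Q: prob_space Q by blast
    show "Q = P" using Q P sc Q.finite_measure_axioms by (intro future_measure_eqI) (auto simp: cyl_prob_def)
  qed
  with P show "sets (path_measure S x) = sets future" "prob_space (path_measure S x)"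
    "emeasure (path_measure S x) (cylinder {1..} {1..k} e) = ennreal (cyl_prob x e k)" by auto
qed

sublocale path: prob_space "path_measure S x" for x by (rule prob_space_path_measure)

lemma space_path_measure: "space (path_measure S x) = PiE {1..} (\<lambda>_. UNIV)"
  using sets_eq_imp_space_eq[OF sets_path_measure] by (simp add: space_PiM)

lemma lcons_in_PiE[simp]: "lcons e \<tau> \<in> PiE {Suc 0..} (\<lambda>_. UNIV)" by (auto simp: lcons_def)

lemma lcons_vimage_cylinder:
  assumes "1 \<le> k"
  shows "lcons e -` cylinder {1..} {1..k} c \<inter> PiE {1..} (\<lambda>_. UNIV) =
    (if c 1 = Some e then cylinder {1..} {1..k - 1} (\<lambda>n. c (Suc n)) else {})"
proof -
  have "(\<forall>i\<in>{1..k}. lcons e \<tau> i = c i) \<longleftrightarrow> c 1 = Some e \<and> (\<forall>i\<in>{1..k-1}. \<tau> i = c (Suc i))" for \<tau>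
  proof
    assume *: "\<forall>i\<in>{1..k}. lcons e \<tau> i = c i"
    have "\<tau> i = c (Suc i)" if "i \<in> {1..k-1}" for i
      using *[rule_format, of "Suc i"] that by (cases i) auto
    moreover have "c 1 = Some e" using *[rule_format, of 1] assms by simp
    ultimately show "c 1 = Some e \<and> (\<forall>i\<in>{1..k-1}. \<tau> i = c (Suc i))" by blast
  next
    assume *: "c 1 = Some e \<and> (\<forall>i\<in>{1..k-1}. \<tau> i = c (Suc i))"
    show "\<forall>i\<in>{1..k}. lcons e \<tau> i = c i"
    proof
      fix i assume i: "i \<in> {1..k}"
      show "lcons e \<tau> i = c i"
      proof (cases "i = 1")
        case False
        then have "i - 1 \<in> {1..k-1}" "i = Suc (Suc (i - 2))" using i by auto
        then show ?thesis using * by (metis diff_Suc_1 lcons_Suc_Suc)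
      qed (use * in simp)
    qed
  qed
  then show ?thesis by (auto simp: cylinder_eq set_eq_iff simp del: PiE_iff)
qed

section \<open>Disintegration of the path measures by the first letter\<close>

lemma measurable_lcons_path: "lcons e \<in> path_measure S x \<rightarrow>\<^sub>M future"
  by (subst measurable_cong_sets[OF sets_path_measure refl]) (rule measurable_lcons)

lemma measurable_lcons_kernel:
  "(\<lambda>e. distr (path_measure S (wmap S e x)) future (lcons e)) \<in> measure_pmf p \<rightarrow>\<^sub>M subprob_algebra future"
proof -
  have "distr (path_measure S (wmap S e x)) future (lcons e) \<in> space (subprob_algebra future)" for e
    unfolding space_subprob_algebra
    using path.prob_space_distr[OF measurable_lcons_path] by (auto intro: prob_space_imp_subprob_space)
  then show ?thesis by simp
qed

text \<open>The Markov property at time one, checked on cylinders. An orbit of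
  \<open>lcons e \<tau>\<close> from x continues as the orbit of \<tau> from
  \<open>wmap S e x\<close>, so this identity drives the later inductions that vary the starting
  point.\<close>

lemma path_measure_step:
  "path_measure S x = measure_pmf (edge_pmf x) \<bind> (\<lambda>e. distr (path_measure S (wmap S e x)) future (lcons e))"
proof (rule future_measure_eqI)
  let ?N = "measure_pmf (edge_pmf x) \<bind> (\<lambda>e. distr (path_measure S (wmap S e x)) future (lcons e))"
  show "sets ?N = sets future" by (rule sets_bind[where N=future]) auto
  show "finite_measure (path_measure S x)" by (rule path.finite_measure_axioms)
  show "sets (path_measure S x) = sets future" by simp
  fix k :: nat and c :: "nat \<Rightarrow> 'e option" assume k: "1 \<le> k"
  have "emeasure ?N (cylinder {1..} {1..k} c)
      = (\<integral>\<^sup>+e. emeasure (distr (path_measure S (wmap S e x)) future (lcons e)) (cylinder {1..} {1..k} c) \<partial>measure_pmf (edge_pmf x))"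
    by (rule emeasure_bind[OF _ measurable_lcons_kernel cylinder_in_sets]) auto
  also have "\<dots> = (\<integral>\<^sup>+e. (if c 1 = Some e then ennreal (cyl_prob (wmap S e x) (\<lambda>n. c (Suc n)) (k - 1)) else 0) \<partial>measure_pmf (edge_pmf x))"
  proof (rule nn_integral_cong)
    fix e
    have "emeasure (distr (path_measure S (wmap S e x)) future (lcons e)) (cylinder {1..} {1..k} c)
      = emeasure (path_measure S (wmap S e x)) (lcons e -` cylinder {1..} {1..k} c \<inter> PiE {1..} (\<lambda>_. UNIV))"
      unfolding space_path_measure[symmetric, of "wmap S e x"]
      by (rule emeasure_distr[OF measurable_lcons_path cylinder_in_sets]) auto
    then show "emeasure (distr (path_measure S (wmap S e x)) future (lcons e)) (cylinder {1..} {1..k} c)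
      = (if c 1 = Some e then ennreal (cyl_prob (wmap S e x) (\<lambda>n. c (Suc n)) (k - 1)) else 0)"
      unfolding lcons_vimage_cylinder[OF k] using emeasure_path_cylinder by simp
  qed
  also have "\<dots> = ennreal (cyl_prob x c k)"
  proof (cases "c 1")
    case None
    obtain k' where k': "k = Suc k'" using k by (cases k) auto
    show ?thesis unfolding k' cyl_prob_Suc_shift using None by simp
  next
    case (Some e0)
    obtain k' where k': "k = Suc k'" using k by (cases k) auto
    have "(\<integral>\<^sup>+e. (if c 1 = Some e then ennreal (cyl_prob (wmap S e x) (\<lambda>n. c (Suc n)) (k - 1)) else 0) \<partial>measure_pmf (edge_pmf x))
      = (\<integral>\<^sup>+e. ennreal (cyl_prob (wmap S e0 x) (\<lambda>n. c (Suc n)) (k - 1)) * indicator {e0} e \<partial>measure_pmf (edge_pmf x))"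
      using Some by (intro nn_integral_cong) (auto split: split_indicator)
    also have "\<dots> = ennreal (cyl_prob (wmap S e0 x) (\<lambda>n. c (Suc n)) (k - 1)) * ennreal (wgt S e0 x)"
      by (simp add: nn_integral_cmult_indicator emeasure_pmf_single)
    also have "\<dots> = ennreal (cyl_prob x c k)"
      unfolding k' cyl_prob_Suc_shift using Some by (simp add: ennreal_mult' mult.commute)
    finally show ?thesis .
  qed
  finally show "emeasure (path_measure S x) (cylinder {1..} {1..k} c) = emeasure ?N (cylinder {1..} {1..k} c)"
    using emeasure_path_cylinder by simp
qed

lemma nn_integral_path_step:
  assumes [measurable]: "f \<in> borel_measurable future"
  shows "(\<integral>\<^sup>+\<tau>. f \<tau> \<partial>path_measure S x) =
    (\<integral>\<^sup>+e. ennreal (wgt S e x) * (\<integral>\<^sup>+\<tau>. f (lcons e \<tau>) \<partial>path_measure S (wmap S e x)) \<partial>count_space UNIV)"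
proof -
  have "(\<integral>\<^sup>+\<tau>. f \<tau> \<partial>path_measure S x) = (\<integral>\<^sup>+e. (\<integral>\<^sup>+\<tau>. f \<tau> \<partial>distr (path_measure S (wmap S e x)) future (lcons e)) \<partial>measure_pmf (edge_pmf x))"
    by (subst path_measure_step) (rule nn_integral_bind[OF assms measurable_lcons_kernel])
  also have "\<dots> = (\<integral>\<^sup>+e. (\<integral>\<^sup>+\<tau>. f (lcons e \<tau>) \<partial>path_measure S (wmap S e x)) \<partial>measure_pmf (edge_pmf x))"
    by (intro nn_integral_cong nn_integral_distr measurable_lcons_path) (simp only: measurable_distr_eq1 assms)
  finally show ?thesis by (simp add: nn_integral_measure_pmf)
qed

lemma AE_path_step:
  assumes P[measurable]: "Measurable.pred future P"
  shows "(AE \<tau> in path_measure S x. P \<tau>) \<longleftrightarrow>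
    (\<forall>e. 0 < wgt S e x \<longrightarrow> (AE \<tau> in path_measure S (wmap S e x). P (lcons e \<tau>)))"
proof -
  have "(AE \<tau> in path_measure S x. P \<tau>) \<longleftrightarrow>
     (AE e in measure_pmf (edge_pmf x). AE \<tau> in distr (path_measure S (wmap S e x)) future (lcons e). P \<tau>)"
    by (subst path_measure_step) (rule AE_bind[OF measurable_lcons_kernel P])
  also have "\<dots> \<longleftrightarrow> (\<forall>e\<in>set_pmf (edge_pmf x). AE \<tau> in path_measure S (wmap S e x). P (lcons e \<tau>))"
    unfolding AE_measure_pmf_iff by (intro ball_cong refl AE_distr_iff measurable_lcons_path) measurable
  finally show ?thesis by (auto simp: set_pmf_iff less_le)
qed

text \<open>Makes the path measures a kernel that can be integrated over a random starting point; it
  suffices that cylinder probabilities depend measurably on that point.\<close>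

lemma measurable_path_measure[measurable]: "path_measure S \<in> borel \<rightarrow>\<^sub>M prob_algebra future"
proof (rule measurable_prob_algebra_generated)
  note A = future_windows
  show "sets (future :: (nat \<Rightarrow> 'e option) measure) = sigma_sets (PiE {1..} (\<lambda>_. UNIV)) (insert {} {cylinder {1..} {1..Suc k} e |k e. True})"
    by (rule code_generator_sets[OF A])
  show "Int_stable (insert {} {cylinder {1..} {1..Suc k} e |k e. True} :: (nat \<Rightarrow> 'e option) set set)"
    by (rule code_generator_stable[OF A])
  show "(insert {} {cylinder {1..} {1..Suc k} e |k e. True} :: (nat \<Rightarrow> 'e option) set set) \<subseteq> Pow (PiE {1..} (\<lambda>_. UNIV))"
    by (rule code_generator_Pow[OF A])
  show "prob_space (path_measure S a)" for a by (rule prob_space_path_measure)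
  show "sets (path_measure S a) = sets future" for a by simp
  fix B :: "(nat \<Rightarrow> 'e option) set" assume "B \<in> insert {} {cylinder {1..} {1..Suc k} e |k e. True}"
  then consider "B = {}" | k e where "B = cylinder {1..} {1..Suc k} e" by blast
  then show "(\<lambda>a. emeasure (path_measure S a) B) \<in> borel_measurable borel"
  proof cases
    case 2 show ?thesis unfolding 2 emeasure_path_cylinder by measurable
  qed simp
qed

end

subsection \<open>Orbits under the path measures\<close>

declare One_nat_def [simp del]

text \<open>A finite window over a countable alphabet takes countably many values, so every preimage
  is a countable union of cylinders.\<close>

lemma measurable_finite_coords:
  fixes g :: "('i \<Rightarrow> 'e::countable option) \<Rightarrow> 'b"
  assumes "finite A" "A \<subseteq> J" and g: "\<And>\<sigma> \<tau>. (\<And>i. i \<in> A \<Longrightarrow> \<sigma> i = \<tau> i) \<Longrightarrow> g \<sigma> = g \<tau>"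
    and sp: "\<And>\<sigma>. g \<sigma> \<in> space N"
  shows "g \<in> code_space J \<rightarrow>\<^sub>M N"
proof (rule measurableI)
  fix B assume "B \<in> sets N"
  have "depends_on A (g -` B)" unfolding depends_on_def using g by (metis vimage_eq)
  then show "g -` B \<inter> space (code_space J) \<in> sets (code_space J)"
    using depends_on_in_sets[OF assms(1,2)] by (simp add: space_PiM)
qed (rule sp)

lemma lcons_one[simp]: "lcons e \<tau> 1 = Some e"
  by (simp add: lcons_def)

context msys
begin

lemma measurable_orbit_finite:
  assumes "\<And>x. h x \<in> space N"
  shows "(\<lambda>\<tau>. h (orbit S \<tau> k x)) \<in> (future :: (nat \<Rightarrow> 'e option) measure) \<rightarrow>\<^sub>M N"
  by (rule measurable_finite_coords[where A="{1..k}"])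
     (auto intro!: arg_cong[where f=h] orbit_cong assms)

lemma measurable_orbits:
  assumes "\<And>u v. h u v \<in> space N"
  shows "(\<lambda>\<tau>. h (orbit S \<tau> k x) (orbit S \<tau> k y)) \<in> (future :: (nat \<Rightarrow> 'e option) measure) \<rightarrow>\<^sub>M N"
  by (rule measurable_finite_coords[where A="{1..k}"])
     (auto intro!: arg_cong2[where f=h] orbit_cong assms)

lemma measurable_cyl_probs:
  assumes "\<And>u v. h u v \<in> space N"
  shows "(\<lambda>\<tau>. h (cyl_prob x \<tau> k) (cyl_prob y \<tau> k)) \<in> (future :: (nat \<Rightarrow> 'e option) measure) \<rightarrow>\<^sub>M N"
  by (rule measurable_finite_coords[where A="{1..k}"])
     (auto intro!: arg_cong2[where f=h] cyl_prob_cong assms)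

lemma measurable_letter_orbit:
  assumes "\<And>c x. h c x \<in> space N"
  shows "(\<lambda>\<tau>. h (\<tau> (Suc k)) (orbit S \<tau> k x)) \<in> (future :: (nat \<Rightarrow> 'e option) measure) \<rightarrow>\<^sub>M N"
proof (rule measurable_finite_coords[where A="{1..Suc k}"])
  fix \<sigma> \<tau> :: "nat \<Rightarrow> 'e option" assume *: "\<And>i. i \<in> {1..Suc k} \<Longrightarrow> \<sigma> i = \<tau> i"
  have "orbit S \<sigma> k x = orbit S \<tau> k x" by (rule orbit_cong) (use * in auto)
  moreover have "\<sigma> (Suc k) = \<tau> (Suc k)" by (rule *) simp
  ultimately show "h (\<sigma> (Suc k)) (orbit S \<sigma> k x) = h (\<tau> (Suc k)) (orbit S \<tau> k x)" by simp
qed (auto simp: assms)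

lemma measurable_orbit_pair[measurable]:
  "(\<lambda>(x, \<tau>). orbit S \<tau> k x) \<in> borel \<Otimes>\<^sub>M future \<rightarrow>\<^sub>M borel"
  unfolding split_beta'
  by (rule measurable_orbit) (auto intro!: measurable_compose[OF measurable_snd measurable_future_apply])

lemma measurable_letter_orbit_pair:
  assumes [measurable]: "\<And>c. h c \<in> borel \<rightarrow>\<^sub>M N"
  shows "(\<lambda>(x, \<tau>). h (\<tau> (Suc k)) (orbit S \<tau> k x)) \<in> borel \<Otimes>\<^sub>M future \<rightarrow>\<^sub>M N"
proof -
  have [measurable]: "(\<lambda>p. snd p (Suc k)) \<in> borel \<Otimes>\<^sub>M (future :: (nat \<Rightarrow> 'e option) measure) \<rightarrow>\<^sub>M count_space UNIV"
    by (rule measurable_compose[OF measurable_snd measurable_future_apply]) simp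
  have "(\<lambda>p. h c (orbit S (snd p) k (fst p))) \<in> borel \<Otimes>\<^sub>M future \<rightarrow>\<^sub>M N" for c
    using measurable_compose[OF measurable_orbit_pair assms] by (simp add: split_beta')
  then show ?thesis unfolding split_beta'
    by (rule measurable_compose_countable) measurable
qed

definition follows :: "'k \<Rightarrow> (nat \<Rightarrow> 'e option) \<Rightarrow> bool" where
  "follows x \<tau> \<longleftrightarrow> (\<forall>n. 0 < wgt_ext S (\<tau> (Suc n)) (orbit S \<tau> n x))"

lemma AE_follows: "AE \<tau> in path_measure S x. follows x \<tau>"
  unfolding follows_def AE_all_countable
proof
  fix n
  show "AE \<tau> in path_measure S x. 0 < wgt_ext S (\<tau> (Suc n)) (orbit S \<tau> n x)"
  proof (induction n arbitrary: x)
    case 0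
    have "Measurable.pred (future :: (nat \<Rightarrow> 'e option) measure) (\<lambda>\<tau>. 0 < wgt_ext S (\<tau> (Suc 0)) (orbit S \<tau> 0 x))"
      by (rule measurable_letter_orbit[of "\<lambda>c x. 0 < wgt_ext S c x"]) simp
    then show ?case by (subst AE_path_step) auto
  next
    case (Suc n)
    have "Measurable.pred (future :: (nat \<Rightarrow> 'e option) measure) (\<lambda>\<tau>. 0 < wgt_ext S (\<tau> (Suc (Suc n))) (orbit S \<tau> (Suc n) x))"
      by (rule measurable_letter_orbit[of "\<lambda>c x. 0 < wgt_ext S c x"]) simp
    then show ?case using Suc by (subst AE_path_step) (auto simp: orbit_lcons simp del: orbit.simps)
  qed
qed

lemma follows_edge:
  assumes "follows x \<tau>"
  obtains e where "\<tau> (Suc n) = Some e" "0 < wgt S e (orbit S \<tau> n x)" "orbit S \<tau> n x \<in> cell S (src S e)"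
proof (cases "\<tau> (Suc n)")
  case None
  then show ?thesis using assms unfolding follows_def by (metis less_irrefl wgt_ext.simps(1))
next
  case (Some e)
  then have "0 < wgt S e (orbit S \<tau> n x)" using assms unfolding follows_def by (metis wgt_ext.simps(2))
  with Some show ?thesis using that wgt_pos_cell by blast
qed

lemma follows_cyl_prob_pos: "follows x \<tau> \<Longrightarrow> 0 < cyl_prob x \<tau> n"
  by (induction n) (auto simp: follows_def)

text \<open>The letters alone determine the cells: the n-th point lies in the source cell of the
  next letter, and a second orbit from the same cell is carried along by \<open>wmap_cell\<close>.
  Time 0 is excepted in the last clause because paths are nonempty.\<close>

lemma follows_same_cell:
  assumes f: "follows x \<tau>" and x: "x \<in> cell S j" and y: "y \<in> cell S j"
  shows "\<exists>i. orbit S \<tau> n x \<in> cell S i \<and> orbit S \<tau> n y \<in> cell S i \<and> (n \<noteq> 0 \<longrightarrow> path_of_length S n j i)"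
proof -
  define ed where "ed n = the (\<tau> (Suc n))" for n
  have ed: "\<tau> (Suc n) = Some (ed n)" "orbit S \<tau> n x \<in> cell S (src S (ed n))" for n
    using follows_edge[OF f, of n] unfolding ed_def by (metis option.sel)+
  have orb: "orbit S \<tau> (Suc n) z = wmap S (ed n) (orbit S \<tau> n z)" for n z using ed(1)[of n] by simp
  have tg: "orbit S \<tau> (Suc n) x \<in> cell S (tgt S (ed n))" for n unfolding orb using ed(2) wmap_cell by blast
  have link: "src S (ed (Suc n)) = tgt S (ed n)" for n using cell_unique[OF ed(2)[of "Suc n"] tg[of n]] .
  have s0: "src S (ed 0) = j" using cell_unique[OF ed(2)[of 0], of j] x by simp
  have yy: "orbit S \<tau> n y \<in> cell S (src S (ed n))" for n
  proof (induction n)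
    case 0 then show ?case using y s0 by simp
  next
    case (Suc n) then show ?case unfolding orb link using wmap_cell by blast
  qed
  have "path_of_length S n j (src S (ed n))" if "n \<noteq> 0"
  proof -
    let ?es = "map ed [0..<n]"
    have "is_path S ?es" unfolding is_path_def using that link by auto
    moreover have "src S (hd ?es) = j" using that s0 by (simp add: hd_map)
    moreover have "tgt S (last ?es) = src S (ed n)" using that link[of "n - 1"] by (simp add: last_map)
    ultimately show ?thesis unfolding path_of_length_def by (intro exI[of _ ?es]) simp
  qed
  then show ?thesis using ed(2) yy by blast
qed

section \<open>Contraction of two orbits driven by the same letters\<close>

lemma contraction_step:
  assumes c: "contractive S a" and x: "x \<in> cell S j" and y: "y \<in> cell S j"
  shows "(\<integral>\<^sup>+e. ennreal (wgt S e x) * ennreal (dist (wmap S e x) (wmap S e y)) \<partial>count_space UNIV) \<le> ennreal (a * dist x y)"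
proof -
  have "(\<integral>\<^sup>+e. ennreal (wgt S e x) * ennreal (dist (wmap S e x) (wmap S e y)) \<partial>count_space UNIV)
    = (\<integral>\<^sup>+e. ennreal (wgt S e x * dist (wmap S e x) (wmap S e y)) * indicator {e. src S e = j} e \<partial>count_space UNIV)"
  proof (rule nn_integral_cong)
    fix e
    show "ennreal (wgt S e x) * ennreal (dist (wmap S e x) (wmap S e y)) =
      ennreal (wgt S e x * dist (wmap S e x) (wmap S e y)) * indicator {e. src S e = j} e"
    proof (cases "src S e = j")
      case False
      then have "wgt S e x = 0" using x cell_unique wgt_0 by blast
      then show ?thesis by simp
    qed (simp add: ennreal_mult')
  qed
  also have "\<dots> = (\<Sum>\<^sub>\<infinity>e\<in>{e. src S e = j}. ennreal (wgt S e x * dist (wmap S e x) (wmap S e y)))"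
    by (subst infsum_ennreal_eq_nn_integral) (auto simp: nn_integral_count_space_indicator)
  also have "\<dots> \<le> ennreal (a * dist x y)" using c x y unfolding contractive_def by blast
  finally show ?thesis .
qed

text \<open>After the first letter e the induction hypothesis contributes a^n times the distance of
  the images under e; one application of the contraction inequality bounds the mean of these
  distances. Edges of weight zero at x drop out, and for all others x and y lie in the source cell
  of e.\<close>

lemma contraction_iterate:
  assumes c: "contractive S a" and x: "x \<in> cell S j" and y: "y \<in> cell S j"
  shows "(\<integral>\<^sup>+\<tau>. ennreal (dist (orbit S \<tau> n x) (orbit S \<tau> n y)) \<partial>path_measure S x) \<le> ennreal (a ^ n * dist x y)"
  using x y
proof (induction n arbitrary: x y j)
  case 0 then show ?case by (simp add: path.emeasure_space_1)
next
  case (Suc n)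
  have a: "0 < a" using c by (simp add: contractive_def)
  have m: "(\<lambda>\<tau>. ennreal (dist (orbit S \<tau> (Suc n) x) (orbit S \<tau> (Suc n) y))) \<in> borel_measurable (future :: (nat \<Rightarrow> 'e option) measure)"
    by (rule measurable_orbits[of "\<lambda>u v. ennreal (dist u v)"]) simp
  have "(\<integral>\<^sup>+\<tau>. ennreal (dist (orbit S \<tau> (Suc n) x) (orbit S \<tau> (Suc n) y)) \<partial>path_measure S x)
    = (\<integral>\<^sup>+e. ennreal (wgt S e x) * (\<integral>\<^sup>+\<tau>. ennreal (dist (orbit S \<tau> n (wmap S e x)) (orbit S \<tau> n (wmap S e y)))
        \<partial>path_measure S (wmap S e x)) \<partial>count_space UNIV)"
    by (subst nn_integral_path_step[OF m]) (simp only: orbit_lcons)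
  also have "\<dots> \<le> (\<integral>\<^sup>+e. ennreal (a ^ n) * (ennreal (wgt S e x) * ennreal (dist (wmap S e x) (wmap S e y))) \<partial>count_space UNIV)"
  proof (rule nn_integral_mono)
    fix e
    show "ennreal (wgt S e x) * (\<integral>\<^sup>+\<tau>. ennreal (dist (orbit S \<tau> n (wmap S e x)) (orbit S \<tau> n (wmap S e y)))
        \<partial>path_measure S (wmap S e x)) \<le> ennreal (a ^ n) * (ennreal (wgt S e x) * ennreal (dist (wmap S e x) (wmap S e y)))"
    proof (cases "wgt S e x = 0")
      case False
      then have "x \<in> cell S (src S e)" using wgt_0 by blast
      moreover from this have "y \<in> cell S (src S e)" using cell_unique Suc.prems by blast
      ultimately have "(\<integral>\<^sup>+\<tau>. ennreal (dist (orbit S \<tau> n (wmap S e x)) (orbit S \<tau> n (wmap S e y)))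
        \<partial>path_measure S (wmap S e x)) \<le> ennreal (a ^ n * dist (wmap S e x) (wmap S e y))"
        using wmap_cell by (intro Suc.IH) auto
      also have "\<dots> = ennreal (a ^ n) * ennreal (dist (wmap S e x) (wmap S e y))" using a by (simp add: ennreal_mult')
      finally show ?thesis by (subst mult.left_commute) (rule mult_left_mono, simp_all)
    qed simp
  qed
  also have "\<dots> = ennreal (a ^ n) * (\<integral>\<^sup>+e. ennreal (wgt S e x) * ennreal (dist (wmap S e x) (wmap S e y)) \<partial>count_space UNIV)"
    by (rule nn_integral_cmult) simp
  also have "\<dots> \<le> ennreal (a ^ n) * ennreal (a * dist x y)"
    by (intro mult_left_mono contraction_step[OF c Suc.prems]) simp
  also have "\<dots> = ennreal (a ^ Suc n * dist x y)"
    using a by (simp add: ennreal_mult'[symmetric] mult_ac)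
  finally show ?case .
qed

text \<open>The series of positive parts has a finite integral, hence is almost surely finite and
  bounds each of its terms. Exponential rates in the mean become almost sure rates in this
  way.\<close>

lemma AE_bounded_of_summable_bound:
  fixes D :: "nat \<Rightarrow> (nat \<Rightarrow> 'e option) \<Rightarrow> real"
  assumes m[measurable]: "\<And>n. D n \<in> borel_measurable future"
    and b: "\<And>n. (\<integral>\<^sup>+\<tau>. ennreal (D n \<tau>) \<partial>path_measure S x) \<le> ennreal (B n)"
    and B: "summable B" "\<And>n. 0 \<le> B n"
  shows "AE \<tau> in path_measure S x. \<exists>C. \<forall>n. D n \<tau> \<le> real C"
proof -
  have "(\<integral>\<^sup>+\<tau>. (\<Sum>n. ennreal (D n \<tau>)) \<partial>path_measure S x) = (\<Sum>n. \<integral>\<^sup>+\<tau>. ennreal (D n \<tau>) \<partial>path_measure S x)"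
    by (rule nn_integral_suminf) measurable
  also have "\<dots> \<le> (\<Sum>n. ennreal (B n))" by (intro suminf_le b) auto
  also have "\<dots> = ennreal (suminf B)" using B by (simp add: suminf_ennreal2)
  also have "\<dots> < \<infinity>" by simp
  finally have "AE \<tau> in path_measure S x. (\<Sum>n. ennreal (D n \<tau>)) \<noteq> \<infinity>"
    by (intro nn_integral_noteq_infinite) auto
  then show ?thesis
  proof eventually_elim
    case (elim \<tau>)
    then obtain r where r: "0 \<le> r" "(\<Sum>n. ennreal (D n \<tau>)) = ennreal r"
      by (metis ennreal_cases infinity_ennreal_def)
    obtain C :: nat where C: "r \<le> real C" using real_arch_simple by blast
    have "D n \<tau> \<le> real C" for n
    proof -
      have "ennreal (D n \<tau>) \<le> ennreal r" using sum_le_suminf[of "\<lambda>n. ennreal (D n \<tau>)" "{n}"] r by simp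
      then show ?thesis using r C by (simp add: ennreal_le_iff)
    qed
    then show ?case by blast
  qed
qed

text \<open>Multiplying the distances by a^(-\<alpha> k) leaves means of order a^((1 - \<alpha>) k),
  which are summable because \<alpha> < 1.\<close>

lemma AE_orbit_dist_decay:
  assumes c: "contractive S a" and x: "x \<in> cell S j" and y: "y \<in> cell S j" and \<alpha>: "0 < \<alpha>" "\<alpha> < 1"
  shows "AE \<tau> in path_measure S x. \<exists>C::nat. \<forall>k. dist (orbit S \<tau> k x) (orbit S \<tau> k y) \<le> real C * a powr (\<alpha> * real k)"
proof -
  have a: "0 < a" "a < 1" using c by (auto simp: contractive_def)
  let ?D = "\<lambda>k \<tau>. a powr (- \<alpha> * real k) * dist (orbit S \<tau> k x) (orbit S \<tau> k y)"
  have m: "?D k \<in> borel_measurable (future :: (nat \<Rightarrow> 'e option) measure)" for k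
    by (rule measurable_orbits[of "\<lambda>u v. a powr (- \<alpha> * real k) * dist u v"]) simp
  have "AE \<tau> in path_measure S x. \<exists>C. \<forall>k. ?D k \<tau> \<le> real C"
  proof (rule AE_bounded_of_summable_bound[OF m])
    fix k
    have "(\<integral>\<^sup>+\<tau>. ennreal (?D k \<tau>) \<partial>path_measure S x)
       = ennreal (a powr (- \<alpha> * real k)) * (\<integral>\<^sup>+\<tau>. ennreal (dist (orbit S \<tau> k x) (orbit S \<tau> k y)) \<partial>path_measure S x)"
    proof -
      have "(\<lambda>\<tau>. ennreal (dist (orbit S \<tau> k x) (orbit S \<tau> k y))) \<in> borel_measurable (future :: (nat \<Rightarrow> 'e option) measure)"
        by (rule measurable_orbits[of "\<lambda>u v. ennreal (dist u v)"]) simp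
      then show ?thesis by (subst nn_integral_cmult[symmetric]) (simp_all add: ennreal_mult' cong: measurable_cong_sets)
    qed
    also have "\<dots> \<le> ennreal (a powr (- \<alpha> * real k)) * ennreal (a ^ k * dist x y)"
      by (intro mult_left_mono contraction_iterate[OF c x y]) simp
    also have "\<dots> = ennreal (a powr (- \<alpha> * real k) * (a ^ k * dist x y))" by (simp add: ennreal_mult')
    also have "a powr (- \<alpha> * real k) * (a ^ k * dist x y) = (a powr (1 - \<alpha>)) ^ k * dist x y"
      using a by (simp add: powr_realpow[symmetric] powr_powr powr_add[symmetric] algebra_simps)
    finally show "(\<integral>\<^sup>+\<tau>. ennreal (?D k \<tau>) \<partial>path_measure S x) \<le> ennreal ((a powr (1 - \<alpha>)) ^ k * dist x y)" .
  next
    have "a powr (1 - \<alpha>) < 1" using a \<alpha> powr_less_mono2[of "1 - \<alpha>" a 1] by simp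
    then show "summable (\<lambda>k. (a powr (1 - \<alpha>)) ^ k * dist x y)"
      using a by (intro summable_mult2 summable_geometric) simp
  qed simp
  then show ?thesis
  proof eventually_elim
    case (elim \<tau>)
    then obtain C where C: "\<And>k. ?D k \<tau> \<le> real C" by blast
    have "dist (orbit S \<tau> k x) (orbit S \<tau> k y) \<le> real C * a powr (\<alpha> * real k)" for k
    proof -
      have "dist (orbit S \<tau> k x) (orbit S \<tau> k y) = ?D k \<tau> * a powr (\<alpha> * real k)"
        using a by (simp add: powr_minus field_simps)
      also have "\<dots> \<le> real C * a powr (\<alpha> * real k)" by (intro mult_right_mono C) simp
      finally show ?thesis .
    qed
    then show ?case by blast
  qed
qed

subsection \<open>The Markov operator\<close>

lemma markov_op_eq: "markov_op S f x = (\<integral>\<^sup>+e. ennreal (wgt S e x) * f (wmap S e x) \<partial>count_space UNIV)"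
  unfolding markov_op_def by (rule infsum_ennreal_eq_nn_integral) simp

lemma measurable_markov_op[measurable]:
  assumes [measurable]: "f \<in> borel_measurable borel"
  shows "markov_op S f \<in> borel_measurable borel"
proof -
  interpret sigma_finite_measure "count_space (UNIV :: 'e set)" by (rule sigma_finite_measure_count_space)
  have "(\<lambda>p. ennreal (wgt S (snd p) (fst p)) * f (wmap S (snd p) (fst p))) \<in> borel_measurable (borel \<Otimes>\<^sub>M count_space (UNIV :: 'e set))"
    by (rule measurable_compose_countable[of "\<lambda>e p. ennreal (wgt S e (fst p)) * f (wmap S e (fst p))"]) measurable
  then show ?thesis unfolding markov_op_eq[abs_def]
    by (intro borel_measurable_nn_integral) (simp add: split_beta')
qed

lemma sets_adj_op[simp, measurable_cong]: "sets (adj_op S \<nu>) = sets borel"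
  unfolding adj_op_def by (metis sets.sigma_sets_eq sets_measure_of space_borel sets.space_closed)

text \<open>\<open>measure_of\<close> has the prescribed values only if these are countably
  additive, which is verified here by exchanging sum and integral.\<close>

lemma emeasure_adj_op:
  assumes [measurable_cong]: "sets \<nu> = sets borel" and B: "B \<in> sets borel"
  shows "emeasure (adj_op S \<nu>) B = (\<integral>\<^sup>+x. markov_op S (indicator B) x \<partial>\<nu>)"
  unfolding adj_op_def
proof (rule emeasure_measure_of_sigma)
  show "sigma_algebra UNIV (sets (borel :: 'k measure))"
    using sets.sigma_algebra_axioms[of "borel :: 'k measure"] by simp
  show "positive (sets borel) (\<lambda>B. \<integral>\<^sup>+x. markov_op S (indicator B) x \<partial>\<nu>)"
    by (simp add: positive_def markov_op_eq)
  show "countably_additive (sets borel) (\<lambda>B. \<integral>\<^sup>+x. markov_op S (indicator B) x \<partial>\<nu>)"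
  proof (rule countably_additiveI)
    fix A :: "nat \<Rightarrow> 'k set" assume A: "range A \<subseteq> sets borel" "disjoint_family A" "(\<Union>i. A i) \<in> sets borel"
    have Am[measurable]: "A i \<in> sets borel" for i using A by auto
    have "(\<Sum>i. \<integral>\<^sup>+x. markov_op S (indicator (A i)) x \<partial>\<nu>) = (\<integral>\<^sup>+x. (\<Sum>i. markov_op S (indicator (A i)) x) \<partial>\<nu>)"
      by (rule nn_integral_suminf[symmetric]) measurable
    also have "\<dots> = (\<integral>\<^sup>+x. markov_op S (indicator (\<Union>i. A i)) x \<partial>\<nu>)"
    proof (rule nn_integral_cong)
      fix x
      have "(\<Sum>i. markov_op S (indicator (A i)) x) = (\<integral>\<^sup>+e. (\<Sum>i. ennreal (wgt S e x) * indicator (A i) (wmap S e x)) \<partial>count_space UNIV)"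
        unfolding markov_op_eq by (rule nn_integral_suminf[symmetric]) simp
      also have "\<dots> = markov_op S (indicator (\<Union>i. A i)) x"
        unfolding markov_op_eq
        by (intro nn_integral_cong) (simp add: ennreal_suminf_cmult suminf_indicator[OF A(2)])
      finally show "(\<Sum>i. markov_op S (indicator (A i)) x) = markov_op S (indicator (\<Union>i. A i)) x" .
    qed
    finally show "(\<Sum>i. \<integral>\<^sup>+x. markov_op S (indicator (A i)) x \<partial>\<nu>) = (\<integral>\<^sup>+x. markov_op S (indicator (\<Union>i. A i)) x \<partial>\<nu>)" .
  qed
qed (rule B)

lemma nn_integral_adj_op:
  assumes \<nu>[measurable_cong]: "sets \<nu> = sets borel" and f: "f \<in> borel_measurable borel"
  shows "(\<integral>\<^sup>+x. f x \<partial>adj_op S \<nu>) = (\<integral>\<^sup>+x. markov_op S f x \<partial>\<nu>)"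
  using f
proof (induction rule: borel_measurable_induct)
  case (cong f g)
  then show ?case by (simp add: fun_eq_iff[THEN iffD2, of f g])
next
  case (set A)
  then show ?case using emeasure_adj_op[OF \<nu>] by simp
next
  case (mult u c)
  note [measurable] = mult(2)
  have "markov_op S (\<lambda>x. c * u x) y = c * markov_op S u y" for y
    unfolding markov_op_eq by (subst nn_integral_cmult[symmetric]) (auto simp: mult.left_commute)
  then show ?case using mult by (simp add: nn_integral_cmult)
next
  case (add u v)
  note [measurable] = add(1,3)
  have "markov_op S (\<lambda>x. v x + u x) y = markov_op S v y + markov_op S u y" for y
    unfolding markov_op_eq by (subst nn_integral_add[symmetric]) (auto simp: distrib_left)
  then show ?case using add by (simp add: nn_integral_add)
next
  case (seq U)
  note [measurable] = seq(1)
  have mono: "incseq (\<lambda>i. markov_op S (U i) y)" for y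
    using seq(3) unfolding markov_op_eq incseq_def le_fun_def by (auto intro!: nn_integral_mono mult_left_mono)
  have sup: "markov_op S (SUP i. U i) y = (SUP i. markov_op S (U i) y)" for y
  proof -
    have "(SUP i. markov_op S (U i) y) = (\<integral>\<^sup>+e. (SUP i. ennreal (wgt S e y) * U i (wmap S e y)) \<partial>count_space UNIV)"
      unfolding markov_op_eq
      by (rule nn_integral_monotone_convergence_SUP[symmetric])
         (use seq(3) in \<open>auto simp: incseq_def le_fun_def intro!: mult_left_mono\<close>)
    also have "\<dots> = markov_op S (SUP i. U i) y"
      unfolding markov_op_eq by (simp add: SUP_mult_left_ennreal image_comp)
    finally show ?thesis by simp
  qed
  have "(\<integral>\<^sup>+x. (SUP i. U i) x \<partial>adj_op S \<nu>) = (SUP i. \<integral>\<^sup>+x. U i x \<partial>adj_op S \<nu>)"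
    unfolding SUP_apply by (rule nn_integral_monotone_convergence_SUP) (use seq(3) in auto)
  also have "\<dots> = (SUP i. \<integral>\<^sup>+x. markov_op S (U i) x \<partial>\<nu>)" using seq by simp
  also have "\<dots> = (\<integral>\<^sup>+x. (SUP i. markov_op S (U i) x) \<partial>\<nu>)"
    by (rule nn_integral_monotone_convergence_SUP[symmetric]) (use mono in \<open>auto simp: incseq_def le_fun_def\<close>)
  finally show ?case by (simp only: sup)
qed

lemma measurable_path_nn_integral:
  assumes [measurable]: "(\<lambda>(x, \<tau>). f x \<tau>) \<in> borel_measurable (borel \<Otimes>\<^sub>M future)"
  shows "(\<lambda>x. \<integral>\<^sup>+\<tau>. f x \<tau> \<partial>path_measure S x) \<in> borel_measurable borel"
  by (rule nn_integral_measurable_subprob_algebra2[OF assms measurable_prob_algebraD[OF measurable_path_measure]])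

text \<open>The k-th iterate is the law of the k-th orbit point when the starting point has law
  \<nu>, since splitting off the first edge amounts to one application of \<open>markov_op\<close>.
  Through this the averages along paths speak about invariant measures and occupation
  measures.\<close>

lemma nn_integral_adj_op_iterate:
  assumes \<nu>: "sets \<nu> = sets borel" and f[measurable]: "f \<in> borel_measurable borel"
  shows "(\<integral>\<^sup>+x. f x \<partial>(adj_op S ^^ k) \<nu>) = (\<integral>\<^sup>+x. (\<integral>\<^sup>+\<tau>. f (orbit S \<tau> k x) \<partial>path_measure S x) \<partial>\<nu>)"
  using \<nu>
proof (induction k arbitrary: \<nu>)
  case 0 then show ?case by (simp add: path.emeasure_space_1)
next
  case (Suc k)
  have meas: "(\<lambda>x. \<integral>\<^sup>+\<tau>. f (orbit S \<tau> k x) \<partial>path_measure S x) \<in> borel_measurable borel"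
    by (rule measurable_path_nn_integral) (use measurable_compose[OF measurable_orbit_pair f] in \<open>simp add: split_beta'\<close>)
  have "(\<integral>\<^sup>+x. f x \<partial>(adj_op S ^^ Suc k) \<nu>) = (\<integral>\<^sup>+x. f x \<partial>(adj_op S ^^ k) (adj_op S \<nu>))"
    by (simp add: funpow_swap1)
  also have "\<dots> = (\<integral>\<^sup>+x. markov_op S (\<lambda>x. \<integral>\<^sup>+\<tau>. f (orbit S \<tau> k x) \<partial>path_measure S x) x \<partial>\<nu>)"
    using Suc by (simp add: nn_integral_adj_op[OF _ meas])
  also have "\<dots> = (\<integral>\<^sup>+x. (\<integral>\<^sup>+\<tau>. f (orbit S \<tau> (Suc k) x) \<partial>path_measure S x) \<partial>\<nu>)"
  proof (rule nn_integral_cong)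
    fix x
    have "(\<lambda>\<tau>. f (orbit S \<tau> (Suc k) x)) \<in> borel_measurable (future :: (nat \<Rightarrow> 'e option) measure)"
      by (rule measurable_orbit_finite) simp
    then show "markov_op S (\<lambda>x. \<integral>\<^sup>+\<tau>. f (orbit S \<tau> k x) \<partial>path_measure S x) x
      = (\<integral>\<^sup>+\<tau>. f (orbit S \<tau> (Suc k) x) \<partial>path_measure S x)"
      by (subst nn_integral_path_step) (simp_all only: orbit_lcons markov_op_eq)
  qed
  finally show ?case .
qed

end

subsection \<open>Comparing averages along two orbits\<close>

text \<open>For orthogonal increments: almost sure convergence along the squares is immediate, and the
  gap between \<open>n\<^sup>2\<close> and \<open>(n + 1)\<^sup>2\<close> is so short that no maximal inequality is needed.\<close>

lemma (in prob_space) averages_tendsto_0: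
  fixes D :: "nat \<Rightarrow> 'a \<Rightarrow> real"
  assumes D[measurable]: "\<And>k. D k \<in> borel_measurable M" and c: "0 \<le> c"
    and b: "\<And>l m. (\<integral>\<^sup>+x. ennreal ((\<Sum>k\<in>{l..<l+m}. D k x)\<^sup>2) \<partial>M) \<le> ennreal (real m * c)"
  shows "AE x in M. (\<lambda>n. (\<Sum>k<n. D k x) / n) \<longlonglongrightarrow> 0"
proof -
  \<comment> \<open>Collects the block up to n^2 and every partial block that starts at n^2; the sum
    over the 2n + 1 possible lengths stands in for a maximum.\<close>
  define Y where "Y n x = (\<Sum>k\<in>{0..<0+n\<^sup>2}. D k x)\<^sup>2 + (\<Sum>r\<le>2*n. (\<Sum>k\<in>{n\<^sup>2..<n\<^sup>2+r}. D k x)\<^sup>2)" for n x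
  have Y0: "0 \<le> Y n x" for n x unfolding Y_def by (intro add_nonneg_nonneg sum_nonneg) auto
  have Ym[measurable]: "Y n \<in> borel_measurable M" for n unfolding Y_def[abs_def] by measurable
  \<comment> \<open>The constant 7 absorbs n^2 + (2n + 1) 2n = 5 n^2 + 2n by means of n <=
    n^2.\<close>
  have Yi: "(\<integral>\<^sup>+x. ennreal (Y n x) \<partial>M) \<le> ennreal (7 * (real n)\<^sup>2 * c)" for n
  proof -
    have "(\<integral>\<^sup>+x. ennreal (Y n x) \<partial>M) = (\<integral>\<^sup>+x. ennreal ((\<Sum>k\<in>{0..<0+n\<^sup>2}. D k x)\<^sup>2) +
        (\<Sum>r\<le>2*n. ennreal ((\<Sum>k\<in>{n\<^sup>2..<n\<^sup>2+r}. D k x)\<^sup>2)) \<partial>M)"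
      unfolding Y_def by (intro nn_integral_cong) (simp add: sum_nonneg)
    also have "\<dots> = (\<integral>\<^sup>+x. ennreal ((\<Sum>k\<in>{0..<0+n\<^sup>2}. D k x)\<^sup>2) \<partial>M) +
        (\<Sum>r\<le>2*n. \<integral>\<^sup>+x. ennreal ((\<Sum>k\<in>{n\<^sup>2..<n\<^sup>2+r}. D k x)\<^sup>2) \<partial>M)"
    proof -
      have "(\<integral>\<^sup>+x. (\<Sum>r\<le>2*n. ennreal ((\<Sum>k\<in>{n\<^sup>2..<n\<^sup>2+r}. D k x)\<^sup>2)) \<partial>M)
        = (\<Sum>r\<le>2*n. \<integral>\<^sup>+x. ennreal ((\<Sum>k\<in>{n\<^sup>2..<n\<^sup>2+r}. D k x)\<^sup>2) \<partial>M)"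
        by (rule nn_integral_sum) measurable
      moreover have "(\<integral>\<^sup>+x. ennreal ((\<Sum>k\<in>{0..<0+n\<^sup>2}. D k x)\<^sup>2) +
          (\<Sum>r\<le>2*n. ennreal ((\<Sum>k\<in>{n\<^sup>2..<n\<^sup>2+r}. D k x)\<^sup>2)) \<partial>M)
        = (\<integral>\<^sup>+x. ennreal ((\<Sum>k\<in>{0..<0+n\<^sup>2}. D k x)\<^sup>2) \<partial>M) +
          (\<integral>\<^sup>+x. (\<Sum>r\<le>2*n. ennreal ((\<Sum>k\<in>{n\<^sup>2..<n\<^sup>2+r}. D k x)\<^sup>2)) \<partial>M)"
        by (rule nn_integral_add) measurable
      ultimately show ?thesis by simp
    qed
    also have "\<dots> \<le> ennreal (real (n\<^sup>2) * c) + (\<Sum>r\<le>2*n. ennreal (real (2 * n) * c))"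
    proof (intro add_mono sum_mono b)
      fix r assume "r \<in> {..2*n}"
      then have "real r * c \<le> real (2 * n) * c" using c by (intro mult_right_mono) auto
      then show "(\<integral>\<^sup>+x. ennreal ((\<Sum>k\<in>{n\<^sup>2..<n\<^sup>2+r}. D k x)\<^sup>2) \<partial>M) \<le> ennreal (real (2 * n) * c)"
        using b[of "n\<^sup>2" r] by (meson ennreal_leI order_trans)
    qed
    also have "\<dots> = ennreal (real (n\<^sup>2) * c + (\<Sum>r\<le>2*n. real (2 * n) * c))"
    proof -
      have "(\<Sum>r\<le>2*n. ennreal (real (2 * n) * c)) = ennreal (\<Sum>r\<le>2*n. real (2 * n) * c)"
        by (rule sum_ennreal) (use c in simp)
      then show ?thesis using c by (simp only:) (rule ennreal_plus[symmetric], auto intro!: sum_nonneg)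
    qed
    also have "\<dots> \<le> ennreal (7 * (real n)\<^sup>2 * c)"
    proof (rule ennreal_leI)
      have "real n \<le> (real n)\<^sup>2" by (cases n) (auto simp: power2_eq_square)
      then have "real (n\<^sup>2) + (2 * real n + 1) * (2 * real n) \<le> 7 * (real n)\<^sup>2"
        by (simp add: power2_eq_square algebra_simps)
      then have "(real (n\<^sup>2) + (2 * real n + 1) * (2 * real n)) * c \<le> 7 * (real n)\<^sup>2 * c"
        using c by (rule mult_right_mono)
      then show "real (n\<^sup>2) * c + (\<Sum>r\<le>2*n. real (2 * n) * c) \<le> 7 * (real n)\<^sup>2 * c"
        by (simp add: algebra_simps)
    qed
    finally show ?thesis .
  qed
  \<comment> \<open>Division by n^4 leaves the summable bound 7 c / n^2. So
    \<open>Y n x / n^4\<close> tends to 0, and twice its square root dominates the averages up to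
    the next square.\<close>
  have "(\<integral>\<^sup>+x. (\<Sum>n. ennreal (Y (Suc n) x / real (Suc n) ^ 4)) \<partial>M)
      = (\<Sum>n. \<integral>\<^sup>+x. ennreal (Y (Suc n) x / real (Suc n) ^ 4) \<partial>M)"
    by (rule nn_integral_suminf) measurable
  also have "\<dots> \<le> (\<Sum>n. ennreal (7 * c * inverse ((real (Suc n))\<^sup>2)))"
  proof (intro suminf_le)
    fix n
    have "(\<integral>\<^sup>+x. ennreal (Y (Suc n) x / real (Suc n) ^ 4) \<partial>M)
      = ennreal (inverse (real (Suc n) ^ 4)) * (\<integral>\<^sup>+x. ennreal (Y (Suc n) x) \<partial>M)"
      using Y0 by (subst nn_integral_cmult[symmetric]) (auto simp: ennreal_mult[symmetric] divide_inverse mult.commute intro!: nn_integral_cong)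
    also have "\<dots> \<le> ennreal (inverse (real (Suc n) ^ 4)) * ennreal (7 * (real (Suc n))\<^sup>2 * c)"
      by (intro mult_left_mono Yi) simp
    also have "\<dots> = ennreal (7 * c * inverse ((real (Suc n))\<^sup>2))"
    proof -
      have "inverse (r ^ 4) * (7 * r\<^sup>2 * c) = 7 * c * inverse (r\<^sup>2)" if "r \<noteq> 0" for r :: real
        using that by (simp add: power4_eq_xxxx power2_eq_square field_simps)
      then show ?thesis using c by (subst ennreal_mult[symmetric]) (simp_all del: of_nat_Suc)
    qed
    finally show "(\<integral>\<^sup>+x. ennreal (Y (Suc n) x / real (Suc n) ^ 4) \<partial>M) \<le> ennreal (7 * c * inverse ((real (Suc n))\<^sup>2))" .
  qed auto
  also have "\<dots> = ennreal (\<Sum>n. 7 * c * inverse ((real (Suc n))\<^sup>2))"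
    using c inverse_squares_sums by (intro suminf_ennreal2 summable_mult) (auto simp: sums_iff inverse_eq_divide add.commute)
  also have "\<dots> < \<infinity>" by simp
  finally have "AE x in M. (\<Sum>n. ennreal (Y (Suc n) x / real (Suc n) ^ 4)) \<noteq> \<infinity>"
    by (intro nn_integral_noteq_infinite) auto
  then show ?thesis
  proof eventually_elim
    case (elim x)
    have "summable (\<lambda>n. Y (Suc n) x / real (Suc n) ^ 4)"
      using elim Y0 by (intro summable_suminf_not_top) auto
    then have "(\<lambda>n. Y (Suc n) x / real (Suc n) ^ 4) \<longlonglongrightarrow> 0" by (rule summable_LIMSEQ_zero)
    then have "(\<lambda>n. Y n x / real n ^ 4) \<longlonglongrightarrow> 0" by (simp only: filterlim_sequentially_Suc[of "\<lambda>n. Y n x / real n ^ 4"])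
    then have "(\<lambda>n. 2 * sqrt (Y n x / real n ^ 4)) \<longlonglongrightarrow> 2 * sqrt 0" by (intro tendsto_intros)
    then have Z: "(\<lambda>n. 2 * sqrt (Y n x / real n ^ 4)) \<longlonglongrightarrow> 0" by simp
    have fs: "filterlim floor_sqrt at_top sequentially"
      unfolding filterlim_at_top
    proof (intro allI)
      fix K show "\<forall>\<^sub>F n in sequentially. K \<le> floor_sqrt n"
        by (rule eventually_sequentiallyI[of "K\<^sup>2"]) (metis le_floor_sqrt_iff)
    qed
    have L: "(\<lambda>N. 2 * sqrt (Y (floor_sqrt N) x / real (floor_sqrt N) ^ 4)) \<longlonglongrightarrow> 0"
      by (rule filterlim_compose[OF Z fs])
    show ?case
    proof (rule Lim_null_comparison[OF _ L], rule eventually_sequentiallyI[of 1])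
      fix N :: nat assume N: "1 \<le> N"
      define n where "n = floor_sqrt N"
      have n1: "n\<^sup>2 \<le> N" unfolding n_def by simp
      have "N < (Suc n)\<^sup>2" unfolding n_def by (rule Suc_floor_sqrt_power2_gt)
      then have n2: "N - n\<^sup>2 \<le> 2 * n" by (simp add: power2_eq_square)
      have np: "0 < n" using N unfolding n_def by simp
      have sq: "sqrt (Y n x / real n ^ 4) = sqrt (Y n x) / (real n)\<^sup>2"
        by (simp add: real_sqrt_divide power4_eq_xxxx power2_eq_square real_sqrt_mult)
      have "(\<Sum>k<N. D k x) = (\<Sum>k\<in>{0..<0+n\<^sup>2}. D k x) + (\<Sum>k\<in>{n\<^sup>2..<n\<^sup>2+(N-n\<^sup>2)}. D k x)"
        using n1 by (simp add: lessThan_atLeast0 sum.atLeastLessThan_concat)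
      moreover have "\<bar>\<Sum>k\<in>{0..<0+n\<^sup>2}. D k x\<bar> \<le> sqrt (Y n x)"
        unfolding Y_def by (rule real_le_rsqrt) (simp add: sum_nonneg)
      moreover have "\<bar>\<Sum>k\<in>{n\<^sup>2..<n\<^sup>2+(N-n\<^sup>2)}. D k x\<bar> \<le> sqrt (Y n x)"
      proof (rule real_le_rsqrt)
        have "(\<Sum>k\<in>{n\<^sup>2..<n\<^sup>2+(N-n\<^sup>2)}. D k x)\<^sup>2 \<le> (\<Sum>r\<le>2*n. (\<Sum>k\<in>{n\<^sup>2..<n\<^sup>2+r}. D k x)\<^sup>2)"
          using n2 by (intro member_le_sum[of "N - n\<^sup>2" "{..2*n}" "\<lambda>r. (\<Sum>k\<in>{n\<^sup>2..<n\<^sup>2+r}. D k x)\<^sup>2"]) auto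
        then show "\<bar>\<Sum>k\<in>{n\<^sup>2..<n\<^sup>2+(N-n\<^sup>2)}. D k x\<bar>\<^sup>2 \<le> Y n x"
          unfolding Y_def power2_abs by (intro add_increasing) auto
      qed
      ultimately have "\<bar>\<Sum>k<N. D k x\<bar> \<le> 2 * sqrt (Y n x)" by linarith
      then have "\<bar>\<Sum>k<N. D k x\<bar> / N \<le> 2 * sqrt (Y n x) / (real n)\<^sup>2"
        using np n1 Y0 by (intro frac_le) (auto simp flip: of_nat_power)
      then show "norm ((\<Sum>k<N. D k x) / N) \<le> 2 * sqrt (Y (floor_sqrt N) x / real (floor_sqrt N) ^ 4)"
        unfolding n_def[symmetric] sq by simp
    qed
  qed
qed

text \<open>The pathwise half of case (b). One half of \<epsilon> pays for the rate
  \<open>1 / Suc m\<close>, the other for the constant C once n is large; \<open>Suc C\<close> keeps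
  the argument of the logarithm positive.\<close>

lemma log_ratio_growth:
  fixes u v :: "nat \<Rightarrow> real"
  assumes h: "\<forall>m::nat. \<exists>C::nat. \<forall>n. exp (- (1 / Suc m) * real n) * (v n / u n) \<le> real C"
    and u: "\<And>n. 0 < u n" and v: "\<And>n. 0 < v n" and \<epsilon>: "0 < \<epsilon>"
  shows "\<forall>\<^sub>F n in sequentially. (ln (v n) - ln (u n)) / real n \<le> \<epsilon>"
proof -
  obtain m where m: "1 / Suc m < \<epsilon> / 2" using nat_approx_posE[of "\<epsilon> / 2"] \<epsilon> by auto
  obtain C :: nat where C: "\<And>n. exp (- (1 / Suc m) * real n) * (v n / u n) \<le> real C" using h by blast
  obtain N :: nat where N: "ln (real (Suc C)) / (\<epsilon> / 2) \<le> real N" using real_arch_simple by blast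
  show ?thesis
  proof (rule eventually_sequentiallyI[of "Suc N"])
    fix n assume n: "Suc N \<le> n"
    have r: "0 < v n / u n" using u[of n] v[of n] by simp
    have "exp (- (1 / Suc m) * real n) * (v n / u n) \<le> real (Suc C)" using C[of n] by simp
    then have "ln (exp (- (1 / Suc m) * real n) * (v n / u n)) \<le> ln (real (Suc C))"
      using mult_pos_pos[OF exp_gt_zero r] by (subst ln_le_cancel_iff) (simp_all only: of_nat_0_less_iff zero_less_Suc)
    then have "ln (v n / u n) \<le> ln (real (Suc C)) + (1 / Suc m) * real n"
      using r by (subst (asm) ln_mult_pos) (simp_all del: of_nat_Suc)
    also have "ln (real (Suc C)) \<le> \<epsilon> / 2 * real n"
    proof -
      have "ln (real (Suc C)) \<le> \<epsilon> / 2 * real N" using N \<epsilon> by (simp add: field_simps del: of_nat_Suc)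
      also have "\<dots> \<le> \<epsilon> / 2 * real n" using n \<epsilon> by (intro mult_left_mono) auto
      finally show ?thesis .
    qed
    also have "(1 / Suc m) * real n \<le> \<epsilon> / 2 * real n" using m by (intro mult_right_mono) auto
    finally have "ln (v n / u n) \<le> \<epsilon> * real n" by simp
    then have "ln (v n) - ln (u n) \<le> \<epsilon> * real n" using u[of n] v[of n] by (simp add: ln_div)
    then show "(ln (v n) - ln (u n)) / real n \<le> \<epsilon>" using n by (simp add: field_simps)
  qed
qed

lemma summable_on_of_nn_integral:
  fixes f :: "'a \<Rightarrow> real"
  assumes f: "\<And>x. 0 \<le> f x" and fin: "(\<integral>\<^sup>+x. ennreal (f x) \<partial>count_space UNIV) < \<infinity>"
  shows "f summable_on UNIV"
proof (rule nonneg_bdd_above_summable_on[OF f])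
  obtain C where C: "0 \<le> C" "(\<integral>\<^sup>+x. ennreal (f x) \<partial>count_space UNIV) = ennreal C"
    using fin by (metis ennreal_cases infinity_ennreal_def less_irrefl)
  show "bdd_above (sum f ` {F. F \<subseteq> UNIV \<and> finite F})"
  proof (rule bdd_aboveI2)
    fix F assume "F \<in> {F. F \<subseteq> UNIV \<and> finite (F :: 'a set)}"
    then have F: "finite F" by simp
    have "ennreal (sum f F) = (\<Sum>x\<in>F. ennreal (f x))" using f by (simp add: sum_ennreal)
    also have "\<dots> = (\<integral>\<^sup>+x. ennreal (f x) \<partial>count_space F)" using F by (simp add: nn_integral_count_space_finite)
    also have "\<dots> = (\<integral>\<^sup>+x. ennreal (f x) * indicator F x \<partial>count_space UNIV)"
      by (subst nn_integral_count_space_indicator) auto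
    also have "\<dots> \<le> (\<integral>\<^sup>+x. ennreal (f x) \<partial>count_space UNIV)"
      by (intro nn_integral_mono) (auto split: split_indicator)
    finally show "sum f F \<le> C" using C by (simp add: ennreal_le_iff)
  qed
qed

context msys
begin

text \<open>Pairs each letter with the point at which it is chosen, starting at time 0. Functions of
  the point alone are included as constant functions of the letter.\<close>

definition birk :: "('e option \<Rightarrow> 'k \<Rightarrow> real) \<Rightarrow> nat \<Rightarrow> 'k \<Rightarrow> (nat \<Rightarrow> 'e option) \<Rightarrow> real" where
  "birk h n x \<tau> = (\<Sum>k<n. h (\<tau> (Suc k)) (orbit S \<tau> k x))"

lemma birk_lcons: "birk h (Suc n) x (lcons e \<tau>) = h (Some e) x + birk h n (wmap S e x) \<tau>"
  unfolding birk_def by (subst sum.lessThan_Suc_shift) (simp add: orbit_lcons del: orbit.simps(2))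

lemma measurable_birk[measurable]: "birk h n x \<in> borel_measurable (future :: (nat \<Rightarrow> 'e option) measure)"
  unfolding birk_def[abs_def] by (intro borel_measurable_sum measurable_letter_orbit) simp

lemma measurable_path_cong: "g \<in> borel_measurable (future :: (nat \<Rightarrow> 'e option) measure) \<Longrightarrow> g \<in> borel_measurable (path_measure S x)"
  by (subst measurable_cong_sets[OF sets_path_measure refl])

text \<open>The interface between the ergodic theorem and the function classes at hand: under it a
  limit of averages from one point of a cell is passed on to all points of the cell.\<close>

definition same_averages :: "('e option \<Rightarrow> 'k \<Rightarrow> real) \<Rightarrow> bool" where
  "same_averages h \<longleftrightarrow> (\<forall>j. \<forall>x\<in>cell S j. \<forall>y\<in>cell S j.
     AE \<tau> in path_measure S x. (\<lambda>n. (birk h n x \<tau> - birk h n y \<tau>) / n) \<longlonglongrightarrow> 0)"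

lemma AE_path_transfer:
  assumes "absolutely_continuous_system S" "x \<in> cell S j" "y \<in> cell S j" "AE \<tau> in path_measure S y. Q \<tau>"
  shows "AE \<tau> in path_measure S x. Q \<tau>"
  using assms unfolding absolutely_continuous_system_def
  by (intro absolutely_continuous_AE[of "path_measure S x" "path_measure S y"]) auto

text \<open>With decay exponent 1/2 the distances are dominated by a geometric series, so the
  difference of the Birkhoff sums stays bounded along almost every path.\<close>

lemma same_averages_Lipschitz:
  assumes c: "contractive S a" and g: "\<And>u v. \<bar>g u - g v\<bar> \<le> L * dist u v" and L: "0 \<le> L"
  shows "same_averages (\<lambda>_. g)"
  unfolding same_averages_def
proof (intro allI ballI)
  fix j x y assume x: "x \<in> cell S j" and y: "y \<in> cell S j"
  have a: "0 < a" "a < 1" using c by (auto simp: contractive_def)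
  define q where "q = a powr (1/2)"
  have q: "0 < q" "q < 1" using a powr_less_mono2[of "1/2" a 1] by (auto simp: q_def)
  have "AE \<tau> in path_measure S x. \<exists>C::nat. \<forall>k. dist (orbit S \<tau> k x) (orbit S \<tau> k y) \<le> real C * a powr (1/2 * real k)"
    by (rule AE_orbit_dist_decay[OF c x y]) auto
  then show "AE \<tau> in path_measure S x. (\<lambda>n. (birk (\<lambda>_. g) n x \<tau> - birk (\<lambda>_. g) n y \<tau>) / n) \<longlonglongrightarrow> 0"
  proof eventually_elim
    case (elim \<tau>)
    then obtain C :: nat where C: "\<And>k. dist (orbit S \<tau> k x) (orbit S \<tau> k y) \<le> real C * a powr (1/2 * real k)" by blast
    have qk: "a powr (1/2 * real k) = q ^ k" for k using a by (simp add: powr_realpow[symmetric] powr_powr q_def)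
    define B where "B = L * C * (1 / (1 - q))"
    have bound: "\<bar>birk (\<lambda>_. g) n x \<tau> - birk (\<lambda>_. g) n y \<tau>\<bar> \<le> B" for n
    proof -
      have "\<bar>birk (\<lambda>_. g) n x \<tau> - birk (\<lambda>_. g) n y \<tau>\<bar> \<le> (\<Sum>k<n. \<bar>g (orbit S \<tau> k x) - g (orbit S \<tau> k y)\<bar>)"
        unfolding birk_def sum_subtractf[symmetric] by (rule sum_abs)
      also have "\<dots> \<le> (\<Sum>k<n. L * (C * q ^ k))"
        using C g L unfolding qk by (intro sum_mono) (meson mult_left_mono order_trans)
      also have "\<dots> = L * C * (\<Sum>k<n. q ^ k)" by (simp add: sum_distrib_left mult.assoc)
      also have "(\<Sum>k<n. q ^ k) \<le> (\<Sum>k. q ^ k)" using q by (intro sum_le_suminf summable_geometric) auto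
      also have "(\<Sum>k. q ^ k) = 1 / (1 - q)" using q by (intro suminf_geometric) simp
      finally show ?thesis unfolding B_def using L by (simp add: mult_left_mono)
    qed
    show ?case
    proof (rule Lim_null_comparison)
      show "\<forall>\<^sub>F n in sequentially. norm ((birk (\<lambda>_. g) n x \<tau> - birk (\<lambda>_. g) n y \<tau>) / real n) \<le> B / real n"
        using bound by (auto intro!: always_eventually divide_right_mono)
      show "(\<lambda>n. B / real n) \<longlonglongrightarrow> 0" by (rule lim_const_over_n)
    qed
  qed
qed

text \<open>Orbits driven by the same letters from one cell visit the same cells, so the difference
  is even zero.\<close>

lemma same_averages_indicator_cell: "same_averages (\<lambda>_. indicator (cell S j))"
  unfolding same_averages_def
proof (intro allI ballI)
  fix i x y assume x: "x \<in> cell S i" and y: "y \<in> cell S i"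
  show "AE \<tau> in path_measure S x. (\<lambda>n. (birk (\<lambda>_. indicator (cell S j)) n x \<tau> - birk (\<lambda>_. indicator (cell S j)) n y \<tau>) / real n) \<longlonglongrightarrow> 0"
    using AE_follows
  proof eventually_elim
    case (elim \<tau>)
    have "(indicator (cell S j) (orbit S \<tau> k x) :: real) = indicator (cell S j) (orbit S \<tau> k y)" for k
      using follows_same_cell[OF elim x y, of k] cell_unique by (auto simp: indicator_def)
    then show ?case unfolding birk_def by simp
  qed
qed

subsubsection \<open>Case (a)\<close>

context
  fixes f :: "'e \<Rightarrow> 'k \<Rightarrow> real" and c :: real
  assumes fm[measurable]: "\<And>e. f e \<in> borel_measurable borel" and f0[simp]: "\<And>e x. 0 \<le> f e x"
    and c0: "0 \<le> c" and f2: "\<And>x. (\<integral>\<^sup>+e. ennreal (wgt S e x) * ennreal ((f e x)\<^sup>2) \<partial>count_space UNIV) \<le> ennreal c"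
begin

text \<open>The conditional mean of the next value of \<open>f\<close> given the current point: the
  function whose continuity is assumed in case (a).\<close>

definition cmean :: "'k \<Rightarrow> real" where "cmean x = (\<Sum>\<^sub>\<infinity>e. wgt S e x * f e x)"

lemma nn_integral_wgt_const: "(\<integral>\<^sup>+e. ennreal (wgt S e x) * C \<partial>count_space UNIV) = C"
  using nn_integral_wgt[of x] by (subst nn_integral_multc) auto

lemma nn_integral_wgt_f_bound: "(\<integral>\<^sup>+e. ennreal (wgt S e x * f e x) \<partial>count_space UNIV) \<le> ennreal (1 + c)"
proof -
  have "(\<integral>\<^sup>+e. ennreal (wgt S e x * f e x) \<partial>count_space UNIV)
      \<le> (\<integral>\<^sup>+e. ennreal (wgt S e x) * 1 + ennreal (wgt S e x) * ennreal ((f e x)\<^sup>2) \<partial>count_space UNIV)"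
  proof (rule nn_integral_mono)
    fix e
    have "2 * f e x \<le> 1 + (f e x)\<^sup>2"
      using zero_le_power2[of "f e x - 1"] by (simp add: power2_eq_square algebra_simps)
    then have "f e x \<le> 1 + (f e x)\<^sup>2" using f0[of e x] by linarith
    then have "wgt S e x * f e x \<le> wgt S e x * (1 + (f e x)\<^sup>2)" by (rule mult_left_mono) simp
    then have "ennreal (wgt S e x * f e x) \<le> ennreal (wgt S e x * (1 + (f e x)\<^sup>2))" by (rule ennreal_leI)
    also have "\<dots> = ennreal (wgt S e x) * 1 + ennreal (wgt S e x) * ennreal ((f e x)\<^sup>2)"
      by (simp add: ennreal_mult'[symmetric] ennreal_plus[symmetric] distrib_left del: ennreal_plus)
    finally show "ennreal (wgt S e x * f e x) \<le> ennreal (wgt S e x) * 1 + ennreal (wgt S e x) * ennreal ((f e x)\<^sup>2)" .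
  qed
  also have "\<dots> = 1 + (\<integral>\<^sup>+e. ennreal (wgt S e x) * ennreal ((f e x)\<^sup>2) \<partial>count_space UNIV)"
    by (subst nn_integral_add) (auto simp: nn_integral_wgt)
  also have "\<dots> \<le> 1 + ennreal c" by (intro add_left_mono f2)
  also have "\<dots> = ennreal (1 + c)" using c0 by simp
  finally show ?thesis .
qed

lemma ennreal_cmean: "ennreal (cmean x) = (\<integral>\<^sup>+e. ennreal (wgt S e x) * ennreal (f e x) \<partial>count_space UNIV)"
proof -
  have "(\<lambda>e. wgt S e x * f e x) summable_on UNIV"
    using nn_integral_wgt_f_bound[of x] by (intro summable_on_of_nn_integral) (auto simp: le_less_trans)
  then have "ennreal (cmean x) = (\<integral>\<^sup>+e. ennreal (wgt S e x * f e x) \<partial>count_space UNIV)"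
    unfolding cmean_def by (subst nn_integral_count_space_eq_infsum) auto
  then show ?thesis by (simp add: ennreal_mult')
qed

lemma cmean_nonneg[simp]: "0 \<le> cmean x" unfolding cmean_def by (intro infsum_nonneg) simp

lemma cmean_bound: "cmean x \<le> 1 + c"
proof -
  have "ennreal (cmean x) \<le> ennreal (1 + c)"
    using nn_integral_wgt_f_bound[of x] unfolding ennreal_cmean by (simp add: ennreal_mult')
  then show ?thesis using c0 by (simp add: ennreal_le_iff del: ennreal_plus)
qed

lemma measurable_cmean[measurable]: "cmean \<in> borel_measurable borel"
proof -
  interpret sigma_finite_measure "count_space (UNIV :: 'e set)" by (rule sigma_finite_measure_count_space)
  have "(\<lambda>p. ennreal (wgt S (snd p) (fst p)) * ennreal (f (snd p) (fst p))) \<in> borel_measurable (borel \<Otimes>\<^sub>M count_space (UNIV :: 'e set))"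
    by (rule measurable_compose_countable[of "\<lambda>e p. ennreal (wgt S e (fst p)) * ennreal (f e (fst p))"]) measurable
  then have "(\<lambda>x. ennreal (cmean x)) \<in> borel_measurable borel"
    unfolding ennreal_cmean by (intro borel_measurable_nn_integral) (simp add: split_beta')
  then have "(\<lambda>x. enn2real (ennreal (cmean x))) \<in> borel_measurable borel" by measurable
  then show ?thesis by simp
qed

text \<open>A variance is at most the second moment. With g the mean and V the variance, the
  identity is written additively as V + 2 g^2 = E f^2 + g^2, which avoids truncated subtraction in
  \<open>ennreal\<close>; the finite term 2 g^2 is cancelled at the end.\<close>

lemma variance_bound:
  "(\<integral>\<^sup>+e. ennreal (wgt S e x) * ennreal ((f e x - cmean x)\<^sup>2) \<partial>count_space UNIV) \<le> ennreal c"
proof -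
  let ?g = "cmean x" and ?p = "\<lambda>e. ennreal (wgt S e x)"
  let ?V = "\<integral>\<^sup>+e. ?p e * ennreal ((f e x - ?g)\<^sup>2) \<partial>count_space UNIV"
  have "?V + ennreal (2 * ?g) * ennreal ?g
    = (\<integral>\<^sup>+e. ?p e * ennreal ((f e x - ?g)\<^sup>2) + ennreal (2 * ?g) * (?p e * ennreal (f e x)) \<partial>count_space UNIV)"
    unfolding ennreal_cmean by (subst nn_integral_add) (auto simp: nn_integral_cmult)
  also have "\<dots> = (\<integral>\<^sup>+e. ?p e * ennreal ((f e x)\<^sup>2) + ?p e * ennreal (?g\<^sup>2) \<partial>count_space UNIV)"
  proof (rule nn_integral_cong)
    fix e
    have "?p e * ennreal ((f e x - ?g)\<^sup>2) + ennreal (2 * ?g) * (?p e * ennreal (f e x))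
      = ennreal (wgt S e x * (f e x - ?g)\<^sup>2 + 2 * ?g * (wgt S e x * f e x))"
      by (simp add: ennreal_mult'[symmetric] ennreal_plus[symmetric] del: ennreal_plus)
    also have "wgt S e x * (f e x - ?g)\<^sup>2 + 2 * ?g * (wgt S e x * f e x) = wgt S e x * (f e x)\<^sup>2 + wgt S e x * ?g\<^sup>2"
      by (simp add: power2_eq_square algebra_simps)
    finally show "?p e * ennreal ((f e x - ?g)\<^sup>2) + ennreal (2 * ?g) * (?p e * ennreal (f e x))
      = ?p e * ennreal ((f e x)\<^sup>2) + ?p e * ennreal (?g\<^sup>2)" by (simp add: ennreal_mult')
  qed
  also have "\<dots> = (\<integral>\<^sup>+e. ?p e * ennreal ((f e x)\<^sup>2) \<partial>count_space UNIV) + ennreal (?g\<^sup>2)"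
    by (subst nn_integral_add) (auto simp: nn_integral_wgt_const)
  also have "\<dots> \<le> ennreal c + ennreal (?g\<^sup>2)" by (intro add_right_mono f2)
  also have "\<dots> \<le> ennreal c + ennreal (2 * ?g) * ennreal ?g"
    by (intro add_left_mono) (simp add: ennreal_mult'[symmetric] power2_eq_square ennreal_leI)
  finally show ?thesis by (subst (asm) (1 2) add.commute) (simp add: ennreal_add_left_cancel_le ennreal_mult_eq_top_iff)
qed

lemma nn_integral_birk_step:
  assumes h: "\<And>c x. 0 \<le> h c x"
  shows "(\<integral>\<^sup>+\<tau>. ennreal (birk h (Suc n) x \<tau>) \<partial>path_measure S x)
    = (\<integral>\<^sup>+e. ennreal (wgt S e x) * ennreal (h (Some e) x) \<partial>count_space UNIV)
      + (\<integral>\<^sup>+e. ennreal (wgt S e x) * (\<integral>\<^sup>+\<tau>. ennreal (birk h n (wmap S e x) \<tau>) \<partial>path_measure S (wmap S e x)) \<partial>count_space UNIV)"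
proof -
  have b0: "0 \<le> birk h n y \<tau>" for y \<tau> unfolding birk_def by (intro sum_nonneg h)
  have "(\<integral>\<^sup>+\<tau>. ennreal (birk h (Suc n) x \<tau>) \<partial>path_measure S x)
    = (\<integral>\<^sup>+e. ennreal (wgt S e x) * (\<integral>\<^sup>+\<tau>. ennreal (h (Some e) x) + ennreal (birk h n (wmap S e x) \<tau>) \<partial>path_measure S (wmap S e x)) \<partial>count_space UNIV)"
    by (subst nn_integral_path_step) (simp_all add: birk_lcons h b0)
  also have "\<dots> = (\<integral>\<^sup>+e. ennreal (wgt S e x) * ennreal (h (Some e) x) +
      ennreal (wgt S e x) * (\<integral>\<^sup>+\<tau>. ennreal (birk h n (wmap S e x) \<tau>) \<partial>path_measure S (wmap S e x)) \<partial>count_space UNIV)"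
  proof (rule nn_integral_cong)
    fix e
    have "(\<integral>\<^sup>+\<tau>. ennreal (h (Some e) x) + ennreal (birk h n (wmap S e x) \<tau>) \<partial>path_measure S (wmap S e x))
      = ennreal (h (Some e) x) + (\<integral>\<^sup>+\<tau>. ennreal (birk h n (wmap S e x) \<tau>) \<partial>path_measure S (wmap S e x))"
      by (subst nn_integral_add) (auto simp: path.emeasure_space_1 cong: measurable_cong_sets)
    then show "ennreal (wgt S e x) * (\<integral>\<^sup>+\<tau>. ennreal (h (Some e) x) + ennreal (birk h n (wmap S e x) \<tau>) \<partial>path_measure S (wmap S e x))
      = ennreal (wgt S e x) * ennreal (h (Some e) x) + ennreal (wgt S e x) * (\<integral>\<^sup>+\<tau>. ennreal (birk h n (wmap S e x) \<tau>) \<partial>path_measure S (wmap S e x))"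
      by (simp add: distrib_left)
  qed
  also have "\<dots> = (\<integral>\<^sup>+e. ennreal (wgt S e x) * ennreal (h (Some e) x) \<partial>count_space UNIV)
      + (\<integral>\<^sup>+e. ennreal (wgt S e x) * (\<integral>\<^sup>+\<tau>. ennreal (birk h n (wmap S e x) \<tau>) \<partial>path_measure S (wmap S e x)) \<partial>count_space UNIV)"
    by (rule nn_integral_add) auto
  finally show ?thesis .
qed

lemma fun_ext_nonneg: "0 \<le> fun_ext f d x" by (cases d) auto

text \<open>Averaging over the next letter replaces \<open>f\<close> by \<open>cmean\<close>.
  Equality of the two expectations is what centres the sums of \<open>mdiff\<close>.\<close>

lemma nn_integral_birk_eq:
  "(\<integral>\<^sup>+\<tau>. ennreal (birk (fun_ext f) n x \<tau>) \<partial>path_measure S x) = (\<integral>\<^sup>+\<tau>. ennreal (birk (\<lambda>_. cmean) n x \<tau>) \<partial>path_measure S x)"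
proof (induction n arbitrary: x)
  case 0 then show ?case by (simp add: birk_def)
next
  case (Suc n)
  show ?case
    by (subst (1 2) nn_integral_birk_step) (auto simp: fun_ext_nonneg Suc nn_integral_wgt_const ennreal_cmean[symmetric])
qed

lemma nn_integral_birk_cmean_finite: "(\<integral>\<^sup>+\<tau>. ennreal (birk (\<lambda>_. cmean) n x \<tau>) \<partial>path_measure S x) < \<infinity>"
proof -
  have "birk (\<lambda>_. cmean) n x \<tau> \<le> real n * (1 + c)" for \<tau>
    unfolding birk_def using sum_bounded_above[of "{..<n}" "\<lambda>k. cmean (orbit S \<tau> k x)" "1 + c"] cmean_bound by simp
  then have "(\<integral>\<^sup>+\<tau>. ennreal (birk (\<lambda>_. cmean) n x \<tau>) \<partial>path_measure S x) \<le> (\<integral>\<^sup>+\<tau>. ennreal (real n * (1 + c)) \<partial>path_measure S x)"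
    by (intro nn_integral_mono ennreal_leI)
  also have "\<dots> < \<infinity>" by (simp add: path.emeasure_space_1 ennreal_mult_less_top)
  finally show ?thesis .
qed

text \<open>Martingale differences under \<open>path_measure S x\<close>: the value at the next
  letter minus its conditional mean.\<close>

definition mdiff :: "nat \<Rightarrow> 'k \<Rightarrow> (nat \<Rightarrow> 'e option) \<Rightarrow> real" where
  "mdiff k x \<tau> = fun_ext f (\<tau> (Suc k)) (orbit S \<tau> k x) - cmean (orbit S \<tau> k x)"

lemma sum_mdiff: "(\<Sum>k<n. mdiff k x \<tau>) = birk (fun_ext f) n x \<tau> - birk (\<lambda>_. cmean) n x \<tau>"
  by (simp add: mdiff_def birk_def sum_subtractf)

lemma measurable_mdiff[measurable]: "mdiff k x \<in> borel_measurable (future :: (nat \<Rightarrow> 'e option) measure)"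
  unfolding mdiff_def[abs_def]
  using measurable_letter_orbit[of "\<lambda>c x. fun_ext f c x - cmean x" borel k x] by simp

lemma integral_sum_mdiff: "(\<integral>\<tau>. (\<Sum>k<n. mdiff k x \<tau>) \<partial>path_measure S x) = 0"
  and integrable_sum_mdiff: "integrable (path_measure S x) (\<lambda>\<tau>. \<Sum>k<n. mdiff k x \<tau>)"
proof -
  have n0: "0 \<le> birk (fun_ext f) n x \<tau>" "0 \<le> birk (\<lambda>_. cmean) n x \<tau>" for \<tau>
    unfolding birk_def by (intro sum_nonneg, simp add: fun_ext_nonneg)+
  have i1: "integrable (path_measure S x) (birk (fun_ext f) n x)"
    using nn_integral_birk_cmean_finite[where n=n and x=x] nn_integral_birk_eq[where n=n and x=x] n0
    by (intro integrableI_nonneg measurable_path_cong measurable_birk) auto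
  have i2: "integrable (path_measure S x) (birk (\<lambda>_. cmean) n x)"
    using nn_integral_birk_cmean_finite[where n=n and x=x] n0
    by (intro integrableI_nonneg measurable_path_cong measurable_birk) auto
  have "(\<integral>\<tau>. birk (fun_ext f) n x \<tau> \<partial>path_measure S x) = (\<integral>\<tau>. birk (\<lambda>_. cmean) n x \<tau> \<partial>path_measure S x)"
    using nn_integral_birk_eq[where n=n and x=x] n0
    by (subst (1 2) integral_eq_nn_integral) (auto intro!: measurable_path_cong measurable_birk)
  then show "(\<integral>\<tau>. (\<Sum>k<n. mdiff k x \<tau>) \<partial>path_measure S x) = 0"
    unfolding sum_mdiff using i1 i2 by simp
  show "integrable (path_measure S x) (\<lambda>\<tau>. \<Sum>k<n. mdiff k x \<tau>)"
    unfolding sum_mdiff using i1 i2 by simp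
qed

text \<open>Orthogonality of the increments without a filtration: once the first letter is fixed,
  the first increment is a constant and the remaining sum is centred, so the cross term vanishes and
  second moments add up, each at most c.\<close>

lemma second_moment_mdiff: "(\<integral>\<^sup>+\<tau>. ennreal ((\<Sum>k<n. mdiff k x \<tau>)\<^sup>2) \<partial>path_measure S x) \<le> ennreal (real n * c)"
proof (induction n arbitrary: x)
  case 0 then show ?case by simp
next
  case (Suc n)
  let ?V = "\<lambda>y \<tau>. \<Sum>k<n. mdiff k y \<tau>"
  have split: "(\<Sum>k<Suc n. mdiff k x (lcons e \<tau>)) = (f e x - cmean x) + ?V (wmap S e x) \<tau>" for e \<tau>
    unfolding sum_mdiff birk_lcons by simp
  have inner: "(\<integral>\<^sup>+\<tau>. ennreal ((d + ?V y \<tau>)\<^sup>2) \<partial>path_measure S y) \<le> ennreal (d\<^sup>2) + ennreal (real n * c)" for d y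
  proof -
    have m: "(\<lambda>\<tau>. (?V y \<tau>)\<^sup>2) \<in> borel_measurable (path_measure S y)"
      by (rule measurable_path_cong) measurable
    have i: "integrable (path_measure S y) (\<lambda>\<tau>. (?V y \<tau>)\<^sup>2)"
      using Suc[of y] by (intro integrableI_nonneg m) (auto simp: le_less_trans)
    have "(\<integral>\<^sup>+\<tau>. ennreal ((d + ?V y \<tau>)\<^sup>2) \<partial>path_measure S y) = (\<integral>\<^sup>+\<tau>. ennreal (d\<^sup>2 + 2 * d * ?V y \<tau> + (?V y \<tau>)\<^sup>2) \<partial>path_measure S y)"
      by (simp add: power2_sum add_ac)
    also have "\<dots> = ennreal (\<integral>\<tau>. d\<^sup>2 + 2 * d * ?V y \<tau> + (?V y \<tau>)\<^sup>2 \<partial>path_measure S y)"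
    proof (rule nn_integral_eq_integral)
      show "integrable (path_measure S y) (\<lambda>\<tau>. d\<^sup>2 + 2 * d * ?V y \<tau> + (?V y \<tau>)\<^sup>2)"
        using i integrable_sum_mdiff[where x=y and n=n] by auto
      have "d\<^sup>2 + 2 * d * ?V y \<tau> + (?V y \<tau>)\<^sup>2 = (d + ?V y \<tau>)\<^sup>2" for \<tau> by (simp add: power2_sum)
      then show "AE \<tau> in path_measure S y. 0 \<le> d\<^sup>2 + 2 * d * ?V y \<tau> + (?V y \<tau>)\<^sup>2" by simp
    qed
    also have "(\<integral>\<tau>. d\<^sup>2 + 2 * d * ?V y \<tau> + (?V y \<tau>)\<^sup>2 \<partial>path_measure S y) = d\<^sup>2 + (\<integral>\<tau>. (?V y \<tau>)\<^sup>2 \<partial>path_measure S y)"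
      using i integrable_sum_mdiff[where x=y and n=n] integral_sum_mdiff[where x=y and n=n] by (simp add: path.prob_space)
    also have "ennreal \<dots> = ennreal (d\<^sup>2) + (\<integral>\<^sup>+\<tau>. ennreal ((?V y \<tau>)\<^sup>2) \<partial>path_measure S y)"
      using nn_integral_eq_integral[OF i] by simp
    also have "\<dots> \<le> ennreal (d\<^sup>2) + ennreal (real n * c)" by (intro add_left_mono Suc)
    finally show ?thesis .
  qed
  have "(\<integral>\<^sup>+\<tau>. ennreal ((\<Sum>k<Suc n. mdiff k x \<tau>)\<^sup>2) \<partial>path_measure S x)
    = (\<integral>\<^sup>+e. ennreal (wgt S e x) * (\<integral>\<^sup>+\<tau>. ennreal (((f e x - cmean x) + ?V (wmap S e x) \<tau>)\<^sup>2) \<partial>path_measure S (wmap S e x)) \<partial>count_space UNIV)"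
    by (subst nn_integral_path_step) (simp_all only: split, measurable)
  also have "\<dots> \<le> (\<integral>\<^sup>+e. ennreal (wgt S e x) * (ennreal ((f e x - cmean x)\<^sup>2) + ennreal (real n * c)) \<partial>count_space UNIV)"
    by (intro nn_integral_mono mult_left_mono inner) simp
  also have "\<dots> = (\<integral>\<^sup>+e. ennreal (wgt S e x) * ennreal ((f e x - cmean x)\<^sup>2) \<partial>count_space UNIV) + ennreal (real n * c)"
    by (simp add: distrib_left nn_integral_add nn_integral_wgt_const)
  also have "\<dots> \<le> ennreal c + ennreal (real n * c)" by (intro add_right_mono variance_bound)
  also have "\<dots> = ennreal (real (Suc n) * c)" using c0 by (simp add: ennreal_plus[symmetric] algebra_simps del: ennreal_plus)
  finally show ?case .
qed

lemma mdiff_Suc_lcons: "mdiff (Suc k) x (lcons e \<tau>) = mdiff k (wmap S e x) \<tau>"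
  unfolding mdiff_def orbit_lcons by simp

text \<open>After l letters the block becomes an initial block from the point reached, and the bound
  for initial blocks is uniform in the starting point.\<close>

lemma second_moment_mdiff_shift:
  "(\<integral>\<^sup>+\<tau>. ennreal ((\<Sum>k\<in>{l..<l+m}. mdiff k x \<tau>)\<^sup>2) \<partial>path_measure S x) \<le> ennreal (real m * c)"
proof (induction l arbitrary: x)
  case 0 then show ?case using second_moment_mdiff[where n=m and x=x] by (simp add: lessThan_atLeast0)
next
  case (Suc l)
  have "(\<integral>\<^sup>+\<tau>. ennreal ((\<Sum>k\<in>{Suc l..<Suc l+m}. mdiff k x \<tau>)\<^sup>2) \<partial>path_measure S x)
    = (\<integral>\<^sup>+e. ennreal (wgt S e x) * (\<integral>\<^sup>+\<tau>. ennreal ((\<Sum>k\<in>{l..<l+m}. mdiff k (wmap S e x) \<tau>)\<^sup>2) \<partial>path_measure S (wmap S e x)) \<partial>count_space UNIV)"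
    by (subst nn_integral_path_step, measurable) (simp only: sum.shift_bounds_Suc_ivl mdiff_Suc_lcons add_Suc)
  also have "\<dots> \<le> (\<integral>\<^sup>+e. ennreal (wgt S e x) * ennreal (real m * c) \<partial>count_space UNIV)"
    by (intro nn_integral_mono mult_left_mono Suc) simp
  also have "\<dots> = ennreal (real m * c)" by (rule nn_integral_wgt_const)
  finally show ?case .
qed

lemma AE_mdiff_averages: "AE \<tau> in path_measure S x. (\<lambda>n. (\<Sum>k<n. mdiff k x \<tau>) / n) \<longlonglongrightarrow> 0"
  by (rule path.averages_tendsto_0[OF measurable_path_cong[OF measurable_mdiff] c0 second_moment_mdiff_shift])

text \<open>At time k both orbits lie in one cell reached by a path of length k, at distance at most
  a constant times a^(\<alpha> k). Each term is thus below the path modulus at that radius, and the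
  averages of the moduli vanish by hypothesis.\<close>

lemma AE_cmean_averages:
  assumes ctr: "contractive S a" and \<alpha>: "0 < \<alpha>" "\<alpha> < 1" and uc: "uniformly_continuous_along S a \<alpha> cmean"
    and x: "x \<in> cell S j" and y: "y \<in> cell S j"
  shows "AE \<tau> in path_measure S x. (\<lambda>n. (birk (\<lambda>_. cmean) n x \<tau> - birk (\<lambda>_. cmean) n y \<tau>) / n) \<longlonglongrightarrow> 0"
  using AE_orbit_dist_decay[OF ctr x y \<alpha>] AE_follows
proof eventually_elim
  case (elim \<tau>)
  then obtain C :: nat where C: "\<And>k. dist (orbit S \<tau> k x) (orbit S \<tau> k y) \<le> real C * a powr (\<alpha> * real k)" by blast
  \<comment> \<open>The successor makes \<beta> positive even for C = 0, as the continuity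
    hypothesis requires.\<close>
  define \<beta> where "\<beta> = real (Suc C)"
  have \<beta>: "0 < \<beta>" by (simp add: \<beta>_def)
  define D where "D k = \<bar>cmean (orbit S \<tau> k x) - cmean (orbit S \<tau> k y)\<bar>" for k
  let ?m = "\<lambda>k. path_modulus S j k cmean (\<beta> * a powr (\<alpha> * real k))"
  have Dk: "ennreal (D k) \<le> ?m k" if "1 \<le> k" for k
  proof -
    obtain i where i: "orbit S \<tau> k x \<in> cell S i" "orbit S \<tau> k y \<in> cell S i" "path_of_length S k j i"
      using follows_same_cell[OF elim(2) x y, of k] \<open>1 \<le> k\<close> by auto
    have "dist (orbit S \<tau> k x) (orbit S \<tau> k y) \<le> \<beta> * a powr (\<alpha> * real k)"
      using C[of k] by (rule order_trans) (simp add: \<beta>_def distrib_right)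
    then have "ennreal (D k) \<le> modulus S i cmean (\<beta> * a powr (\<alpha> * real k))"
      unfolding modulus_def D_def using i
      by (intro SUP_upper2[of "(orbit S \<tau> k x, orbit S \<tau> k y)"]) auto
    also have "\<dots> \<le> ?m k" unfolding path_modulus_def using i by (intro SUP_upper) simp
    finally show ?thesis .
  qed
  \<comment> \<open>The time 0 term is kept apart because the moduli are averaged over lengths from
    1 on; it vanishes after division by n.\<close>
  have lim: "(\<lambda>n. ennreal (D 0 / real n) + ennreal (1 / real n) * (\<Sum>k=1..n. ?m k)) \<longlonglongrightarrow> ennreal 0 + 0"
  proof (intro tendsto_add tendsto_ennrealI lim_const_over_n)
    show "(\<lambda>n. ennreal (1 / real n) * (\<Sum>k=1..n. ?m k)) \<longlonglongrightarrow> 0"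
      using uc \<beta> unfolding uniformly_continuous_along_def by blast
  qed
  have le: "ennreal \<bar>(birk (\<lambda>_. cmean) n x \<tau> - birk (\<lambda>_. cmean) n y \<tau>) / n\<bar>
      \<le> ennreal (D 0 / real n) + ennreal (1 / real n) * (\<Sum>k=1..n. ?m k)" for n
  proof -
    have D0: "0 \<le> D k" for k by (simp add: D_def)
    have "\<bar>birk (\<lambda>_. cmean) n x \<tau> - birk (\<lambda>_. cmean) n y \<tau>\<bar> \<le> (\<Sum>k<n. D k)"
      unfolding birk_def sum_subtractf[symmetric] D_def by (rule sum_abs)
    also have "\<dots> \<le> (\<Sum>k\<in>insert 0 {1..n}. D k)" by (rule sum_mono2) (auto simp: D0 not_less_eq_eq One_nat_def)
    also have "\<dots> = D 0 + (\<Sum>k=1..n. D k)" by simp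
    finally have "\<bar>birk (\<lambda>_. cmean) n x \<tau> - birk (\<lambda>_. cmean) n y \<tau>\<bar> / n \<le> (D 0 + (\<Sum>k=1..n. D k)) / n"
      by (rule divide_right_mono) simp
    then have "ennreal \<bar>(birk (\<lambda>_. cmean) n x \<tau> - birk (\<lambda>_. cmean) n y \<tau>) / n\<bar> \<le> ennreal (D 0 / n + 1 / n * (\<Sum>k=1..n. D k))"
      by (intro ennreal_leI) (simp add: add_divide_distrib)
    also have "\<dots> = ennreal (D 0 / n) + ennreal (1 / n) * (\<Sum>k=1..n. ennreal (D k))"
      using D0 by (simp add: ennreal_mult'[symmetric] sum_nonneg)
    also have "\<dots> \<le> ennreal (D 0 / real n) + ennreal (1 / real n) * (\<Sum>k=1..n. ?m k)"
      by (intro add_left_mono mult_left_mono sum_mono Dk) auto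
    finally show ?thesis .
  qed
  have "(\<lambda>n. ennreal \<bar>(birk (\<lambda>_. cmean) n x \<tau> - birk (\<lambda>_. cmean) n y \<tau>) / n\<bar>) \<longlonglongrightarrow> 0"
    by (rule tendsto_sandwich[OF _ _ tendsto_const lim[simplified]]) (use le in auto)
  then have "(\<lambda>n. \<bar>(birk (\<lambda>_. cmean) n x \<tau> - birk (\<lambda>_. cmean) n y \<tau>) / n\<bar>) \<longlonglongrightarrow> 0"
    by (subst (asm) tendsto_ennreal_iff[of _ _ 0, simplified]) auto
  then show ?case by (simp only: tendsto_rabs_zero_iff)
qed

text \<open>The difference of the averages splits into the martingale parts from x and from y and
  the difference of the \<open>cmean\<close> averages. The part from y is controlled under the path
  measure of y and has to be transferred to that of x.\<close>

lemma same_averages_case_a: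
  assumes ctr: "contractive S a" and \<alpha>: "0 < \<alpha>" "\<alpha> < 1" and uc: "uniformly_continuous_along S a \<alpha> cmean"
    and ac: "absolutely_continuous_system S"
  shows "same_averages (fun_ext f)"
  unfolding same_averages_def
proof (intro allI ballI)
  fix j x y assume x: "x \<in> cell S j" and y: "y \<in> cell S j"
  show "AE \<tau> in path_measure S x. (\<lambda>n. (birk (fun_ext f) n x \<tau> - birk (fun_ext f) n y \<tau>) / real n) \<longlonglongrightarrow> 0"
    using AE_mdiff_averages[of x] AE_path_transfer[OF ac x y AE_mdiff_averages[of y]] AE_cmean_averages[OF ctr \<alpha> uc x y]
  proof eventually_elim
    case (elim \<tau>)
    have "(\<lambda>n. (\<Sum>k<n. mdiff k x \<tau>) / n - (\<Sum>k<n. mdiff k y \<tau>) / n + (birk (\<lambda>_. cmean) n x \<tau> - birk (\<lambda>_. cmean) n y \<tau>) / n) \<longlonglongrightarrow> 0 - 0 + 0"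
      by (intro tendsto_intros elim)
    moreover have "(\<Sum>k<n. mdiff k x \<tau>) / n - (\<Sum>k<n. mdiff k y \<tau>) / n + (birk (\<lambda>_. cmean) n x \<tau> - birk (\<lambda>_. cmean) n y \<tau>) / n
      = (birk (fun_ext f) n x \<tau> - birk (fun_ext f) n y \<tau>) / n" for n
      unfolding sum_mdiff by (simp add: diff_divide_distrib)
    ultimately show ?case by simp
  qed
qed

end

subsubsection \<open>Case (b)\<close>

text \<open>Integrating q/p against p yields at most the total mass of q. It is an inequality
  because the mass of q on edges with p = 0 is lost.\<close>

lemma nn_integral_likelihood_ratio:
  "(\<integral>\<^sup>+\<tau>. ennreal (cyl_prob y \<tau> n / cyl_prob x \<tau> n) \<partial>path_measure S x) \<le> 1"
proof (induction n arbitrary: x y)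
  case 0 then show ?case by (simp add: path.emeasure_space_1)
next
  case (Suc n)
  have step: "cyl_prob z (lcons e \<tau>) (Suc n) = wgt S e z * cyl_prob (wmap S e z) \<tau> n" for z e \<tau>
  proof -
    have "cyl_prob (wmap S e z) (\<lambda>n. lcons e \<tau> (Suc n)) n = cyl_prob (wmap S e z) \<tau> n"
    proof (rule cyl_prob_cong)
      fix j :: nat assume "1 \<le> j" then show "lcons e \<tau> (Suc j) = \<tau> j" by (cases j) (auto simp: One_nat_def)
    qed
    then show ?thesis unfolding cyl_prob_Suc_shift by simp
  qed
  have m: "(\<lambda>\<tau>. ennreal (cyl_prob y \<tau> (Suc n) / cyl_prob x \<tau> (Suc n))) \<in> borel_measurable (future :: (nat \<Rightarrow> 'e option) measure)"
    by (rule measurable_cyl_probs[of "\<lambda>u v. ennreal (v / u)"]) simp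
  have m': "(\<lambda>\<tau>. ennreal (cyl_prob y \<tau> n / cyl_prob x \<tau> n)) \<in> borel_measurable (future :: (nat \<Rightarrow> 'e option) measure)" for x y
    by (rule measurable_cyl_probs[of "\<lambda>u v. ennreal (v / u)"]) simp
  have "(\<integral>\<^sup>+\<tau>. ennreal (cyl_prob y \<tau> (Suc n) / cyl_prob x \<tau> (Suc n)) \<partial>path_measure S x)
    = (\<integral>\<^sup>+e. ennreal (wgt S e x) * (\<integral>\<^sup>+\<tau>. ennreal (wgt S e y * cyl_prob (wmap S e y) \<tau> n / (wgt S e x * cyl_prob (wmap S e x) \<tau> n))
        \<partial>path_measure S (wmap S e x)) \<partial>count_space UNIV)"
    by (subst nn_integral_path_step[OF m]) (simp only: step)
  also have "\<dots> \<le> (\<integral>\<^sup>+e. ennreal (wgt S e y) \<partial>count_space UNIV)"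
  proof (rule nn_integral_mono)
    fix e
    show "ennreal (wgt S e x) * (\<integral>\<^sup>+\<tau>. ennreal (wgt S e y * cyl_prob (wmap S e y) \<tau> n / (wgt S e x * cyl_prob (wmap S e x) \<tau> n))
        \<partial>path_measure S (wmap S e x)) \<le> ennreal (wgt S e y)"
    proof (cases "wgt S e x = 0")
      case False
      then have p: "0 < wgt S e x" using wgt_nonneg[of e x] by linarith
      have "(\<integral>\<^sup>+\<tau>. ennreal (wgt S e y * cyl_prob (wmap S e y) \<tau> n / (wgt S e x * cyl_prob (wmap S e x) \<tau> n)) \<partial>path_measure S (wmap S e x))
        = (\<integral>\<^sup>+\<tau>. ennreal (wgt S e y / wgt S e x) * ennreal (cyl_prob (wmap S e y) \<tau> n / cyl_prob (wmap S e x) \<tau> n) \<partial>path_measure S (wmap S e x))"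
        by (simp add: ennreal_mult'[symmetric])
      also have "\<dots> = ennreal (wgt S e y / wgt S e x) * (\<integral>\<^sup>+\<tau>. ennreal (cyl_prob (wmap S e y) \<tau> n / cyl_prob (wmap S e x) \<tau> n) \<partial>path_measure S (wmap S e x))"
        by (rule nn_integral_cmult) (simp add: m' cong: measurable_cong_sets)
      also have "\<dots> \<le> ennreal (wgt S e y / wgt S e x) * 1" by (intro mult_left_mono Suc) simp
      finally have "ennreal (wgt S e x) * (\<integral>\<^sup>+\<tau>. ennreal (wgt S e y * cyl_prob (wmap S e y) \<tau> n / (wgt S e x * cyl_prob (wmap S e x) \<tau> n))
        \<partial>path_measure S (wmap S e x)) \<le> ennreal (wgt S e x) * ennreal (wgt S e y / wgt S e x)"
        by (intro mult_left_mono) auto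
      also have "\<dots> = ennreal (wgt S e y)" using p by (simp add: ennreal_mult'[symmetric])
      finally show ?thesis .
    qed simp
  qed
  also have "\<dots> = 1" by (rule nn_integral_wgt)
  finally show ?case .
qed

text \<open>The ratios have mean at most one, so the damping factor exp(-\<epsilon> n) makes the
  means summable.\<close>

lemma AE_likelihood_ratio_growth:
  assumes \<epsilon>: "0 < \<epsilon>"
  shows "AE \<tau> in path_measure S x. \<exists>C::nat. \<forall>n. exp (- \<epsilon> * real n) * (cyl_prob y \<tau> n / cyl_prob x \<tau> n) \<le> real C"
proof (rule AE_bounded_of_summable_bound)
  show "(\<lambda>\<tau>. exp (- \<epsilon> * real n) * (cyl_prob y \<tau> n / cyl_prob x \<tau> n)) \<in> borel_measurable (future :: (nat \<Rightarrow> 'e option) measure)" for n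
    by (rule measurable_cyl_probs[of "\<lambda>u v. exp (- \<epsilon> * real n) * (v / u)"]) simp
  fix n
  have m': "(\<lambda>\<tau>. ennreal (cyl_prob y \<tau> n / cyl_prob x \<tau> n)) \<in> borel_measurable (future :: (nat \<Rightarrow> 'e option) measure)"
    by (rule measurable_cyl_probs[of "\<lambda>u v. ennreal (v / u)"]) simp
  have "(\<integral>\<^sup>+\<tau>. ennreal (exp (- \<epsilon> * real n) * (cyl_prob y \<tau> n / cyl_prob x \<tau> n)) \<partial>path_measure S x)
    = ennreal (exp (- \<epsilon> * real n)) * (\<integral>\<^sup>+\<tau>. ennreal (cyl_prob y \<tau> n / cyl_prob x \<tau> n) \<partial>path_measure S x)"
  proof -
    have "ennreal (exp (- \<epsilon> * real n) * (cyl_prob y \<tau> n / cyl_prob x \<tau> n)) =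
      ennreal (exp (- \<epsilon> * real n)) * ennreal (cyl_prob y \<tau> n / cyl_prob x \<tau> n)" for \<tau>
      by (rule ennreal_mult') simp
    then show ?thesis by (simp only:) (rule nn_integral_cmult[OF measurable_path_cong[OF m']])
  qed
  also have "\<dots> \<le> ennreal (exp (- \<epsilon> * real n)) * 1" by (intro mult_left_mono nn_integral_likelihood_ratio) simp
  also have "\<dots> = ennreal (exp (- \<epsilon>) ^ n)" by (simp add: exp_of_nat_mult[symmetric] mult.commute)
  finally show "(\<integral>\<^sup>+\<tau>. ennreal (exp (- \<epsilon> * real n) * (cyl_prob y \<tau> n / cyl_prob x \<tau> n)) \<partial>path_measure S x) \<le> ennreal (exp (- \<epsilon>) ^ n)" .
next
  show "summable (\<lambda>n. exp (- \<epsilon>) ^ n)" using \<epsilon> by (intro summable_geometric) simp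
qed simp

text \<open>The difference of the Birkhoff sums is a logarithmic likelihood ratio. Its upper growth
  is controlled under the path measure of x; the lower one is the upper growth of the inverse ratio
  under the path measure of y, transferred to x.\<close>

lemma same_averages_case_b:
  assumes ac: "absolutely_continuous_system S"
    and f: "\<And>e x. f e x = (if x \<in> cell S (src S e) then - ln (wgt S e x) else 0)"
  shows "same_averages (fun_ext f)"
  unfolding same_averages_def
proof (intro allI ballI)
  fix j x y assume x: "x \<in> cell S j" and y: "y \<in> cell S j"
  have up: "AE \<tau> in path_measure S x. \<forall>m::nat. \<exists>C::nat. \<forall>n. exp (- (1 / Suc m) * real n) * (cyl_prob y \<tau> n / cyl_prob x \<tau> n) \<le> real C" for x y
    unfolding AE_all_countable by (intro allI AE_likelihood_ratio_growth) simp
  have birk: "birk (fun_ext f) n z \<tau> = - ln (cyl_prob z \<tau> n)" if fol: "follows z \<tau>" for z \<tau> n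
  proof (induction n)
    case 0 then show ?case by (simp add: birk_def)
  next
    case (Suc n)
    obtain e where e: "\<tau> (Suc n) = Some e" "0 < wgt S e (orbit S \<tau> n z)" "orbit S \<tau> n z \<in> cell S (src S e)"
      using follows_edge[OF fol] by blast
    have "birk (fun_ext f) (Suc n) z \<tau> = birk (fun_ext f) n z \<tau> - ln (wgt S e (orbit S \<tau> n z))"
      unfolding birk_def using e f by simp
    also have "\<dots> = - ln (cyl_prob z \<tau> (Suc n))"
      unfolding Suc using e follows_cyl_prob_pos[OF fol, of n] by (simp add: ln_mult)
    finally show ?case .
  qed
  show "AE \<tau> in path_measure S x. (\<lambda>n. (birk (fun_ext f) n x \<tau> - birk (fun_ext f) n y \<tau>) / real n) \<longlonglongrightarrow> 0"
    using up[of y x] AE_path_transfer[OF ac x y up[of x y]] AE_follows[of x] AE_path_transfer[OF ac x y AE_follows]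
  proof eventually_elim
    case (elim \<tau>)
    note pos = follows_cyl_prob_pos[OF elim(3)] follows_cyl_prob_pos[OF elim(4)]
    have eq: "birk (fun_ext f) n x \<tau> - birk (fun_ext f) n y \<tau> = ln (cyl_prob y \<tau> n) - ln (cyl_prob x \<tau> n)" for n
      using birk[OF elim(3)] birk[OF elim(4)] by simp
    show ?case
    proof (rule tendstoI)
      fix \<epsilon> :: real assume "0 < \<epsilon>"
      then have "0 < \<epsilon> / 2" by simp
      from log_ratio_growth[OF elim(1) pos this] log_ratio_growth[OF elim(2) pos(2,1) this]
      show "\<forall>\<^sub>F n in sequentially. dist ((birk (fun_ext f) n x \<tau> - birk (fun_ext f) n y \<tau>) / real n) 0 < \<epsilon>"
      proof eventually_elim
        case (elim n)
        have "(ln (cyl_prob x \<tau> n) - ln (cyl_prob y \<tau> n)) / n = - ((ln (cyl_prob y \<tau> n) - ln (cyl_prob x \<tau> n)) / n)"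
          by (simp add: minus_divide_left)
        with elim have "\<bar>(ln (cyl_prob y \<tau> n) - ln (cyl_prob x \<tau> n)) / n\<bar> \<le> \<epsilon> / 2" by linarith
        with \<open>0 < \<epsilon>\<close> have "\<bar>(ln (cyl_prob y \<tau> n) - ln (cyl_prob x \<tau> n)) / n\<bar> < \<epsilon>" by linarith
        then show ?case unfolding eq dist_real_def diff_0_right .
      qed
    qed
  qed
qed

end

subsection \<open>The coding map\<close>

abbreviation codes :: "(int \<Rightarrow> 'e option) measure" where
  "codes \<equiv> code_space UNIV"

lemma space_codes[simp]: "space codes = UNIV" by (simp add: space_PiM)

lemma sets_code_borel_UNIV: "sets (code_borel UNIV :: (int \<Rightarrow> 'e::countable option) measure) = sets codes"
  by (rule sets_code_borel) simp

lemma space_past[simp]: "space past = UNIV"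
  unfolding past_def by (simp add: topspace_code_top space_measure_of_conv)

lemma sets_past: "sets past = sigma_sets UNIV {cylinder UNIV {m..0} e | m e. m \<le> 0}"
  unfolding past_def by (simp add: topspace_code_top)

lemma depends_on_mono: "depends_on A B \<Longrightarrow> A \<subseteq> A' \<Longrightarrow> depends_on A' B"
  unfolding depends_on_def by blast

lemma depends_on_in_past:
  fixes B :: "(int \<Rightarrow> 'e::countable option) set"
  assumes "finite A" "A \<subseteq> {..0}" "depends_on A B"
  shows "B \<in> sets past"
proof -
  define m where "m = Min (insert 0 A)"
  have m: "m \<le> 0" "A \<subseteq> {m..0}" using assms(1,2) by (auto simp: m_def)
  have "B \<inter> PiE UNIV (\<lambda>_. UNIV) \<in> sets past"
  proof (rule depends_on_in_sigma)
    show "depends_on {m..0} B" using depends_on_mono[OF assms(3) m(2)] .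
    show "cylinder UNIV {m..0} e \<in> sets past" for e :: "int \<Rightarrow> 'e option"
      unfolding sets_past using m(1) by (intro sigma_sets.Basic) blast
  qed simp
  then show ?thesis by simp
qed

lemma measurable_past_coords:
  fixes g :: "(int \<Rightarrow> 'e::countable option) \<Rightarrow> 'b"
  assumes "finite A" "A \<subseteq> {..0}" and g: "\<And>\<sigma> \<tau>. (\<And>i. i \<in> A \<Longrightarrow> \<sigma> i = \<tau> i) \<Longrightarrow> g \<sigma> = g \<tau>"
    and sp: "\<And>\<sigma>. g \<sigma> \<in> space N"
  shows "g \<in> past \<rightarrow>\<^sub>M N"
proof (rule measurableI)
  fix B assume "B \<in> sets N"
  have "depends_on A (g -` B)" unfolding depends_on_def using g by (metis vimage_eq)
  then show "g -` B \<inter> space past \<in> sets past"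
    using depends_on_in_past[OF assms(1,2)] by simp
qed (rule sp)

lemma sets_past_subset: "sets past \<subseteq> sets (codes :: (int \<Rightarrow> 'e::countable option) measure)"
proof -
  have "{cylinder UNIV {m..0} e | m e. m \<le> 0} \<subseteq> sets (codes :: (int \<Rightarrow> 'e option) measure)"
    by (auto intro!: cylinder_in_sets)
  then show ?thesis unfolding sets_past
    using sets.sigma_sets_subset[of _ "codes :: (int \<Rightarrow> 'e option) measure"] by simp
qed

lemma measurable_past_codes: "g \<in> past \<rightarrow>\<^sub>M N \<Longrightarrow> g \<in> (codes :: (int \<Rightarrow> 'e::countable option) measure) \<rightarrow>\<^sub>M N"
  using sets_past_subset unfolding measurable_def by auto

lemma measurable_code_coord[measurable]: "(\<lambda>\<sigma>. \<sigma> i) \<in> codes \<rightarrow>\<^sub>M count_space UNIV"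
  by (rule measurable_component_singleton) simp

lemma measurable_shift[measurable]: "shift \<in> codes \<rightarrow>\<^sub>M codes"
  unfolding shift_def[abs_def] by (rule measurable_PiM_single') auto

lemma shift_pow: "(shift ^^ n) \<sigma> = (\<lambda>i. \<sigma> (i + int n))"
  by (induction n arbitrary: \<sigma>) (simp_all add: shift_def funpow_swap1 add_ac)

definition forward :: "(int \<Rightarrow> 'e option) \<Rightarrow> nat \<Rightarrow> 'e option" where
  "forward \<sigma> = (\<lambda>n\<in>{1..}. \<sigma> (int n))"

lemma forward_apply[simp]: "1 \<le> n \<Longrightarrow> forward \<sigma> n = \<sigma> (int n)" by (simp add: forward_def)

lemma forward_Suc[simp]: "forward \<sigma> (Suc n) = \<sigma> (1 + int n)" by (simp add: forward_def)

lemma measurable_forward[measurable]: "forward \<in> codes \<rightarrow>\<^sub>M future"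
  unfolding forward_def[abs_def] by (rule measurable_restrict) measurable

locale msys_code = msys S for S :: "('k::complete_space, 'e::countable, 'n) markov" +
  fixes b :: "'n \<Rightarrow> 'k" and z :: 'n
  assumes ucs: "uniformly_continuous_system S" and b_cell: "\<And>i. b i \<in> cell S i"
begin

abbreviation "F \<equiv> coding_map S b z"

lemma backward_cong: "(\<And>i. i \<in> {- int n..0} \<Longrightarrow> \<sigma> i = \<tau> i) \<Longrightarrow> backward S \<sigma> n x = backward S \<tau> n x"
proof (induction n arbitrary: x)
  case (Suc n)
  have "\<sigma> (- int (Suc n)) = \<tau> (- int (Suc n))" by (rule Suc.prems) simp
  then show ?case using Suc.IH Suc.prems by simp
qed simp

lemma backward_seq_cong: "(\<And>i. i \<in> {- int n..0} \<Longrightarrow> \<sigma> i = \<tau> i) \<Longrightarrow> backward_seq S b z \<sigma> n = backward_seq S b z \<tau> n"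
  unfolding backward_seq_def using backward_cong[of n \<sigma> \<tau>] by simp

lemma backward_shift: "backward S (shift \<sigma>) (Suc n) x = wmap_ext S (\<sigma> 1) (backward S \<sigma> n x)"
proof (induction n arbitrary: x)
  case 0 then show ?case by (simp add: shift_def)
next
  case (Suc n)
  have "backward S (shift \<sigma>) (Suc (Suc n)) x = backward S (shift \<sigma>) (Suc n) (wmap_ext S (shift \<sigma> (- int (Suc (Suc n)))) x)"
    by (rule backward.simps)
  also have "shift \<sigma> (- int (Suc (Suc n))) = \<sigma> (- int (Suc n))" by (simp add: shift_def)
  finally show ?case unfolding Suc by simp
qed

lemma backward_seq_shift: "backward_seq S b z (shift \<sigma>) (Suc n) = wmap_ext S (\<sigma> 1) (backward_seq S b z \<sigma> n)"
  unfolding backward_seq_def backward_shift by (simp add: shift_def)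

lemma admissible_edge:
  assumes "\<sigma> \<in> admissible S z"
  obtains e where "\<sigma> n = Some e" "src_ext S z (\<sigma> n) = src S e" "tgt_ext S z (\<sigma> n) = tgt S e"
  using assms unfolding admissible_def by (cases "\<sigma> n") (auto dest: spec[of _ n])

lemma backward_in_cell:
  assumes \<sigma>: "\<sigma> \<in> admissible S z"
  shows "x \<in> cell S (src_ext S z (\<sigma> (- int n))) \<Longrightarrow> backward S \<sigma> n x \<in> cell S (tgt_ext S z (\<sigma> 0))"
proof (induction n arbitrary: x)
  case 0
  obtain e where e: "\<sigma> 0 = Some e" using admissible_edge[OF \<sigma>] by blast
  from 0 show ?case by (simp add: e wmap_cell)
next
  case (Suc n)
  obtain e where e: "\<sigma> (- int (Suc n)) = Some e" using admissible_edge[OF \<sigma>] by blast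
  have "src_ext S z (\<sigma> (- int (Suc n) + 1)) = tgt_ext S z (\<sigma> (- int (Suc n)))"
    using \<sigma> unfolding admissible_def by blast
  then have "src_ext S z (\<sigma> (- int n)) = tgt S e" unfolding e by simp
  moreover have "wmap S e x \<in> cell S (tgt S e)" using Suc.prems unfolding e by (simp add: wmap_cell)
  ultimately show ?case using Suc.IH by (simp add: e[simplified])
qed

text \<open>Keeps the approximants of the coding map inside one cell, the only place where the next
  map is known to be continuous.\<close>

lemma backward_seq_in_cell: "\<sigma> \<in> admissible S z \<Longrightarrow> backward_seq S b z \<sigma> n \<in> cell S (tgt_ext S z (\<sigma> 0))"
  unfolding backward_seq_def by (rule backward_in_cell) (auto simp: b_cell)

lemma admissible_shift: "\<sigma> \<in> admissible S z \<Longrightarrow> shift \<sigma> \<in> admissible S z"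
proof -
  assume \<sigma>: "\<sigma> \<in> admissible S z"
  have "\<sigma> (n + 1) \<noteq> None \<and> src_ext S z (\<sigma> (n + 1 + 1)) = tgt_ext S z (\<sigma> (n + 1))" for n
    using \<sigma> unfolding admissible_def by blast
  then show ?thesis unfolding admissible_def shift_def by blast
qed

text \<open>Unlike \<open>F\<close>, whose domain involves the future as well, \<open>F0\<close> is measurable with respect to
  the past; the two agree on the coding domain.\<close>

definition F0 :: "(int \<Rightarrow> 'e option) \<Rightarrow> 'k" where
  "F0 \<sigma> = (if convergent (backward_seq S b z \<sigma>) then lim (backward_seq S b z \<sigma>) else b (tgt_ext S z (\<sigma> 0)))"

lemma F_eq_F0: "\<sigma> \<in> coding_domain S b z \<Longrightarrow> F \<sigma> = F0 \<sigma>"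
  by (simp add: coding_map_def F0_def coding_domain_def)

text \<open>By completeness convergence is the Cauchy criterion, a countable combination of
  conditions on finitely many past letters.\<close>

lemma past_convergent: "{\<sigma>. convergent (backward_seq S b z \<sigma>)} \<in> sets past"
proof -
  let ?P = "\<lambda>j m n \<sigma>. dist (backward_seq S b z \<sigma> m) (backward_seq S b z \<sigma> n) < 1 / real (Suc j)"
  have [measurable]: "Measurable.pred past (?P j m n)" for j m n
  proof (rule measurable_past_coords[where A="{- int (max m n)..0}"])
    fix \<sigma> \<tau> :: "int \<Rightarrow> 'e option" assume *: "\<And>i. i \<in> {- int (max m n)..0} \<Longrightarrow> \<sigma> i = \<tau> i"
    have "backward_seq S b z \<sigma> m = backward_seq S b z \<tau> m" by (rule backward_seq_cong) (use * in auto)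
    moreover have "backward_seq S b z \<sigma> n = backward_seq S b z \<tau> n" by (rule backward_seq_cong) (use * in auto)
    ultimately show "?P j m n \<sigma> = ?P j m n \<tau>" by simp
  qed auto
  have "{\<sigma> \<in> space past. \<forall>j. \<exists>N. \<forall>m\<ge>N. \<forall>n\<ge>N. ?P j m n \<sigma>} \<in> sets past" by measurable
  moreover have "convergent (backward_seq S b z \<sigma>) \<longleftrightarrow> (\<forall>j. \<exists>N. \<forall>m\<ge>N. \<forall>n\<ge>N. ?P j m n \<sigma>)" for \<sigma>
    unfolding Cauchy_convergent_iff[symmetric] Cauchy_def
  proof (intro iffI allI impI)
    fix \<epsilon> :: real assume *: "\<forall>j. \<exists>N. \<forall>m\<ge>N. \<forall>n\<ge>N. ?P j m n \<sigma>" and "0 < \<epsilon>"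
    then obtain j where "1 / real (Suc j) < \<epsilon>" using nat_approx_posE by blast
    then show "\<exists>N. \<forall>m\<ge>N. \<forall>n\<ge>N. dist (backward_seq S b z \<sigma> m) (backward_seq S b z \<sigma> n) < \<epsilon>"
      using *[rule_format, of j] by (meson less_trans)
  qed simp
  ultimately show ?thesis by simp
qed

lemma measurable_F0[measurable]: "F0 \<in> past \<rightarrow>\<^sub>M borel"
proof (rule borel_measurable_LIMSEQ_metric)
  let ?f = "\<lambda>n \<sigma>. if convergent (backward_seq S b z \<sigma>) then backward_seq S b z \<sigma> n else b (tgt_ext S z (\<sigma> 0))"
  have [measurable]: "Measurable.pred past (\<lambda>\<sigma>. convergent (backward_seq S b z \<sigma>))"
    using past_convergent by (simp add: Measurable.pred_def)
  have [measurable]: "(\<lambda>\<sigma>. backward_seq S b z \<sigma> n) \<in> past \<rightarrow>\<^sub>M borel" for n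
    by (rule measurable_past_coords[where A="{- int n..0}"]) (auto intro: backward_seq_cong)
  have [measurable]: "(\<lambda>\<sigma>. b (tgt_ext S z (\<sigma> 0))) \<in> past \<rightarrow>\<^sub>M borel"
    by (rule measurable_past_coords[where A="{0}"]) auto
  show "?f n \<in> borel_measurable past" for n by measurable
  show "(\<lambda>n. ?f n \<sigma>) \<longlonglongrightarrow> F0 \<sigma>" for \<sigma>
    by (auto simp: F0_def convergent_LIMSEQ_iff)
qed

lemma measurable_F0_codes[measurable]: "F0 \<in> codes \<rightarrow>\<^sub>M borel"
  by (rule measurable_past_codes[OF measurable_F0])

lemma sets_admissible: "admissible S z \<in> sets codes"
proof -
  have [measurable]: "Measurable.pred codes (\<lambda>\<sigma>. \<sigma> n \<noteq> None \<and> src_ext S z (\<sigma> (n + 1)) = tgt_ext S z (\<sigma> n))" for n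
    by (rule measurable_finite_coords[where A="{n, n + 1}"]) auto
  have "{\<sigma> \<in> space codes. \<forall>n. \<sigma> n \<noteq> None \<and> src_ext S z (\<sigma> (n + 1)) = tgt_ext S z (\<sigma> n)} \<in> sets codes"
    by measurable
  then show ?thesis by (simp add: admissible_def)
qed

lemma sets_coding_domain[measurable]: "coding_domain S b z \<in> sets codes"
proof -
  have "coding_domain S b z = admissible S z \<inter> {\<sigma>. convergent (backward_seq S b z \<sigma>)}"
    unfolding coding_domain_def by auto
  also have "\<dots> \<in> sets codes" using sets_admissible past_convergent sets_past_subset by (intro sets.Int) auto
  finally show ?thesis .
qed

lemma measurable_F[measurable]: "F \<in> codes \<rightarrow>\<^sub>M borel"
proof -
  have [measurable]: "(\<lambda>\<sigma>. b (tgt_ext S z (\<sigma> 0))) \<in> codes \<rightarrow>\<^sub>M borel"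
    by (rule measurable_finite_coords[where A="{0}"]) auto
  have "F = (\<lambda>\<sigma>. if \<sigma> \<in> coding_domain S b z then F0 \<sigma> else b (tgt_ext S z (\<sigma> 0)))"
    using F_eq_F0 by (auto simp: coding_map_def)
  then show ?thesis by simp
qed

lemma cylinder_1: "cylinder UNIV {1..1::int} (\<lambda>_. Some e) = {\<sigma>. \<sigma> 1 = Some e}"
  by (auto simp: cylinder_eq)

lemma sets_letter_1[measurable]: "{\<sigma>. \<sigma> 1 = Some e} \<in> sets (codes :: (int \<Rightarrow> 'e option) measure)"
  using measurable_sets[OF measurable_code_coord[of 1], of "{Some e}"] by (simp add: vimage_def)

text \<open>Expresses the conditional expectation by integrals over events of the past, a form that
  can be checked for conditioned measures and extended to functions.\<close>

lemma equilibrium_iff: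
  "M \<in> equilibrium_states S b z \<longleftrightarrow> sets M = sets codes \<and> prob_space M \<and> distr M M shift = M \<and>
    (AE \<sigma> in M. \<sigma> \<in> coding_domain S b z) \<and>
    (\<forall>e. \<forall>A\<in>sets past. emeasure M (A \<inter> {\<sigma>. \<sigma> 1 = Some e}) = (\<integral>\<^sup>+\<sigma>\<in>A. ennreal (wgt S e (F \<sigma>)) \<partial>M))"
proof (cases "sets M = sets codes \<and> prob_space M \<and> distr M M shift = M")
  case False
  then show ?thesis unfolding equilibrium_states_def shift_invariant_def sets_code_borel_UNIV by auto
next
  case True
  then have sM[measurable_cong]: "sets M = sets codes" and "prob_space M" by auto
  interpret prob_space M by fact
  have spM: "space M = UNIV" using sets_eq_imp_space_eq[OF sM] by simp
  have sub: "subalgebra M past" unfolding subalgebra_def using sets_past_subset sM spM by auto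
  interpret fs: finite_measure_subalgebra M past by unfold_locales (rule sub)
  have dom: "emeasure M (coding_domain S b z) = 1 \<longleftrightarrow> (AE \<sigma> in M. \<sigma> \<in> coding_domain S b z)"
    using prob_Collect_eq_1[of "\<lambda>\<sigma>. \<sigma> \<in> coding_domain S b z"] sets_coding_domain sM
    by (simp add: emeasure_eq_measure spM)
  have key: "(AE \<sigma> in M. real_cond_exp M past (indicator (cylinder UNIV {1..1} (\<lambda>_. Some e))) \<sigma> = wgt S e (F \<sigma>))
    \<longleftrightarrow> (\<forall>A\<in>sets past. emeasure M (A \<inter> {\<sigma>. \<sigma> 1 = Some e}) = (\<integral>\<^sup>+\<sigma>\<in>A. ennreal (wgt S e (F \<sigma>)) \<partial>M))" (is "?L \<longleftrightarrow> ?R")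
    if D: "AE \<sigma> in M. \<sigma> \<in> coding_domain S b z" for e
  proof -
    let ?C = "{\<sigma>. \<sigma> 1 = Some e} :: (int \<Rightarrow> 'e option) set"
    have AM: "A \<in> events" if "A \<in> sets past" for A using that sets_past_subset sM by auto
    have wi: "integrable M (\<lambda>\<sigma>. wgt S e (G \<sigma>))" if "G \<in> codes \<rightarrow>\<^sub>M borel" for G
      using that by (intro integrable_const_bound[where B=1]) (auto cong: measurable_cong_sets)
    have lhs: "(\<integral>\<sigma>\<in>A. indicator ?C \<sigma> \<partial>M) = measure M (A \<inter> ?C)" if "A \<in> sets past" for A
      using AM[OF that] by (simp add: set_lebesgue_integral_def indicator_inter_arith[symmetric] spM)
    have rhs: "(\<integral>\<^sup>+\<sigma>\<in>A. ennreal (wgt S e (F \<sigma>)) \<partial>M) = ennreal (\<integral>\<sigma>\<in>A. wgt S e (F \<sigma>) \<partial>M)" if A: "A \<in> sets past" for A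
    proof -
      have "integrable M (\<lambda>\<sigma>. indicator A \<sigma> *\<^sub>R wgt S e (F \<sigma>))"
        using AM[OF A] wi[OF measurable_F] by (rule integrable_mult_indicator)
      then have "(\<integral>\<^sup>+\<sigma>. ennreal (indicator A \<sigma> *\<^sub>R wgt S e (F \<sigma>)) \<partial>M) = ennreal (\<integral>\<sigma>\<in>A. wgt S e (F \<sigma>) \<partial>M)"
        unfolding set_lebesgue_integral_def by (rule nn_integral_eq_integral) auto
      moreover have "ennreal (indicator A \<sigma> *\<^sub>R wgt S e (F \<sigma>)) = ennreal (wgt S e (F \<sigma>)) * indicator A \<sigma>" for \<sigma>
        by (auto split: split_indicator)
      ultimately show ?thesis by simp
    qed
    have nn: "0 \<le> (\<integral>\<sigma>\<in>A. wgt S e (F \<sigma>) \<partial>M)" for A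
      unfolding set_lebesgue_integral_def by (rule integral_nonneg_AE) auto
    have Ci: "integrable M (indicator ?C :: _ \<Rightarrow> real)" using sM by (intro integrable_real_indicator) (auto simp: emeasure_eq_measure)
    show ?thesis
    proof
      assume L: ?L
      show ?R
      proof
        fix A :: "(int \<Rightarrow> 'e option) set" assume A: "A \<in> sets past"
        have "measure M (A \<inter> ?C) = (\<integral>\<sigma>\<in>A. real_cond_exp M past (indicator ?C) \<sigma> \<partial>M)"
          unfolding lhs[OF A, symmetric] by (rule fs.real_cond_exp_intA[OF Ci A])
        also have "\<dots> = (\<integral>\<sigma>\<in>A. wgt S e (F \<sigma>) \<partial>M)"
          using L AM[OF A] unfolding cylinder_1 by (intro set_lebesgue_integral_cong_AE) auto
        finally show "emeasure M (A \<inter> ?C) = (\<integral>\<^sup>+\<sigma>\<in>A. ennreal (wgt S e (F \<sigma>)) \<partial>M)"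
          unfolding rhs[OF A] emeasure_eq_measure by simp
      qed
    next
      assume R: ?R
      \<comment> \<open>The conditional expectation is characterised by a function measurable for
        \<open>past\<close>; hence \<open>F0\<close> stands in for \<open>F\<close>.\<close>
      have FF0: "AE \<sigma> in M. F \<sigma> = F0 \<sigma>" using D by eventually_elim (rule F_eq_F0)
      have "AE \<sigma> in M. real_cond_exp M past (indicator ?C) \<sigma> = wgt S e (F0 \<sigma>)"
      proof (rule fs.real_cond_exp_charact)
        fix A :: "(int \<Rightarrow> 'e option) set" assume A: "A \<in> sets past"
        have "measure M (A \<inter> ?C) = (\<integral>\<sigma>\<in>A. wgt S e (F \<sigma>) \<partial>M)"
          using R[rule_format, OF A] nn unfolding rhs[OF A] emeasure_eq_measure by simp
        also have "\<dots> = (\<integral>\<sigma>\<in>A. wgt S e (F0 \<sigma>) \<partial>M)"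
          using FF0 AM[OF A] by (intro set_lebesgue_integral_cong_AE) auto
        finally show "(\<integral>\<sigma>\<in>A. indicator ?C \<sigma> \<partial>M) = (\<integral>\<sigma>\<in>A. wgt S e (F0 \<sigma>) \<partial>M)" unfolding lhs[OF A] .
      qed (use Ci wi[OF measurable_F0_codes] in auto)
      then show ?L unfolding cylinder_1 using FF0 by eventually_elim simp
    qed
  qed
  show ?thesis
    unfolding equilibrium_states_def shift_invariant_def sets_code_borel_UNIV mem_Collect_eq dom
    using True key by blast
qed

end

section \<open>Dynamics of an equilibrium state and conditional law of its future\<close>

locale equilibrium = msys_code S b z
  for S :: "('k::complete_space, 'e::countable, 'n) markov" and b z +
  fixes M :: "(int \<Rightarrow> 'e option) measure"
  assumes M: "M \<in> equilibrium_states S b z"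
begin

lemma sets_M[simp, measurable_cong]: "sets M = sets codes" using M equilibrium_iff by blast
lemma space_M[simp]: "space M = UNIV" using sets_eq_imp_space_eq[OF sets_M] by simp
lemma prob_space_M: "prob_space M" using M equilibrium_iff by blast

sublocale prob_space M by (rule prob_space_M)

lemma distr_shift: "distr M M shift = M" using M equilibrium_iff by blast
lemma AE_domain: "AE \<sigma> in M. \<sigma> \<in> coding_domain S b z" using M equilibrium_iff by blast

lemma cond: "A \<in> sets past \<Longrightarrow> emeasure M (A \<inter> {\<sigma>. \<sigma> 1 = Some e}) = (\<integral>\<^sup>+\<sigma>\<in>A. ennreal (wgt S e (F \<sigma>)) \<partial>M)"
  using M equilibrium_iff by blast

lemma measurable_past_M: "g \<in> past \<rightarrow>\<^sub>M N \<Longrightarrow> g \<in> M \<rightarrow>\<^sub>M N"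
  using measurable_past_codes by (simp cong: measurable_cong_sets)

lemma emeasure_shift: "A \<in> sets codes \<Longrightarrow> emeasure M (shift -` A) = emeasure M A"
  using emeasure_distr[of shift M M A] distr_shift by (simp cong: measurable_cong_sets)

lemma nn_integral_shift: "f \<in> borel_measurable codes \<Longrightarrow> (\<integral>\<^sup>+\<sigma>. f (shift \<sigma>) \<partial>M) = (\<integral>\<^sup>+\<sigma>. f \<sigma> \<partial>M)"
  using nn_integral_distr[of shift M M f] distr_shift by (simp cong: measurable_cong_sets)

lemma AE_F_eq_F0: "AE \<sigma> in M. F \<sigma> = F0 \<sigma>" using AE_domain by eventually_elim (rule F_eq_F0)

text \<open>Extends \<open>cond\<close> from events to functions of the past: the two densities
  define the same measure on the \<sigma>-algebra \<open>past\<close>, to which both are pushed by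
  the identity.\<close>

lemma nn_integral_cond:
  assumes Y: "Y \<in> borel_measurable past"
  shows "(\<integral>\<^sup>+\<sigma>. indicator {\<sigma>. \<sigma> 1 = Some e} \<sigma> * Y \<sigma> \<partial>M) = (\<integral>\<^sup>+\<sigma>. ennreal (wgt S e (F \<sigma>)) * Y \<sigma> \<partial>M)"
proof -
  have id: "(\<lambda>x. x) \<in> M \<rightarrow>\<^sub>M past" by (rule measurable_past_M) simp
  let ?N1 = "density M (indicator {\<sigma>. \<sigma> 1 = Some e})" and ?N2 = "density M (\<lambda>\<sigma>. ennreal (wgt S e (F \<sigma>)))"
  have id': "(\<lambda>x. x) \<in> density M f \<rightarrow>\<^sub>M past" for f using id by simp
  have m: "indicator {\<sigma>. \<sigma> 1 = Some e} \<in> borel_measurable M" "(\<lambda>\<sigma>. ennreal (wgt S e (F \<sigma>))) \<in> borel_measurable M" by measurable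
  have "distr ?N1 past (\<lambda>x. x) = distr ?N2 past (\<lambda>x. x)"
  proof (rule measure_eqI)
    fix A assume "A \<in> sets (distr ?N1 past (\<lambda>x. x))"
    then have A: "A \<in> sets past" by simp
    then have AM: "A \<in> sets M" using sets_past_subset by auto
    have "emeasure (distr ?N1 past (\<lambda>x. x)) A = emeasure ?N1 A" using A by (simp add: emeasure_distr[OF id' A])
    also have "\<dots> = emeasure M (A \<inter> {\<sigma>. \<sigma> 1 = Some e})"
      using AM m by (simp add: emeasure_density indicator_inter_arith[symmetric] Int_commute)
    also have "\<dots> = emeasure ?N2 A" unfolding cond[OF A] using AM m by (simp add: emeasure_density)
    also have "\<dots> = emeasure (distr ?N2 past (\<lambda>x. x)) A" using A by (simp add: emeasure_distr[OF id' A])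
    finally show "emeasure (distr ?N1 past (\<lambda>x. x)) A = emeasure (distr ?N2 past (\<lambda>x. x)) A" .
  qed simp
  then have "(\<integral>\<^sup>+\<sigma>. Y \<sigma> \<partial>distr ?N1 past (\<lambda>x. x)) = (\<integral>\<^sup>+\<sigma>. Y \<sigma> \<partial>distr ?N2 past (\<lambda>x. x))" by simp
  then show ?thesis
    using measurable_past_M[OF Y] m by (simp add: nn_integral_distr[OF id'] Y nn_integral_density)
qed

text \<open>For each edge the set where its weight at \<open>F0\<close> vanishes is an event of the
  past, and on it the edge has conditional probability zero.\<close>

lemma AE_wgt_pos: "AE \<sigma> in M. \<forall>e. \<sigma> 1 = Some e \<longrightarrow> 0 < wgt S e (F \<sigma>)"
  unfolding AE_all_countable
proof
  fix e
  let ?Z = "{\<sigma>. wgt S e (F0 \<sigma>) = 0}"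
  have Z: "?Z \<in> sets past"
    using measurable_sets[OF measurable_compose[OF measurable_F0 measurable_wgt], of "{0}" e] by (simp add: vimage_def)
  have ZM: "?Z \<in> sets M" using Z sets_past_subset by auto
  have "emeasure M (?Z \<inter> {\<sigma>. \<sigma> 1 = Some e}) = (\<integral>\<^sup>+\<sigma>\<in>?Z. ennreal (wgt S e (F \<sigma>)) \<partial>M)" by (rule cond[OF Z])
  also have "\<dots> = (\<integral>\<^sup>+\<sigma>. 0 \<partial>M)"
    using AE_F_eq_F0 by (intro nn_integral_cong_AE) (auto elim!: eventually_mono split: split_indicator)
  finally have "emeasure M (?Z \<inter> {\<sigma>. \<sigma> 1 = Some e}) = 0" by simp
  then have "AE \<sigma> in M. \<sigma> \<notin> ?Z \<inter> {\<sigma>. \<sigma> 1 = Some e}"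
    using ZM by (intro AE_not_in) (auto simp: null_sets_def)
  then show "AE \<sigma> in M. \<sigma> 1 = Some e \<longrightarrow> 0 < wgt S e (F \<sigma>)"
    using AE_F_eq_F0
  proof eventually_elim
    case (elim \<sigma>)
    then show ?case using wgt_nonneg[of e "F \<sigma>"] by (auto simp: less_le)
  qed
qed

text \<open>Shifting applies the map of the letter at 1 to every approximant, and continuity on the
  source cell passes this to the limit. Cells need not be closed, so that the limit
  \<open>F \<sigma>\<close> stays in the source cell is deduced from the positive weight of the
  letter there.\<close>

lemma AE_step:
  "AE \<sigma> in M. \<exists>e. \<sigma> 1 = Some e \<and> 0 < wgt S e (F \<sigma>) \<and> F \<sigma> \<in> cell S (src S e) \<and> F (shift \<sigma>) = wmap S e (F \<sigma>)"
  using AE_domain AE_wgt_pos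
proof eventually_elim
  case (elim \<sigma>)
  then have \<sigma>: "\<sigma> \<in> admissible S z" and conv: "convergent (backward_seq S b z \<sigma>)" by (auto simp: coding_domain_def)
  obtain e where e: "\<sigma> 1 = Some e" using admissible_edge[OF \<sigma>] by blast
  have pos: "0 < wgt S e (F \<sigma>)" using elim(2) e by blast
  then have Fc: "F \<sigma> \<in> cell S (src S e)" by (rule wgt_pos_cell)
  have "src_ext S z (\<sigma> (0 + 1)) = tgt_ext S z (\<sigma> 0)" using \<sigma> unfolding admissible_def by blast
  then have te: "tgt_ext S z (\<sigma> 0) = src S e" using e by simp
  have lim: "backward_seq S b z \<sigma> \<longlonglongrightarrow> F \<sigma>"
    using elim(1) conv by (simp add: coding_map_def convergent_LIMSEQ_iff)
  have "continuous_on (cell S (src S e)) (wmap S e)"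
    using ucs unfolding uniformly_continuous_system_def by (blast intro: uniformly_continuous_imp_continuous)
  then have "(\<lambda>n. wmap S e (backward_seq S b z \<sigma> n)) \<longlonglongrightarrow> wmap S e (F \<sigma>)"
    by (rule continuous_on_tendsto_compose[OF _ lim Fc])
       (use backward_seq_in_cell[OF \<sigma>] te in auto)
  then have "(\<lambda>n. backward_seq S b z (shift \<sigma>) (Suc n)) \<longlonglongrightarrow> wmap S e (F \<sigma>)"
    unfolding backward_seq_shift e by simp
  then have l: "backward_seq S b z (shift \<sigma>) \<longlonglongrightarrow> wmap S e (F \<sigma>)" by (simp only: filterlim_sequentially_Suc)
  then have "shift \<sigma> \<in> coding_domain S b z"
    using admissible_shift[OF \<sigma>] by (auto simp: coding_domain_def convergent_def)
  then have "F (shift \<sigma>) = wmap S e (F \<sigma>)" using limI[OF l] by (simp add: coding_map_def[of S b z "shift \<sigma>"])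
  with e pos Fc show ?case by blast
qed

lemma measurable_unshift_past: "(\<lambda>\<tau> i. \<tau> (i - 1)) \<in> past \<rightarrow>\<^sub>M (past :: (int \<Rightarrow> 'e option) measure)"
  unfolding past_def[of]
proof (rule measurable_sigma_sets[where \<Omega>=UNIV and A="{cylinder UNIV {m..0} e | m e. m \<le> 0}"])
  show "sets (sigma (topspace (code_top UNIV)) {cylinder UNIV {m..0} e |m e. m \<le> 0})
    = sigma_sets UNIV {cylinder UNIV {m..0} (e :: int \<Rightarrow> 'e option) |m e. m \<le> 0}"
    using sets_past unfolding past_def .
  fix Y :: "(int \<Rightarrow> 'e option) set" assume "Y \<in> {cylinder UNIV {m..0} e | m e. m \<le> 0}"
  then obtain m and e :: "int \<Rightarrow> 'e option" where Y: "Y = cylinder UNIV {m..0} e" by blast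
  have "depends_on {m - 1..-1} ((\<lambda>\<tau> i. \<tau> (i - 1)) -` Y)"
    unfolding depends_on_def Y cylinder_eq
  proof (intro allI impI)
    fix \<sigma> \<tau> :: "int \<Rightarrow> 'e option" assume *: "\<forall>i\<in>{m - 1..-1}. \<sigma> i = \<tau> i"
    have "\<sigma> (i - 1) = \<tau> (i - 1)" if "i \<in> {m..0}" for i using *[rule_format, of "i - 1"] that by simp
    then show "\<sigma> \<in> (\<lambda>\<tau> i. \<tau> (i - 1)) -` {\<sigma> \<in> UNIV \<rightarrow>\<^sub>E UNIV. \<forall>i\<in>{m..0}. \<sigma> i = e i} \<longleftrightarrow>
      \<tau> \<in> (\<lambda>\<tau> i. \<tau> (i - 1)) -` {\<sigma> \<in> UNIV \<rightarrow>\<^sub>E UNIV. \<forall>i\<in>{m..0}. \<sigma> i = e i}" by auto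
  qed
  then have "(\<lambda>\<tau> i. \<tau> (i - 1)) -` Y \<in> sets past" by (intro depends_on_in_past) auto
  then show "(\<lambda>\<tau> i. \<tau> (i - 1)) -` Y \<inter> space (sigma (topspace (code_top UNIV)) {cylinder UNIV {m..0} e |m e. m \<le> 0})
    \<in> sets (sigma (topspace (code_top UNIV)) {cylinder UNIV {m..0} (e :: int \<Rightarrow> 'e option) |m e. m \<le> 0})"
    unfolding past_def[symmetric] by simp
qed auto

text \<open>By invariance the first letter can be shifted to position 0 and absorbed into the past;
  then the induction hypothesis covers the other letters, and \<open>nn_integral_cond\<close>
  returns the weight of the first. This is why the induction runs over all past events
  \<open>A\<close>.\<close>

lemma emeasure_past_cylinder:
  assumes "A \<in> sets past"
  shows "emeasure M (A \<inter> {\<sigma>. \<forall>i\<in>{1..k}. \<sigma> (int i) = e i}) = (\<integral>\<^sup>+\<sigma>\<in>A. ennreal (cyl_prob (F \<sigma>) e k) \<partial>M)"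
  using assms
proof (induction k arbitrary: A e)
  case 0
  then have "A \<in> sets M" using sets_past_subset by auto
  then show ?case by simp
next
  case (Suc k)
  note [measurable] = Suc.prems[THEN subsetD[OF sets_past_subset]]
  have cylm: "{\<sigma>. \<forall>i\<in>{1..k}. \<sigma> (int i) = e' i} \<in> sets (codes :: (int \<Rightarrow> 'e option) measure)" for k e'
    using depends_on_in_sets[of "int ` {1..k}" UNIV "{\<sigma>. \<forall>i\<in>{1..k}. \<sigma> (int i) = e' i}"] by (simp add: depends_on_def)
  show ?case
  proof (cases "e 1")
    case None
    have "AE \<sigma> in M. \<sigma> \<notin> A \<inter> {\<sigma>. \<forall>i\<in>{1..Suc k}. \<sigma> (int i) = e i}"
      using AE_step
    proof eventually_elim
      case (elim \<sigma>)
      then have "\<sigma> 1 \<noteq> None" by auto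
      then have "\<sigma> (int 1) \<noteq> e 1" using None by simp
      then show ?case by force
    qed
    then have "emeasure M (A \<inter> {\<sigma>. \<forall>i\<in>{1..Suc k}. \<sigma> (int i) = e i}) = 0"
      using cylm[of "Suc k" e] by (subst AE_iff_measurable[symmetric, where P="\<lambda>\<sigma>. \<sigma> \<notin> A \<inter> {\<sigma>. \<forall>i\<in>{1..Suc k}. \<sigma> (int i) = e i}"]) auto
    then show ?thesis unfolding cyl_prob_Suc_shift None by simp
  next
    case (Some e1)
    let ?e = "\<lambda>n. e (Suc n)"
    \<comment> \<open>The event \<open>A\<close> together with the first letter, seen after one
      shift: coordinates move one place to the left, so it is still an event of the past.\<close>
    let ?A = "{\<tau>. (\<lambda>i. \<tau> (i - 1)) \<in> A} \<inter> {\<tau>. \<tau> 0 = Some e1}"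
    have A': "?A \<in> sets past"
    proof (rule sets.Int)
      show "{\<tau>. (\<lambda>i. \<tau> (i - 1)) \<in> A} \<in> sets past"
        using measurable_sets[OF measurable_unshift_past Suc.prems] by (simp add: vimage_def)
      show "{\<tau> :: int \<Rightarrow> 'e option. \<tau> 0 = Some e1} \<in> sets past"
        by (rule depends_on_in_past[of "{0}"]) (auto simp: depends_on_def)
    qed
    have A'c: "?A \<in> sets codes" using A' sets_past_subset by auto
    have sh: "shift \<sigma> \<in> ?A \<longleftrightarrow> \<sigma> \<in> A \<and> \<sigma> 1 = Some e1" for \<sigma> by (simp add: shift_def)
    have cyl: "(\<forall>i\<in>{1..Suc k}. \<sigma> (int i) = e i) \<longleftrightarrow> \<sigma> 1 = Some e1 \<and> (\<forall>i\<in>{1..k}. shift \<sigma> (int i) = ?e i)" for \<sigma>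
    proof
      assume *: "\<forall>i\<in>{1..Suc k}. \<sigma> (int i) = e i"
      have "\<sigma> 1 = Some e1" using *[rule_format, of 1] Some by simp
      moreover have "shift \<sigma> (int i) = ?e i" if "i \<in> {1..k}" for i
        using *[rule_format, of "Suc i"] that by (simp add: shift_def add.commute)
      ultimately show "\<sigma> 1 = Some e1 \<and> (\<forall>i\<in>{1..k}. shift \<sigma> (int i) = ?e i)" by blast
    next
      assume *: "\<sigma> 1 = Some e1 \<and> (\<forall>i\<in>{1..k}. shift \<sigma> (int i) = ?e i)"
      show "\<forall>i\<in>{1..Suc k}. \<sigma> (int i) = e i"
      proof
        fix i assume i: "i \<in> {1..Suc k}"
        show "\<sigma> (int i) = e i"
        proof (cases "i = 1")
          case False
          then have "i - 1 \<in> {1..k}" "i = Suc (i - 1)" using i by auto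
          then show ?thesis using * by (metis shift_def of_nat_Suc add.commute)
        qed (use * Some in simp)
      qed
    qed
    have "A \<inter> {\<sigma>. \<forall>i\<in>{1..Suc k}. \<sigma> (int i) = e i} = shift -` (?A \<inter> {\<sigma>. \<forall>i\<in>{1..k}. \<sigma> (int i) = ?e i})"
      using cyl sh by auto
    then have "emeasure M (A \<inter> {\<sigma>. \<forall>i\<in>{1..Suc k}. \<sigma> (int i) = e i}) = emeasure M (?A \<inter> {\<sigma>. \<forall>i\<in>{1..k}. \<sigma> (int i) = ?e i})"
      using emeasure_shift[OF sets.Int[OF A'c cylm]] by simp
    also have "\<dots> = (\<integral>\<^sup>+\<sigma>\<in>?A. ennreal (cyl_prob (F \<sigma>) ?e k) \<partial>M)" by (rule Suc.IH[OF A'])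
    also have "\<dots> = (\<integral>\<^sup>+\<sigma>. ennreal (cyl_prob (F (shift \<sigma>)) ?e k) * indicator ?A (shift \<sigma>) \<partial>M)"
      by (intro nn_integral_shift[symmetric] borel_measurable_times_ennreal borel_measurable_indicator A'c) measurable
    also have "\<dots> = (\<integral>\<^sup>+\<sigma>. indicator {\<sigma>. \<sigma> 1 = Some e1} \<sigma> * (ennreal (cyl_prob (wmap S e1 (F0 \<sigma>)) ?e k) * indicator A \<sigma>) \<partial>M)"
    proof (rule nn_integral_cong_AE)
      show "AE \<sigma> in M. ennreal (cyl_prob (F (shift \<sigma>)) ?e k) * indicator ?A (shift \<sigma>) =
        indicator {\<sigma>. \<sigma> 1 = Some e1} \<sigma> * (ennreal (cyl_prob (wmap S e1 (F0 \<sigma>)) ?e k) * indicator A \<sigma>)"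
        using AE_step AE_F_eq_F0
      proof eventually_elim
        case (elim \<sigma>)
        show ?case
        proof (cases "\<sigma> \<in> A \<and> \<sigma> 1 = Some e1")
          case True
          then have "F (shift \<sigma>) = wmap S e1 (F0 \<sigma>)" using elim by auto
          then show ?thesis using True sh[of \<sigma>] by simp
        next
          case False
          then show ?thesis using sh[of \<sigma>] by (auto split: split_indicator)
        qed
      qed
    qed
    also have "\<dots> = (\<integral>\<^sup>+\<sigma>. ennreal (wgt S e1 (F \<sigma>)) * (ennreal (cyl_prob (wmap S e1 (F0 \<sigma>)) ?e k) * indicator A \<sigma>) \<partial>M)"
      by (intro nn_integral_cond borel_measurable_times_ennreal borel_measurable_indicator Suc.prems) measurable
    also have "\<dots> = (\<integral>\<^sup>+\<sigma>\<in>A. ennreal (cyl_prob (F \<sigma>) e (Suc k)) \<partial>M)"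
    proof (rule nn_integral_cong_AE)
      show "AE \<sigma> in M. ennreal (wgt S e1 (F \<sigma>)) * (ennreal (cyl_prob (wmap S e1 (F0 \<sigma>)) ?e k) * indicator A \<sigma>)
        = ennreal (cyl_prob (F \<sigma>) e (Suc k)) * indicator A \<sigma>"
        using AE_F_eq_F0 by eventually_elim (simp add: cyl_prob_Suc_shift Some ennreal_mult' mult.assoc del: cyl_prob_Suc)
    qed
    finally show ?thesis .
  qed
qed

lemma measurable_path_F: "(\<lambda>\<sigma>. path_measure S (F \<sigma>)) \<in> M \<rightarrow>\<^sub>M subprob_algebra future"
  by (rule measurable_prob_algebraD) measurable

text \<open>Given the past, the future letters have law \<open>path_measure S (F \<sigma>)\<close>.
  Restricting M to \<open>A\<close> by a density reduces the claim to two measures that agree on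
  cylinders.\<close>

lemma emeasure_past_forward:
  assumes A: "A \<in> sets past" and B: "B \<in> sets future"
  shows "emeasure M (A \<inter> {\<sigma>. forward \<sigma> \<in> B}) = (\<integral>\<^sup>+\<sigma>\<in>A. emeasure (path_measure S (F \<sigma>)) B \<partial>M)"
proof -
  have AM[measurable]: "A \<in> sets codes" using A sets_past_subset by auto
  let ?D = "density M (indicator A)"
  have fwd: "forward \<in> ?D \<rightarrow>\<^sub>M future" by simp
  have ker: "(\<lambda>\<sigma>. path_measure S (F \<sigma>)) \<in> ?D \<rightarrow>\<^sub>M subprob_algebra future" using measurable_path_F by simp
  have ne: "space ?D \<noteq> {}" by simp
  have D: "emeasure ?D C = emeasure M (A \<inter> C)" if "C \<in> sets codes" for C
    using that AM by (simp add: emeasure_density indicator_inter_arith[symmetric] Int_commute)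
  have "finite_measure (distr ?D future forward)"
    by (intro finite_measure.finite_measure_distr fwd finite_measureI) (simp add: D[OF sets.top[of codes], unfolded space_codes] emeasure_eq_measure)
  moreover have Bk: "emeasure (?D \<bind> (\<lambda>\<sigma>. path_measure S (F \<sigma>))) C = (\<integral>\<^sup>+\<sigma>\<in>A. emeasure (path_measure S (F \<sigma>)) C \<partial>M)"
    if C: "C \<in> sets future" for C
  proof -
    have "(\<lambda>\<sigma>. emeasure (path_measure S (F \<sigma>)) C) \<in> borel_measurable M"
      using measurable_compose[OF measurable_path_F measurable_emeasure_subprob_algebra[OF C]] .
    then show ?thesis
      by (simp add: emeasure_bind[OF ne ker C] nn_integral_density mult.commute)
  qed
  ultimately have "distr ?D future forward = ?D \<bind> (\<lambda>\<sigma>. path_measure S (F \<sigma>))"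
  proof (intro future_measure_eqI)
    show "sets (?D \<bind> (\<lambda>\<sigma>. path_measure S (F \<sigma>))) = sets future" by (rule sets_bind[OF _ ne]) simp
    fix k :: nat and e :: "nat \<Rightarrow> 'e option"
    have cm: "cylinder {1..} {1..k} e \<in> sets future" by (rule cylinder_in_sets) auto
    have "forward -` cylinder {1..} {1..k} e = {\<sigma>. \<forall>i\<in>{1..k}. \<sigma> (int i) = e i}"
      by (auto simp: cylinder_eq forward_def)
    moreover have "forward -` cylinder {1..} {1..k} e \<in> sets codes"
      using measurable_sets[OF measurable_forward cm] by simp
    ultimately have "emeasure (distr ?D future forward) (cylinder {1..} {1..k} e) = emeasure M (A \<inter> {\<sigma>. \<forall>i\<in>{1..k}. \<sigma> (int i) = e i})"
      by (simp add: emeasure_distr[OF fwd cm] D)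
    also have "\<dots> = (\<integral>\<^sup>+\<sigma>\<in>A. ennreal (cyl_prob (F \<sigma>) e k) \<partial>M)" by (rule emeasure_past_cylinder[OF A])
    finally show "emeasure (distr ?D future forward) (cylinder {1..} {1..k} e) = emeasure (?D \<bind> (\<lambda>\<sigma>. path_measure S (F \<sigma>))) (cylinder {1..} {1..k} e)"
      by (simp add: Bk[OF cm] emeasure_path_cylinder)
  qed simp_all
  then have "emeasure (distr ?D future forward) B = (\<integral>\<^sup>+\<sigma>\<in>A. emeasure (path_measure S (F \<sigma>)) B \<partial>M)" by (simp add: Bk[OF B])
  moreover have "forward -` B \<in> sets codes" using measurable_sets[OF measurable_forward B] by simp
  ultimately show ?thesis using B by (simp add: emeasure_distr[OF fwd B] D vimage_def)
qed

lemma joint_law: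
  "distr M (borel \<Otimes>\<^sub>M future) (\<lambda>\<sigma>. (F \<sigma>, forward \<sigma>)) =
   M \<bind> (\<lambda>\<sigma>. distr (path_measure S (F \<sigma>)) (borel \<Otimes>\<^sub>M future) (\<lambda>\<tau>. (F \<sigma>, \<tau>)))" (is "?L = ?R")
  and measurable_joint_kernel:
  "(\<lambda>\<sigma>. distr (path_measure S (F \<sigma>)) (borel \<Otimes>\<^sub>M future) (\<lambda>\<tau>. (F \<sigma>, \<tau>))) \<in> M \<rightarrow>\<^sub>M subprob_algebra (borel \<Otimes>\<^sub>M future)"
proof -
  show K: "(\<lambda>\<sigma>. distr (path_measure S (F \<sigma>)) (borel \<Otimes>\<^sub>M future) (\<lambda>\<tau>. (F \<sigma>, \<tau>))) \<in> M \<rightarrow>\<^sub>M subprob_algebra (borel \<Otimes>\<^sub>M future)"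
    by (rule measurable_distr2[OF _ measurable_path_F]) measurable
  have fm: "(\<lambda>\<sigma>. (F \<sigma>, forward \<sigma>)) \<in> M \<rightarrow>\<^sub>M borel \<Otimes>\<^sub>M future" by measurable
  have ne: "space M \<noteq> {}" by simp
  let ?E = "{a \<times> b |a b. a \<in> sets (borel :: 'k measure) \<and> b \<in> sets (future :: (nat \<Rightarrow> 'e option) measure)}"
  show "?L = ?R"
  proof (rule measure_eqI_generator_eq[where E="?E" and \<Omega>="space (borel \<Otimes>\<^sub>M future)" and A="\<lambda>_. space (borel :: 'k measure) \<times> space (future :: (nat \<Rightarrow> 'e option) measure)"])
    show "Int_stable ?E" by (rule Int_stable_pair_measure_generator)
    show "?E \<subseteq> Pow (space (borel \<Otimes>\<^sub>M future))" unfolding space_pair_measure by (rule pair_measure_closed)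
    show "sets ?L = sigma_sets (space (borel \<Otimes>\<^sub>M future)) ?E" by (simp add: sets_pair_measure space_pair_measure)
    have "sets ?R = sets (borel \<Otimes>\<^sub>M future)" by (rule sets_bind[OF _ ne]) simp
    then show "sets ?R = sigma_sets (space (borel \<Otimes>\<^sub>M future)) ?E" by (simp add: sets_pair_measure space_pair_measure)
    show "range (\<lambda>_. space borel \<times> space future) \<subseteq> ?E" by (auto intro!: exI[of _ UNIV] exI[of _ "space future"])
    show "(\<Union>i. space borel \<times> space future) = space (borel \<Otimes>\<^sub>M future)" by (simp add: space_pair_measure)
    show "emeasure ?L (space borel \<times> space future) \<noteq> \<infinity>"
      using finite_measure.emeasure_finite[OF finite_measure_distr[OF fm]] by simp
    fix X assume "X \<in> ?E"
    then obtain B C where X: "X = B \<times> C" and B[measurable]: "B \<in> sets borel" and C[measurable]: "C \<in> sets future" by blast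
    have XP: "X \<in> sets (borel \<Otimes>\<^sub>M future)" unfolding X by measurable
    \<comment> \<open>The condition on \<open>F\<close> must be read through \<open>F0\<close> to
      become an event of the past.\<close>
    let ?A = "{\<sigma>. F0 \<sigma> \<in> B}"
    have A: "?A \<in> sets past" using measurable_sets[OF measurable_F0 B] by (simp add: vimage_def)
    have "emeasure ?L X = emeasure M {\<sigma>. F \<sigma> \<in> B \<and> forward \<sigma> \<in> C}"
      unfolding emeasure_distr[OF fm XP] by (simp add: X vimage_def)
    also have "\<dots> = emeasure M (?A \<inter> {\<sigma>. forward \<sigma> \<in> C})"
    proof (rule emeasure_eq_AE)
      show "AE \<sigma> in M. \<sigma> \<in> {\<sigma>. F \<sigma> \<in> B \<and> forward \<sigma> \<in> C} \<longleftrightarrow> \<sigma> \<in> ?A \<inter> {\<sigma>. forward \<sigma> \<in> C}"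
        using AE_F_eq_F0 by eventually_elim auto
      have "{\<sigma> \<in> space codes. F \<sigma> \<in> B \<and> forward \<sigma> \<in> C} \<in> sets codes" by measurable
      then show "{\<sigma>. F \<sigma> \<in> B \<and> forward \<sigma> \<in> C} \<in> events" by simp
      have "{\<sigma> \<in> space codes. F0 \<sigma> \<in> B \<and> forward \<sigma> \<in> C} \<in> sets codes" by measurable
      then show "?A \<inter> {\<sigma>. forward \<sigma> \<in> C} \<in> events" by (simp add: Collect_conj_eq)
    qed
    also have "\<dots> = (\<integral>\<^sup>+\<sigma>\<in>?A. emeasure (path_measure S (F \<sigma>)) C \<partial>M)" by (rule emeasure_past_forward[OF A C])
    also have "\<dots> = (\<integral>\<^sup>+\<sigma>. emeasure (distr (path_measure S (F \<sigma>)) (borel \<Otimes>\<^sub>M future) (\<lambda>\<tau>. (F \<sigma>, \<tau>))) X \<partial>M)"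
    proof (rule nn_integral_cong_AE)
      show "AE \<sigma> in M. emeasure (path_measure S (F \<sigma>)) C * indicator ?A \<sigma> =
        emeasure (distr (path_measure S (F \<sigma>)) (borel \<Otimes>\<^sub>M future) (\<lambda>\<tau>. (F \<sigma>, \<tau>))) X"
        using AE_F_eq_F0
      proof eventually_elim
        case (elim \<sigma>)
        have "(\<lambda>\<tau>. (F \<sigma>, \<tau>)) \<in> path_measure S (F \<sigma>) \<rightarrow>\<^sub>M borel \<Otimes>\<^sub>M future" by measurable
        then have "emeasure (distr (path_measure S (F \<sigma>)) (borel \<Otimes>\<^sub>M future) (\<lambda>\<tau>. (F \<sigma>, \<tau>))) X
          = emeasure (path_measure S (F \<sigma>)) ((\<lambda>\<tau>. (F \<sigma>, \<tau>)) -` X \<inter> space (path_measure S (F \<sigma>)))"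
          by (rule emeasure_distr[OF _ XP])
        also have "(\<lambda>\<tau>. (F \<sigma>, \<tau>)) -` X \<inter> space (path_measure S (F \<sigma>)) = (if F0 \<sigma> \<in> B then C else {})"
          using sets.sets_into_space[OF C] elim by (auto simp: X space_path_measure space_PiM)
        finally show ?case by (auto split: split_indicator)
      qed
    qed
    also have "\<dots> = emeasure ?R X" by (rule emeasure_bind[OF ne K XP, symmetric])
    finally show "emeasure ?L X = emeasure ?R X" .
  qed
qed

text \<open>Lets an almost sure statement about the coded point and its future be read as one about
  almost every path from almost every coded point.\<close>

lemma AE_joint:
  assumes Q: "Measurable.pred (borel \<Otimes>\<^sub>M future) Q"
  shows "(AE \<sigma> in M. Q (F \<sigma>, forward \<sigma>)) \<longleftrightarrow> (AE \<sigma> in M. AE \<tau> in path_measure S (F \<sigma>). Q (F \<sigma>, \<tau>))"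
proof -
  have fm: "(\<lambda>\<sigma>. (F \<sigma>, forward \<sigma>)) \<in> M \<rightarrow>\<^sub>M borel \<Otimes>\<^sub>M future" by measurable
  have Qs: "{x \<in> space (borel \<Otimes>\<^sub>M future). Q x} \<in> sets (borel \<Otimes>\<^sub>M future)" using Q by (simp add: Measurable.pred_def)
  have "(AE \<sigma> in M. Q (F \<sigma>, forward \<sigma>)) \<longleftrightarrow> (AE p in distr M (borel \<Otimes>\<^sub>M future) (\<lambda>\<sigma>. (F \<sigma>, forward \<sigma>)). Q p)"
    by (rule AE_distr_iff[OF fm Qs, symmetric])
  also have "\<dots> \<longleftrightarrow> (AE \<sigma> in M. AE p in distr (path_measure S (F \<sigma>)) (borel \<Otimes>\<^sub>M future) (\<lambda>\<tau>. (F \<sigma>, \<tau>)). Q p)"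
    unfolding joint_law by (rule AE_bind[OF measurable_joint_kernel Q])
  also have "\<dots> \<longleftrightarrow> (AE \<sigma> in M. AE \<tau> in path_measure S (F \<sigma>). Q (F \<sigma>, \<tau>))"
    by (intro AE_cong AE_distr_iff[OF _ Qs]) measurable
  finally show ?thesis .
qed

section \<open>The image measure under the coding map\<close>

lemma sets_coded[simp]: "sets (coded S b z M) = sets borel" by (simp add: coded_def)

lemma emeasure_coded: "B \<in> sets borel \<Longrightarrow> emeasure (coded S b z M) B = emeasure M (F -` B)"
  unfolding coded_def by (subst emeasure_distr) (auto cong: measurable_cong_sets)

lemma nn_integral_coded: "g \<in> borel_measurable borel \<Longrightarrow> (\<integral>\<^sup>+x. g x \<partial>coded S b z M) = (\<integral>\<^sup>+\<sigma>. g (F \<sigma>) \<partial>M)"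
  unfolding coded_def by (rule nn_integral_distr) (auto cong: measurable_cong_sets)

text \<open>The Markov operator evaluated at \<open>F \<sigma>\<close> is the conditional
  expectation of the same function at \<open>F (shift \<sigma>)\<close>, and the shift preserves
  M.\<close>

lemma coded_invariant: "coded S b z M \<in> invariant_measures S"
  unfolding invariant_measures_def
proof (intro CollectI conjI)
  show "sets (coded S b z M) = sets borel" by simp
  show "prob_space (coded S b z M)" unfolding coded_def by (rule prob_space_distr) (simp cong: measurable_cong_sets)
  show "adj_op S (coded S b z M) = coded S b z M"
  proof (rule measure_eqI)
    fix B assume "B \<in> sets (adj_op S (coded S b z M))"
    then have B[measurable]: "B \<in> sets borel" by simp
    have "emeasure (adj_op S (coded S b z M)) B = (\<integral>\<^sup>+\<sigma>. markov_op S (indicator B) (F \<sigma>) \<partial>M)"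
      by (simp add: emeasure_adj_op nn_integral_coded)
    also have "\<dots> = (\<integral>\<^sup>+e. (\<integral>\<^sup>+\<sigma>. ennreal (wgt S e (F \<sigma>)) * indicator B (wmap S e (F \<sigma>)) \<partial>M) \<partial>count_space UNIV)"
      unfolding markov_op_eq by (rule nn_integral_count_space_nn_integral) auto
    also have "\<dots> = (\<integral>\<^sup>+e. (\<integral>\<^sup>+\<sigma>. indicator {\<sigma>. \<sigma> 1 = Some e} \<sigma> * indicator B (wmap S e (F \<sigma>)) \<partial>M) \<partial>count_space UNIV)"
    proof (rule nn_integral_cong)
      fix e
      have "(\<integral>\<^sup>+\<sigma>. ennreal (wgt S e (F \<sigma>)) * indicator B (wmap S e (F \<sigma>)) \<partial>M) = (\<integral>\<^sup>+\<sigma>. ennreal (wgt S e (F \<sigma>)) * indicator B (wmap S e (F0 \<sigma>)) \<partial>M)"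
        using AE_F_eq_F0 by (intro nn_integral_cong_AE) (auto elim!: eventually_mono)
      also have "\<dots> = (\<integral>\<^sup>+\<sigma>. indicator {\<sigma>. \<sigma> 1 = Some e} \<sigma> * indicator B (wmap S e (F0 \<sigma>)) \<partial>M)"
        by (rule nn_integral_cond[symmetric]) measurable
      also have "\<dots> = (\<integral>\<^sup>+\<sigma>. indicator {\<sigma>. \<sigma> 1 = Some e} \<sigma> * indicator B (wmap S e (F \<sigma>)) \<partial>M)"
        using AE_F_eq_F0 by (intro nn_integral_cong_AE) (auto elim!: eventually_mono)
      finally show "(\<integral>\<^sup>+\<sigma>. ennreal (wgt S e (F \<sigma>)) * indicator B (wmap S e (F \<sigma>)) \<partial>M) = \<dots>" .
    qed
    also have "\<dots> = (\<integral>\<^sup>+\<sigma>. (\<integral>\<^sup>+e. indicator {\<sigma>. \<sigma> 1 = Some e} \<sigma> * indicator B (wmap S e (F \<sigma>)) \<partial>count_space UNIV) \<partial>M)"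
      by (rule nn_integral_count_space_nn_integral[symmetric]) auto
    also have "\<dots> = (\<integral>\<^sup>+\<sigma>. indicator B (F (shift \<sigma>)) \<partial>M)"
    proof (rule nn_integral_cong_AE)
      show "AE \<sigma> in M. (\<integral>\<^sup>+e. indicator {\<sigma>. \<sigma> 1 = Some e} \<sigma> * indicator B (wmap S e (F \<sigma>)) \<partial>count_space UNIV) = indicator B (F (shift \<sigma>))"
        using AE_step
      proof eventually_elim
        case (elim \<sigma>)
        then obtain e where e: "\<sigma> 1 = Some e" "F (shift \<sigma>) = wmap S e (F \<sigma>)" by blast
        have "(\<integral>\<^sup>+e'. indicator {\<sigma>. \<sigma> 1 = Some e'} \<sigma> * indicator B (wmap S e' (F \<sigma>)) \<partial>count_space UNIV)
          = (\<integral>\<^sup>+e'. indicator B (F (shift \<sigma>)) * indicator {e} e' \<partial>count_space UNIV)"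
          using e by (intro nn_integral_cong) (auto split: split_indicator)
        also have "\<dots> = indicator B (F (shift \<sigma>))" by (subst nn_integral_cmult_indicator) auto
        finally show ?case .
      qed
    qed
    also have "\<dots> = (\<integral>\<^sup>+\<sigma>. indicator B (F \<sigma>) \<partial>M)" by (rule nn_integral_shift) measurable
    also have "\<dots> = emeasure (coded S b z M) B"
      using nn_integral_coded[of "indicator B"] by simp
    finally show "emeasure (adj_op S (coded S b z M)) B = emeasure (coded S b z M) B" .
  qed simp
qed

end

subsection \<open>Communication classes\<close>

lemma depends_on_in_codes:
  fixes B :: "(int \<Rightarrow> 'e::countable option) set"
  shows "finite A \<Longrightarrow> depends_on A B \<Longrightarrow> B \<in> sets codes"
  using depends_on_in_sets[of A UNIV B] by simp

definition edges :: "('k, 'e, 'n) markov \<Rightarrow> ('n \<times> 'n) set" where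
  "edges S = {(src S e, tgt S e) | e. True}"

lemma path_edges: "es \<noteq> [] \<Longrightarrow> is_path S es \<Longrightarrow> (src S (hd es), tgt S (last es)) \<in> (edges S)\<^sup>*"
proof (induction es rule: list_nonempty_induct)
  case (single e)
  then show ?case by (auto simp: edges_def)
next
  case (cons e es)
  have link: "src S ((e # es) ! Suc m) = tgt S ((e # es) ! m)" if "Suc m < length (e # es)" for m
    using cons.prems that unfolding is_path_def by blast
  have "is_path S es" unfolding is_path_def
  proof (intro conjI allI impI)
    fix m assume "Suc m < length es" then show "src S (es ! Suc m) = tgt S (es ! m)" using link[of "Suc m"] by simp
  qed (rule cons.hyps)
  then have "(src S (hd es), tgt S (last es)) \<in> (edges S)\<^sup>*" by (rule cons.IH)
  moreover have "src S (hd es) = tgt S e" using link[of 0] cons.hyps by (simp add: hd_conv_nth)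
  moreover have "(src S e, tgt S e) \<in> edges S" by (auto simp: edges_def)
  ultimately show ?case using cons.hyps by (auto intro: converse_rtrancl_into_rtrancl)
qed

text \<open>The reflexive transitive closure supplies transitivity and an induction along single
  edges.\<close>

lemma accessible_iff: "accessible S i j \<longleftrightarrow> (i, j) \<in> (edges S)\<^sup>*"
proof
  assume "accessible S i j"
  then show "(i, j) \<in> (edges S)\<^sup>*"
    unfolding accessible_def path_of_length_def using path_edges[of _ S] by (auto simp: is_path_def)
next
  assume "(i, j) \<in> (edges S)\<^sup>*"
  then show "accessible S i j"
  proof (induction rule: rtrancl_induct)
    case base then show ?case by (simp add: accessible_def)
  next
    case (step j k)
    then obtain e where e: "src S e = j" "tgt S e = k" by (auto simp: edges_def)
    show ?case
    proof (cases "i = j")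
      case True
      then have "path_of_length S 1 i k" unfolding path_of_length_def is_path_def using e by (intro exI[of _ "[e]"]) simp
      then show ?thesis unfolding accessible_def by blast
    next
      case False
      then obtain es where es: "is_path S es" "src S (hd es) = i" "tgt S (last es) = j"
        using step.IH unfolding accessible_def path_of_length_def by blast
      have ne: "es \<noteq> []" using es(1) by (simp add: is_path_def)
      have "is_path S (es @ [e])" unfolding is_path_def
      proof (intro conjI allI impI)
        fix m assume m: "Suc m < length (es @ [e])"
        show "src S ((es @ [e]) ! Suc m) = tgt S ((es @ [e]) ! m)"
        proof (cases "Suc m < length es")
          case True
          then show ?thesis using es(1) by (simp add: nth_append is_path_def)
        next
          case False
          then have len: "length es = Suc m" using m by simp
          moreover have "es ! m = last es" unfolding last_conv_nth[OF ne] len by simp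
          ultimately show ?thesis using es(3) e by (simp add: nth_append)
        qed
      qed simp
      then have "path_of_length S (length (es @ [e])) i k"
        unfolding path_of_length_def using ne es e by (intro exI[of _ "es @ [e]"]) simp
      then show ?thesis unfolding accessible_def by blast
    qed
  qed
qed

lemma accessible_refl: "accessible S i i" and
  accessible_trans: "accessible S i j \<Longrightarrow> accessible S j k \<Longrightarrow> accessible S i k" and
  accessible_edge: "accessible S (src S e) (tgt S e)"
  unfolding accessible_iff by (auto simp: edges_def intro: rtrancl_trans)

lemma accessible_propagate:
  assumes "accessible S i j" "P i" "\<And>e. P (src S e) \<Longrightarrow> P (tgt S e)"
  shows "P j"
  using assms(1) unfolding accessible_iff
  by (induction rule: rtrancl_induct) (use assms(2,3) in \<open>auto simp: edges_def\<close>)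

lemma comm_class_eq:
  assumes c: "c \<in> comm_classes S" and j: "j \<in> c"
  shows "c = {k \<in> essential S. communicate S j k}" "j \<in> essential S"
proof -
  obtain i where i: "i \<in> essential S" "c = {k \<in> essential S. communicate S i k}"
    using c unfolding comm_classes_def quotient_def by auto
  have ij: "communicate S i j" and "j \<in> essential S" using j i by auto
  then show "j \<in> essential S" "c = {k \<in> essential S. communicate S j k}"
    unfolding i(2) communicate_def by (auto intro: accessible_trans)
qed

lemma comm_class_ex:
  assumes "j \<in> essential S"
  shows "\<exists>c\<in>comm_classes S. j \<in> c"
proof -
  let ?r = "{(i, j). i \<in> essential S \<and> j \<in> essential S \<and> communicate S i j}"
  have "?r `` {j} \<in> comm_classes S" unfolding comm_classes_def using assms by (rule quotientI)
  moreover have "j \<in> ?r `` {j}" using assms by (simp add: communicate_def accessible_refl)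
  ultimately show ?thesis by (intro bexI[of _ "?r `` {j}"])
qed

lemma comm_class_unique: "c \<in> comm_classes S \<Longrightarrow> c' \<in> comm_classes S \<Longrightarrow> j \<in> c \<Longrightarrow> j \<in> c' \<Longrightarrow> c = c'"
  by (rule trans[OF comm_class_eq(1) comm_class_eq(1)[symmetric]])

lemma comm_class_accessible: "c \<in> comm_classes S \<Longrightarrow> j \<in> c \<Longrightarrow> k \<in> c \<Longrightarrow> accessible S j k"
  using comm_class_eq(1)[of c S j] by (auto simp: communicate_def)

lemma comm_class_closed:
  assumes c: "c \<in> comm_classes S" and j: "j \<in> c" and k: "accessible S j k"
  shows "k \<in> c"
proof -
  have j': "j \<in> essential S" using comm_class_eq(2)[OF c j] .
  then have jk: "communicate S j k" using k unfolding essential_def by blast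
  have "k \<in> essential S" unfolding essential_def
  proof safe
    fix m assume "accessible S k m"
    then have "accessible S j m" using k accessible_trans by metis
    then have "communicate S j m" using j' unfolding essential_def by blast
    then show "communicate S k m" using jk \<open>accessible S k m\<close> unfolding communicate_def using accessible_trans by metis
  qed
  then show ?thesis using jk comm_class_eq(1)[OF c j] by blast
qed

lemma class_cell_unique:
  assumes S: "markov_system S" and c: "c \<in> comm_classes S" "c' \<in> comm_classes S"
    and x: "x \<in> class_cell S c" "x \<in> class_cell S c'"
  shows "c = c'"
proof -
  interpret msys S by (rule msys.intro[OF S])
  from x obtain j j' where "j \<in> c" "x \<in> cell S j" "j' \<in> c'" "x \<in> cell S j'" by (auto simp: class_cell_def)
  then show ?thesis using cell_unique[of x j j'] comm_class_unique[OF c] by blast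
qed

subsection \<open>Invariant sets\<close>

context msys
begin

text \<open>Positivity of the system: the cylinder of the single letter e is charged from some point
  of the source cell, hence by absolute continuity from every point of it.\<close>

lemma wgt_pos:
  assumes ac: "absolutely_continuous_system S" and y: "y \<in> cell S (src S e)"
  shows "0 < wgt S e y"
proof -
  obtain x where x: "0 < wgt S e x" using wgt_pos_ex by blast
  let ?c = "cylinder {1..} {1..1} (\<lambda>_. Some e) :: (nat \<Rightarrow> 'e option) set"
  have em: "emeasure (path_measure S y) ?c = ennreal (wgt S e y)" for y
    unfolding emeasure_path_cylinder by (simp add: cyl_prob_def)
  have c: "?c \<in> sets (path_measure S y)" for y
    unfolding sets_path_measure by (rule cylinder_in_sets) auto
  have "wgt S e y \<noteq> 0"
  proof
    assume "wgt S e y = 0"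
    then have "?c \<in> null_sets (path_measure S y)"
      using em[of y] by (intro null_setsI[OF _ c]) (simp only: ennreal_0)
    then have "?c \<in> null_sets (path_measure S x)"
      using ac wgt_pos_cell[OF x] y unfolding absolutely_continuous_system_def absolutely_continuous_def by blast
    then show False using em[of x] x by (simp add: null_sets_def)
  qed
  then show ?thesis using wgt_nonneg[of e y] by linarith
qed

lemma sets_class_cell[measurable]: "class_cell S c \<in> sets borel"
  unfolding class_cell_def
  using countable_subset[OF subset_UNIV countable_vertices] by (intro sets.countable_UN') auto

end

text \<open>Approximation with errors 2^(-m) and the Borel-Cantelli lemma: almost every point is
  eventually classified correctly, so the limit superior of the approximating sets agrees with
  \<open>Q\<close>.\<close>

lemma (in prob_space) AE_limsup_of_approx:
  assumes N: "space N = space M" "sets N \<subseteq> sets M" and Q: "Q \<in> sets M"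
    and approx: "\<And>\<epsilon>. 0 < \<epsilon> \<Longrightarrow> \<exists>B\<in>sets N. measure M (sym_diff Q B) < \<epsilon>"
  shows "\<exists>B\<in>sets N. AE x in M. x \<in> Q \<longleftrightarrow> x \<in> B"
proof -
  have "\<exists>B\<in>sets N. measure M (sym_diff Q B) < (1/2) ^ m" for m :: nat by (rule approx) simp
  then obtain B where B: "\<And>m. B m \<in> sets N" "\<And>m. measure M (sym_diff Q (B m)) < (1/2) ^ m" by metis
  have BM: "B m \<in> sets M" for m using B(1) N(2) by blast
  let ?L = "\<Inter>k. \<Union>m\<in>{k..}. B m"
  have "AE x in M. \<forall>\<^sub>F m in sequentially. x \<in> space M - sym_diff Q (B m)"
  proof (rule borel_cantelli_AE1)
    show "summable (\<lambda>m. measure M (sym_diff Q (B m)))"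
      by (rule summable_comparison_test'[of "\<lambda>m. (1/2) ^ m" 0]) (auto intro: summable_geometric less_imp_le[OF B(2)])
  qed (use BM Q in \<open>auto simp: emeasure_eq_measure\<close>)
  then have "AE x in M. x \<in> Q \<longleftrightarrow> x \<in> ?L"
  proof eventually_elim
    case (elim x)
    then obtain k where k: "\<And>m. k \<le> m \<Longrightarrow> x \<in> Q \<longleftrightarrow> x \<in> B m" unfolding eventually_sequentially by blast
    show ?case
    proof
      assume "x \<in> Q"
      show "x \<in> ?L"
      proof
        fix l have "x \<in> B (max k l)" using k[of "max k l"] \<open>x \<in> Q\<close> by simp
        then show "x \<in> (\<Union>m\<in>{l..}. B m)" by (intro UN_I[of "max k l"]) auto
      qed
    next
      assume "x \<in> ?L"
      then obtain m where "k \<le> m" "x \<in> B m" by auto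
      then show "x \<in> Q" using k by blast
    qed
  qed
  moreover have "?L \<in> sets N" by (rule sets.countable_INT) (use B(1) in auto)
  ultimately show ?thesis by blast
qed

lemma code_windows:
  "finite {- int k..int k}" "incseq (\<lambda>k. {- int k..int k})" "(\<Union>k. {- int k..int k}) = UNIV"
proof -
  show "(\<Union>k. {- int k..int k}) = UNIV"
  proof (intro equalityI subsetI)
    fix i :: int have "i \<in> {- int (nat \<bar>i\<bar>)..int (nat \<bar>i\<bar>)}" by (cases "0 \<le> i") auto
    then show "i \<in> (\<Union>k. {- int k..int k})" by blast
  qed simp
qed (auto simp: incseq_def)

text \<open>The approximable sets contain the cylinders and are closed under complements and
  countable unions; for a union, finitely many members are approximated and the rest is a small
  tail.\<close>

lemma window_approximation:
  fixes M :: "(int \<Rightarrow> 'e::countable option) measure"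
  assumes M: "prob_space M" and sM: "sets M = sets codes" and Q: "Q \<in> sets codes" and \<epsilon>: "0 < \<epsilon>"
  shows "\<exists>n::nat. \<exists>B. depends_on {- int n..int n} B \<and> measure M (sym_diff Q B) < \<epsilon>"
proof -
  interpret prob_space M by (rule M)
  note A = code_windows
  let ?E = "insert {} {cylinder UNIV {- int k..int k} e | k e. True} :: (int \<Rightarrow> 'e option) set set"
  have gen: "sets (codes :: (int \<Rightarrow> 'e option) measure) = sigma_sets UNIV ?E"
    using code_generator_sets[OF A] by simp
  have "Q \<in> sigma_sets UNIV ?E" using Q gen by simp
  then show ?thesis using \<epsilon>
  proof (induction arbitrary: \<epsilon> rule: sigma_sets.induct)
    case (Basic a)
    then consider "a = {}" | k e where "a = cylinder UNIV {- int k..int k} e" by blast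
    then show ?case
    proof cases
      case 1 then show ?thesis using Basic by (intro exI[of _ 0] exI[of _ "{}"]) (auto simp: depends_on_def)
    next
      case 2 then show ?thesis using Basic by (intro exI[of _ k] exI[of _ a]) (auto simp: depends_on_def cylinder_eq)
    qed
  next
    case Empty then show ?case by (intro exI[of _ 0] exI[of _ "{}"]) (auto simp: depends_on_def)
  next
    case (Compl a)
    then obtain n B where B: "depends_on {- int n..int n} B" "measure M (sym_diff a B) < \<epsilon>" by blast
    have "sym_diff (UNIV - a) (- B) = sym_diff a B" by auto
    then show ?case using B by (intro exI[of _ n] exI[of _ "- B"]) (auto simp: depends_on_def)
  next
    case (Union a)
    have am: "a i \<in> sets M" for i using Union.hyps gen sM by simp
    have "(\<lambda>N. measure M (\<Union>i<N. a i)) \<longlonglongrightarrow> measure M (\<Union>N. \<Union>i<N. a i)"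
      by (rule finite_Lim_measure_incseq) (use am in \<open>auto simp: incseq_def intro: less_le_trans\<close>)
    moreover have "(\<Union>N. \<Union>i<N. a i) = (\<Union>i. a i)" by auto
    ultimately have "(\<lambda>N. measure M (\<Union>i<N. a i)) \<longlonglongrightarrow> measure M (\<Union>i. a i)" by simp
    then have "\<forall>\<^sub>F N in sequentially. dist (measure M (\<Union>i<N. a i)) (measure M (\<Union>i. a i)) < \<epsilon> / 2"
      using Union.prems by (intro tendstoD) auto
    then obtain N where N: "dist (measure M (\<Union>i<N. a i)) (measure M (\<Union>i. a i)) < \<epsilon> / 2"
      by (auto simp: eventually_sequentially)
    have sub: "(\<Union>i<N. a i) \<subseteq> (\<Union>i. a i)" by auto
    have Um: "(\<Union>i<N. a i) \<in> sets M" "(\<Union>i. a i) \<in> sets M" using am by auto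
    have tail: "measure M ((\<Union>i. a i) - (\<Union>i<N. a i)) < \<epsilon> / 2"
      using N finite_measure_Diff[OF Um(2,1) sub] unfolding dist_real_def by linarith
    \<comment> \<open>Half of \<epsilon> is spent on the tail, the other half is shared by the N
      retained sets; \<open>Suc N\<close> avoids division by zero.\<close>
    have "\<exists>n B. depends_on {- int n..int n} B \<and> measure M (sym_diff (a i) B) < \<epsilon> / (2 * real (Suc N))" for i
      using Union.IH[of "\<epsilon> / (2 * real (Suc N))" i] Union.prems by simp
    then obtain n B where B: "\<And>i. depends_on {- int (n i)..int (n i)} (B i)"
      "\<And>i. measure M (sym_diff (a i) (B i)) < \<epsilon> / (2 * real (Suc N))" by metis
    define m where "m = (\<Sum>i<N. n i)"
    have nm: "n i \<le> m" if "i < N" for i unfolding m_def using that by (intro member_le_sum) auto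
    have Bd: "depends_on {- int m..int m} (B i)" if "i < N" for i
      by (rule depends_on_mono[OF B(1)]) (use nm[OF that] in auto)
    have BM: "B i \<in> sets M" for i using depends_on_in_codes[OF _ B(1)] sM by auto
    have "depends_on {- int m..int m} (\<Union>i<N. B i)" using Bd unfolding depends_on_def by blast
    moreover have "measure M (sym_diff (\<Union>i. a i) (\<Union>i<N. B i)) < \<epsilon>"
    proof -
      have "measure M (sym_diff (\<Union>i. a i) (\<Union>i<N. B i)) \<le> measure M (((\<Union>i. a i) - (\<Union>i<N. a i)) \<union> (\<Union>i<N. sym_diff (a i) (B i)))"
        by (rule finite_measure_mono) (use am BM in auto)
      also have "\<dots> \<le> measure M ((\<Union>i. a i) - (\<Union>i<N. a i)) + measure M (\<Union>i<N. sym_diff (a i) (B i))"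
        by (rule measure_Un_le) (use am BM in auto)
      also have "measure M (\<Union>i<N. sym_diff (a i) (B i)) \<le> (\<Sum>i<N. measure M (sym_diff (a i) (B i)))"
        by (rule finite_measure_subadditive_finite) (use am BM in auto)
      also have "\<dots> \<le> (\<Sum>i<N. \<epsilon> / (2 * real (Suc N)))" by (intro sum_mono less_imp_le B)
      also have "\<dots> \<le> \<epsilon> / 2" using Union.prems by (simp add: field_simps)
      finally show ?thesis using tail by simp
    qed
    ultimately show ?case by blast
  qed
qed

context equilibrium
begin

lemma AE_shift:
  assumes "AE \<sigma> in M. P \<sigma>" shows "AE \<sigma> in M. P (shift \<sigma>)"
proof -
  have "shift \<in> M \<rightarrow>\<^sub>M M" by (simp cong: measurable_cong_sets)
  moreover have "AE \<sigma> in distr M M shift. P \<sigma>" using assms by (simp only: distr_shift)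
  ultimately show ?thesis by (rule AE_distrD)
qed

lemma AE_shift_pow: "AE \<sigma> in M. P \<sigma> \<Longrightarrow> AE \<sigma> in M. P ((shift ^^ n) \<sigma>)"
proof (induction n)
  case (Suc n)
  from AE_shift[OF Suc.IH[OF Suc.prems]] show ?case
    by (simp only: funpow.simps comp_apply funpow_swap1)
qed simp

lemma emeasure_shift_pow: "A \<in> sets codes \<Longrightarrow> emeasure M ((shift ^^ n) -` A) = emeasure M A"
proof (induction n arbitrary: A)
  case (Suc n)
  have "(shift ^^ Suc n) -` A = (shift ^^ n) -` (shift -` A)" by (simp only: funpow.simps vimage_comp)
  moreover have "shift -` A \<in> sets codes" using measurable_sets[OF measurable_shift Suc.prems] by simp
  ultimately have "emeasure M ((shift ^^ Suc n) -` A) = emeasure M (shift -` A)" using Suc.IH by (simp only:)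
  then show ?case using emeasure_shift[OF Suc.prems] by (simp only:)
qed simp

lemma invariant_setsD:
  assumes "Q \<in> invariant_sets M"
  shows "Q \<in> sets codes" "AE \<sigma> in M. shift \<sigma> \<in> Q \<longleftrightarrow> \<sigma> \<in> Q"
proof -
  show Q: "Q \<in> sets codes" using assms unfolding invariant_sets_def sets_code_borel_UNIV by blast
  have "shift -` Q \<in> sets codes" using measurable_sets[OF measurable_shift Q] by simp
  then have "sym_diff (shift -` Q) Q \<in> null_sets M"
    using assms Q unfolding invariant_sets_def by (auto simp: null_sets_def)
  then have "AE \<sigma> in M. \<sigma> \<notin> sym_diff (shift -` Q) Q" by (rule AE_not_in)
  then show "AE \<sigma> in M. shift \<sigma> \<in> Q \<longleftrightarrow> \<sigma> \<in> Q" by eventually_elim auto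
qed

lemma invariant_setsI:
  assumes Q: "Q \<in> sets codes" and ae: "AE \<sigma> in M. shift \<sigma> \<in> Q \<longleftrightarrow> \<sigma> \<in> Q"
  shows "Q \<in> invariant_sets M"
proof -
  have s: "shift -` Q \<in> sets codes" using measurable_sets[OF measurable_shift Q] by simp
  have "AE \<sigma> in M. \<sigma> \<notin> sym_diff (shift -` Q) Q" using ae by eventually_elim auto
  then have "emeasure M (sym_diff (shift -` Q) Q) = 0"
    using Q s by (subst AE_iff_measurable[symmetric, where P="\<lambda>\<sigma>. \<sigma> \<notin> sym_diff (shift -` Q) Q"]) auto
  then show ?thesis using Q unfolding invariant_sets_def sets_code_borel_UNIV by blast
qed

lemma invariant_pow:
  assumes "Q \<in> invariant_sets M"
  shows "AE \<sigma> in M. (shift ^^ n) \<sigma> \<in> Q \<longleftrightarrow> \<sigma> \<in> Q"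
proof (induction n)
  case (Suc n)
  have "AE \<sigma> in M. shift ((shift ^^ n) \<sigma>) \<in> Q \<longleftrightarrow> (shift ^^ n) \<sigma> \<in> Q"
    by (rule AE_shift_pow[OF invariant_setsD(2)[OF assms]])
  with Suc show ?case by eventually_elim simp
qed simp

text \<open>An invariant set is equally close to all shifts of its approximation. The clause about
  \<open>B'\<close> expresses shifts in the other direction by preimages, without an inverse of
  \<open>shift\<close>.\<close>

lemma invariant_window:
  assumes Q: "Q \<in> invariant_sets M" and \<epsilon>: "0 < \<epsilon>"
  shows "\<exists>n::nat. \<exists>B. depends_on {- int n..int n} B \<and> B \<in> sets codes \<and>
    (\<forall>k. measure M (sym_diff Q ((shift ^^ k) -` B)) < \<epsilon>) \<and>
    (\<forall>k B'. B' \<in> sets codes \<longrightarrow> (shift ^^ k) -` B' = B \<longrightarrow> measure M (sym_diff Q B') < \<epsilon>)"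
proof -
  note Qc = invariant_setsD(1)[OF Q]
  obtain n B where B: "depends_on {- int n..int n} B" "measure M (sym_diff Q B) < \<epsilon>"
    using window_approximation[OF prob_space_M sets_M Qc \<epsilon>] by blast
  have Bc: "B \<in> sets codes" by (rule depends_on_in_codes[OF _ B(1)]) simp
  have pm: "(shift ^^ k) -` A \<in> sets codes" if A: "A \<in> sets codes" for A k
  proof -
    have "(shift ^^ k) \<in> codes \<rightarrow>\<^sub>M codes" by (induction k) (auto intro: measurable_comp[OF _ measurable_shift])
    from measurable_sets[OF this A] show ?thesis by simp
  qed
  have eq: "measure M (sym_diff Q ((shift ^^ k) -` B'')) = measure M (sym_diff Q B'')" if B'': "B'' \<in> sets codes" for k B''
  proof -
    have "emeasure M (sym_diff Q ((shift ^^ k) -` B'')) = emeasure M ((shift ^^ k) -` (sym_diff Q B''))"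
    proof (rule emeasure_eq_AE)
      show "AE \<sigma> in M. \<sigma> \<in> sym_diff Q ((shift ^^ k) -` B'') \<longleftrightarrow> \<sigma> \<in> (shift ^^ k) -` (sym_diff Q B'')"
        using invariant_pow[OF Q, of k] by eventually_elim auto
      show "sym_diff Q ((shift ^^ k) -` B'') \<in> sets M" using Qc pm[OF B''] by auto
      have "sym_diff Q B'' \<in> sets codes" using Qc B'' by auto
      from pm[OF this] show "(shift ^^ k) -` (sym_diff Q B'') \<in> sets M" by (simp only: sets_M)
    qed
    also have "\<dots> = emeasure M (sym_diff Q B'')" using Qc B'' by (intro emeasure_shift_pow) auto
    finally show ?thesis by (simp add: measure_def)
  qed
  show ?thesis
    using B Bc eq[OF Bc] by (intro exI[of _ n] exI[of _ B] conjI allI impI) (auto, metis eq)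
qed

text \<open>Moving the window -n..n by n places to the left puts it into -2n..0.\<close>

lemma invariant_past:
  assumes Q: "Q \<in> invariant_sets M"
  shows "\<exists>B\<in>sets past. AE \<sigma> in M. \<sigma> \<in> Q \<longleftrightarrow> \<sigma> \<in> B"
proof (rule AE_limsup_of_approx)
  show "space past = space M" by simp
  show "sets past \<subseteq> events" using sets_past_subset by simp
  show "Q \<in> events" using invariant_setsD(1)[OF Q] by simp
  fix \<epsilon> :: real assume "0 < \<epsilon>"
  then obtain n :: nat and B where B: "depends_on {- int n..int n} B"
    and ap: "\<And>k B'. B' \<in> sets codes \<Longrightarrow> (shift ^^ k) -` B' = B \<Longrightarrow> measure M (sym_diff Q B') < \<epsilon>"
    using invariant_window[OF Q] by metis
  let ?B = "{\<sigma>. (\<lambda>i. \<sigma> (i - int n)) \<in> B}"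
  have "depends_on {- 2 * int n..0} ?B" unfolding depends_on_def
  proof (intro allI impI)
    fix \<sigma> \<tau> :: "int \<Rightarrow> 'e option" assume *: "\<forall>i\<in>{- 2 * int n..0}. \<sigma> i = \<tau> i"
    have "\<forall>i\<in>{- int n..int n}. \<sigma> (i - int n) = \<tau> (i - int n)" using * by auto
    then show "\<sigma> \<in> ?B \<longleftrightarrow> \<tau> \<in> ?B" using B unfolding depends_on_def by simp
  qed
  then have Bp: "?B \<in> sets past" by (intro depends_on_in_past[of "{- 2 * int n..0}"]) auto
  have "(shift ^^ n) -` ?B = B" by (auto simp: shift_pow)
  then have "measure M (sym_diff Q ?B) < \<epsilon>" using Bp sets_past_subset by (intro ap) auto
  with Bp show "\<exists>B\<in>sets past. measure M (sym_diff Q B) < \<epsilon>" by blast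
qed

text \<open>Moving the window to the right puts it into the positive indices; the events of the
  future form the \<sigma>-algebra pulled back along \<open>forward\<close>.\<close>

lemma invariant_future:
  assumes Q: "Q \<in> invariant_sets M"
  shows "\<exists>R\<in>sets future. AE \<sigma> in M. \<sigma> \<in> Q \<longleftrightarrow> forward \<sigma> \<in> R"
proof -
  let ?N = "vimage_algebra UNIV forward (future :: (nat \<Rightarrow> 'e option) measure)"
  have fs: "forward \<in> UNIV \<rightarrow> space (future :: (nat \<Rightarrow> 'e option) measure)"
    by (auto simp: forward_def space_PiM)
  have sN: "sets ?N = {forward -` R | R. R \<in> sets future}"
    using sets_vimage_algebra2[OF fs] by simp
  have "\<exists>B\<in>sets ?N. AE \<sigma> in M. \<sigma> \<in> Q \<longleftrightarrow> \<sigma> \<in> B"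
  proof (rule AE_limsup_of_approx)
    show "space ?N = space M" by simp
    show "sets ?N \<subseteq> events" using measurable_sets[OF measurable_forward] by (auto simp: sN)
    show "Q \<in> events" using invariant_setsD(1)[OF Q] by simp
    fix \<epsilon> :: real assume "0 < \<epsilon>"
    then obtain n :: nat and B where B: "depends_on {- int n..int n} B"
      and ap: "\<And>k. measure M (sym_diff Q ((shift ^^ k) -` B)) < \<epsilon>"
      using invariant_window[OF Q] by metis
    \<comment> \<open>One place more than n, because the future starts at index 1: the window
      becomes 1..2n+1.\<close>
    let ?k = "Suc n"
    let ?R = "{\<tau>. (\<lambda>i. \<tau> (nat (i + int ?k))) \<in> B} :: (nat \<Rightarrow> 'e option) set"
    have "depends_on {1..2 * n + 1} ?R" unfolding depends_on_def
    proof (intro allI impI)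
      fix \<sigma> \<tau> :: "nat \<Rightarrow> 'e option" assume *: "\<forall>i\<in>{1..2 * n + 1}. \<sigma> i = \<tau> i"
      have "\<sigma> (nat (i + int ?k)) = \<tau> (nat (i + int ?k))" if "i \<in> {- int n..int n}" for i
        using that by (intro *[rule_format]) auto
      then show "\<sigma> \<in> ?R \<longleftrightarrow> \<tau> \<in> ?R" using B unfolding depends_on_def by simp
    qed
    then have R: "?R \<inter> PiE {1..} (\<lambda>_. UNIV) \<in> sets future" by (intro depends_on_in_sets[of "{1..2 * n + 1}"]) auto
    have "(shift ^^ ?k) -` B = forward -` (?R \<inter> PiE {1..} (\<lambda>_. UNIV))"
    proof (rule set_eqI)
      fix \<sigma> :: "int \<Rightarrow> 'e option"
      have "\<forall>i\<in>{- int n..int n}. (shift ^^ ?k) \<sigma> i = forward \<sigma> (nat (i + int ?k))"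
        unfolding shift_pow by (auto simp: forward_def)
      then have "(shift ^^ ?k) \<sigma> \<in> B \<longleftrightarrow> (\<lambda>i. forward \<sigma> (nat (i + int ?k))) \<in> B"
        by (rule B[unfolded depends_on_def, THEN spec, THEN spec, THEN mp])
      then show "\<sigma> \<in> (shift ^^ ?k) -` B \<longleftrightarrow> \<sigma> \<in> forward -` (?R \<inter> PiE {1..} (\<lambda>_. UNIV))"
        using fs by (auto simp: space_PiM simp del: funpow.simps of_nat_Suc)
    qed
    then have "(shift ^^ ?k) -` B \<in> sets ?N" unfolding sN using R by blast
    then show "\<exists>B\<in>sets ?N. measure M (sym_diff Q B) < \<epsilon>" using ap by blast
  qed
  then obtain R where R: "R \<in> sets future" "AE \<sigma> in M. \<sigma> \<in> Q \<longleftrightarrow> \<sigma> \<in> forward -` R"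
    unfolding sN by blast
  then show ?thesis by (intro bexI[of _ R]) simp_all
qed

end

section \<open>Charged vertices, ergodicity on a class and conditioning\<close>

locale ac_equilibrium = equilibrium S b z M
  for S :: "('k::complete_space, 'e::countable, 'n) markov" and b z M +
  fixes a :: real
  assumes ctr: "contractive S a" and ac: "absolutely_continuous_system S"
begin

definition vpos :: "'n \<Rightarrow> bool" where
  "vpos j \<longleftrightarrow> 0 < emeasure M (F -` cell S j)"

lemma sets_F_vimage: "B \<in> sets borel \<Longrightarrow> F -` B \<in> sets codes"
  using measurable_sets[OF measurable_F, of B] by simp

text \<open>Supplies a code at which almost sure statements can be evaluated; facts about vertices
  are extracted from facts modulo null sets in this way.\<close>

lemma vpos_ex:
  assumes "vpos j" "AE \<sigma> in M. P \<sigma>"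
  shows "\<exists>\<sigma>. F \<sigma> \<in> cell S j \<and> P \<sigma>"
proof (rule ccontr)
  assume no: "\<not> ?thesis"
  have "AE \<sigma> in M. \<sigma> \<notin> F -` cell S j" using assms(2) by eventually_elim (use no in auto)
  then have "emeasure M (F -` cell S j) = 0"
    using sets_F_vimage[OF sets_cell, of j]
    by (subst AE_iff_measurable[symmetric, where P="\<lambda>\<sigma>. \<sigma> \<notin> F -` cell S j"]) auto
  then show False using assms(1) by (simp add: vpos_def)
qed

lemma AE_vpos: "AE \<sigma> in M. \<exists>j. vpos j \<and> F \<sigma> \<in> cell S j"
proof -
  have "AE \<sigma> in M. \<forall>j\<in>{j. \<not> vpos j}. F \<sigma> \<notin> cell S j"
  proof (rule AE_ball_countable[THEN iffD2])
    show "countable {j. \<not> vpos j}" by (rule countable_subset[OF subset_UNIV countable_vertices])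
    show "\<forall>j\<in>{j. \<not> vpos j}. AE \<sigma> in M. F \<sigma> \<notin> cell S j"
    proof
      fix j assume "j \<in> {j. \<not> vpos j}"
      then have "F -` cell S j \<in> null_sets M"
        using sets_F_vimage[OF sets_cell, of j] by (auto simp: vpos_def null_sets_def)
      then show "AE \<sigma> in M. F \<sigma> \<notin> cell S j" by (auto dest: AE_not_in)
    qed
  qed
  then show ?thesis
  proof eventually_elim
    case (elim \<sigma>)
    obtain j where "F \<sigma> \<in> cell S j" using ex_cell by blast
    then show ?case using elim by auto
  qed
qed

text \<open>If almost no code satisfying \<open>P\<close> used the edge, the integral of its weight
  over the source cell would vanish, but the weight is positive on that cell.\<close>

lemma vpos_edge_ex:
  assumes v: "vpos (src S e)" and P: "AE \<sigma> in M. P \<sigma>"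
  shows "\<exists>\<sigma>. F \<sigma> \<in> cell S (src S e) \<and> F (shift \<sigma>) \<in> cell S (tgt S e) \<and> P \<sigma>"
proof (rule ccontr)
  assume no: "\<not> ?thesis"
  let ?A = "{\<sigma>. F0 \<sigma> \<in> cell S (src S e)}"
  have A: "?A \<in> sets past" using measurable_sets[OF measurable_F0 sets_cell, of "src S e"] by (simp add: vimage_def)
  have AM: "?A \<in> sets M" using A sets_past_subset by auto
  have null: "AE \<sigma> in M. \<sigma> \<notin> ?A \<inter> {\<sigma>. \<sigma> 1 = Some e}"
    using P AE_step AE_F_eq_F0
  proof eventually_elim
    case (elim \<sigma>)
    show ?case
    proof
      assume "\<sigma> \<in> ?A \<inter> {\<sigma>. \<sigma> 1 = Some e}"
      then have "F \<sigma> \<in> cell S (src S e)" "\<sigma> 1 = Some e" using elim by auto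
      then have "F (shift \<sigma>) \<in> cell S (tgt S e)" using elim(2) wmap_cell by auto
      with no elim(1) \<open>F \<sigma> \<in> cell S (src S e)\<close> show False by blast
    qed
  qed
  have "emeasure M (?A \<inter> {\<sigma>. \<sigma> 1 = Some e}) = 0"
    using AM null by (subst AE_iff_measurable[symmetric, where P="\<lambda>\<sigma>. \<sigma> \<notin> ?A \<inter> {\<sigma>. \<sigma> 1 = Some e}"]) auto
  then have "(\<integral>\<^sup>+\<sigma>. ennreal (wgt S e (F \<sigma>)) * indicator ?A \<sigma> \<partial>M) = 0" using cond[OF A] by simp
  then have "AE \<sigma> in M. ennreal (wgt S e (F \<sigma>)) * indicator ?A \<sigma> = 0"
    using AM by (subst (asm) nn_integral_0_iff_AE) auto
  then have "AE \<sigma> in M. F \<sigma> \<notin> cell S (src S e)"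
    using AE_F_eq_F0
  proof eventually_elim
    case (elim \<sigma>)
    show ?case
    proof
      assume "F \<sigma> \<in> cell S (src S e)"
      then have "0 < wgt S e (F \<sigma>)" "\<sigma> \<in> ?A" using wgt_pos[OF ac, of "F \<sigma>" e] elim by simp_all
      then show False using elim(1) by (simp add: ennreal_eq_0_iff)
    qed
  qed
  from vpos_ex[OF v this] show False by blast
qed

lemma vpos_edge: "vpos (src S e) \<Longrightarrow> vpos (tgt S e)"
proof (rule ccontr)
  assume v: "vpos (src S e)" and "\<not> vpos (tgt S e)"
  then have "F -` cell S (tgt S e) \<in> null_sets M"
    using sets_F_vimage[OF sets_cell, of "tgt S e"] by (auto simp: vpos_def null_sets_def)
  then have "AE \<sigma> in M. \<sigma> \<notin> F -` cell S (tgt S e)" by (rule AE_not_in)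
  then have "AE \<sigma> in M. shift \<sigma> \<notin> F -` cell S (tgt S e)" by (rule AE_shift)
  from vpos_edge_ex[OF v this] show False by auto
qed

lemma vpos_accessible: "accessible S i j \<Longrightarrow> vpos i \<Longrightarrow> vpos j"
  by (rule accessible_propagate[where P=vpos]) (auto intro: vpos_edge)

text \<open>An invariant set is, modulo null sets, determined by the past and by the future. Hence its
  conditional probability given the past is both its indicator and a function of \<open>F\<close> of the form
  \<open>x \<mapsto> P\<^sub>x(R)\<close>, and by absolute continuity the latter is constant on every cell.\<close>

lemma invariant_set_vertices:
  assumes Q: "Q \<in> invariant_sets M"
  obtains u where "AE \<sigma> in M. \<forall>j. F \<sigma> \<in> cell S j \<longrightarrow> (\<sigma> \<in> Q \<longleftrightarrow> u j)"
    "\<And>e. vpos (src S e) \<Longrightarrow> u (src S e) = u (tgt S e)"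
proof -
  obtain B where B: "B \<in> sets past" "AE \<sigma> in M. \<sigma> \<in> Q \<longleftrightarrow> \<sigma> \<in> B" using invariant_past[OF Q] by blast
  obtain R where R: "R \<in> sets future" "AE \<sigma> in M. \<sigma> \<in> Q \<longleftrightarrow> forward \<sigma> \<in> R" using invariant_future[OF Q] by blast
  let ?p = "\<lambda>\<sigma>. emeasure (path_measure S (F \<sigma>)) R"
  have pm[measurable]: "?p \<in> borel_measurable M"
    using measurable_compose[OF measurable_path_F measurable_emeasure_subprob_algebra[OF R(1)]] .
  have p1: "?p \<sigma> \<le> 1" for \<sigma> using path.emeasure_le_1 .
  have BM[measurable]: "B \<in> sets M" using B(1) sets_past_subset by auto
  have RM: "{\<sigma>. forward \<sigma> \<in> R} \<in> sets M" using measurable_sets[OF measurable_forward R(1)] by (simp add: vimage_def)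
  \<comment> \<open>On \<open>B\<close> the conditional probability \<open>?p\<close> is at most one
    and integrates to the full mass of \<open>B\<close>, so it is one there; the same computation
    off \<open>B\<close> gives zero.\<close>
  have "(\<integral>\<^sup>+\<sigma>\<in>B. ?p \<sigma> \<partial>M) = emeasure M (B \<inter> {\<sigma>. forward \<sigma> \<in> R})" by (rule emeasure_past_forward[OF B(1) R(1), symmetric])
  also have "\<dots> = emeasure M B"
  proof (rule emeasure_eq_AE)
    show "AE \<sigma> in M. \<sigma> \<in> B \<inter> {\<sigma>. forward \<sigma> \<in> R} \<longleftrightarrow> \<sigma> \<in> B" using B(2) R(2) by eventually_elim blast
    show "B \<inter> {\<sigma>. forward \<sigma> \<in> R} \<in> events" by (rule sets.Int[OF BM RM])
    show "B \<in> events" by (rule BM)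
  qed
  finally have int1: "(\<integral>\<^sup>+\<sigma>\<in>B. ?p \<sigma> \<partial>M) = emeasure M B" .
  have "(\<integral>\<^sup>+\<sigma>\<in>B. ?p \<sigma> \<partial>M) + (\<integral>\<^sup>+\<sigma>\<in>B. (1 - ?p \<sigma>) \<partial>M) = (\<integral>\<^sup>+\<sigma>. indicator B \<sigma> \<partial>M)"
    using p1 by (subst nn_integral_add[symmetric]) (auto intro!: nn_integral_cong split: split_indicator)
  then have "emeasure M B + (\<integral>\<^sup>+\<sigma>\<in>B. (1 - ?p \<sigma>) \<partial>M) = emeasure M B + 0" using int1 nn_integral_indicator[OF BM] by simp
  then have "(\<integral>\<^sup>+\<sigma>\<in>B. (1 - ?p \<sigma>) \<partial>M) = 0" by (subst (asm) ennreal_add_left_cancel) (auto simp: emeasure_eq_measure)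
  then have ae1: "AE \<sigma> in M. (1 - ?p \<sigma>) * indicator B \<sigma> = 0" by (subst (asm) nn_integral_0_iff_AE) auto
  have cB: "UNIV - B \<in> sets past" using B(1) sets.compl_sets[of B past] by simp
  have "(\<integral>\<^sup>+\<sigma>\<in>UNIV - B. ?p \<sigma> \<partial>M) = emeasure M ((UNIV - B) \<inter> {\<sigma>. forward \<sigma> \<in> R})"
    by (rule emeasure_past_forward[OF cB R(1), symmetric])
  also have "\<dots> = emeasure M {}"
  proof (rule emeasure_eq_AE)
    show "AE \<sigma> in M. \<sigma> \<in> (UNIV - B) \<inter> {\<sigma>. forward \<sigma> \<in> R} \<longleftrightarrow> \<sigma> \<in> {}" using B(2) R(2) by eventually_elim blast
    show "(UNIV - B) \<inter> {\<sigma>. forward \<sigma> \<in> R} \<in> events" using sets.compl_sets[OF BM] RM by (intro sets.Int) simp_all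
  qed simp
  finally have "(\<integral>\<^sup>+\<sigma>\<in>UNIV - B. ?p \<sigma> \<partial>M) = 0" by simp
  then have ae0: "AE \<sigma> in M. ?p \<sigma> * indicator (UNIV - B) \<sigma> = 0"
    using sets.compl_sets[OF BM] by (subst (asm) nn_integral_0_iff_AE) auto
  \<comment> \<open>One point of the cell suffices in this definition, since \<open>tr\<close>
    spreads probability one over the whole cell.\<close>
  define u where "u j \<longleftrightarrow> (\<exists>x\<in>cell S j. emeasure (path_measure S x) R = 1)" for j
  have tr: "emeasure (path_measure S y) R = 1" if x: "x \<in> cell S j" "y \<in> cell S j" "emeasure (path_measure S x) R = 1" for x y j
  proof -
    have "AE \<tau> in path_measure S x. \<tau> \<in> R" using x(3) R(1) by (simp add: path.emeasure_eq_measure path.prob_eq_1)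
    then have "AE \<tau> in path_measure S y. \<tau> \<in> R" by (rule AE_path_transfer[OF ac x(2,1)])
    then show ?thesis using R(1) by (simp add: path.emeasure_eq_measure path.prob_eq_1)
  qed
  have ae: "AE \<sigma> in M. \<forall>j. F \<sigma> \<in> cell S j \<longrightarrow> (\<sigma> \<in> Q \<longleftrightarrow> u j)"
    using ae0 ae1 B(2)
  proof eventually_elim
    case (elim \<sigma>)
    show ?case
    proof (intro allI impI)
      fix j assume j: "F \<sigma> \<in> cell S j"
      show "\<sigma> \<in> Q \<longleftrightarrow> u j"
      proof
        assume "\<sigma> \<in> Q"
        then have "1 - ?p \<sigma> = 0" using elim(2,3) by simp
        then have "1 \<le> ?p \<sigma>" by (auto simp: diff_eq_0_iff_ennreal)
        then have "?p \<sigma> = 1" by (rule antisym[OF p1])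
        then show "u j" using j unfolding u_def by blast
      next
        assume "u j"
        then have "?p \<sigma> = 1" using tr j unfolding u_def by blast
        then have "\<sigma> \<in> B" using elim(1) by (auto split: split_indicator_asm)
        then show "\<sigma> \<in> Q" using elim(3) by blast
      qed
    qed
  qed
  moreover have "u (src S e) = u (tgt S e)" if v: "vpos (src S e)" for e
  proof -
    have "AE \<sigma> in M. (\<forall>j. F \<sigma> \<in> cell S j \<longrightarrow> (\<sigma> \<in> Q \<longleftrightarrow> u j)) \<and>
      (\<forall>j. F (shift \<sigma>) \<in> cell S j \<longrightarrow> (shift \<sigma> \<in> Q \<longleftrightarrow> u j)) \<and> (shift \<sigma> \<in> Q \<longleftrightarrow> \<sigma> \<in> Q)"
      using ae AE_shift[OF ae] invariant_setsD(2)[OF Q] by eventually_elim blast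
    from vpos_edge_ex[OF v this] show ?thesis by blast
  qed
  ultimately show ?thesis using that by blast
qed

text \<open>A set of vertices that no edge leaves gives a set contained in its shift preimage modulo
  null sets; both have the same finite mass, so they agree modulo null sets.\<close>

lemma closed_invariant:
  assumes "\<And>e. src S e \<in> J \<Longrightarrow> tgt S e \<in> J"
  shows "F -` (\<Union>j\<in>J. cell S j) \<in> invariant_sets M"
proof (rule invariant_setsI)
  have "(\<Union>j\<in>J. cell S j) \<in> sets borel"
    using countable_subset[OF subset_UNIV countable_vertices, of J] by (intro sets.countable_UN') auto
  then show Q: "F -` (\<Union>j\<in>J. cell S j) \<in> sets codes" by (rule sets_F_vimage)
  let ?Q = "F -` (\<Union>j\<in>J. cell S j)"
  have sQ: "shift -` ?Q \<in> sets codes" using measurable_sets[OF measurable_shift Q] by simp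
  have imp: "AE \<sigma> in M. \<sigma> \<in> ?Q \<longrightarrow> shift \<sigma> \<in> ?Q"
    using AE_step
  proof eventually_elim
    case (elim \<sigma>)
    then obtain e where e: "F \<sigma> \<in> cell S (src S e)" "F (shift \<sigma>) = wmap S e (F \<sigma>)" by blast
    show ?case
    proof
      assume "\<sigma> \<in> ?Q"
      then have "src S e \<in> J" using cell_unique e(1) by auto
      then show "shift \<sigma> \<in> ?Q" using assms wmap_cell[OF e(1)] e(2) by auto
    qed
  qed
  have "emeasure M (shift -` ?Q - ?Q) = 0"
  proof -
    have "emeasure M (shift -` ?Q) = emeasure M ((shift -` ?Q - ?Q) \<union> ?Q)"
    proof (rule emeasure_eq_AE)
      show "AE \<sigma> in M. \<sigma> \<in> shift -` ?Q \<longleftrightarrow> \<sigma> \<in> (shift -` ?Q - ?Q) \<union> ?Q" using imp by eventually_elim blast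
      show "shift -` ?Q \<in> events" using sQ by (simp only: sets_M)
      show "(shift -` ?Q - ?Q) \<union> ?Q \<in> events" unfolding sets_M by (rule sets.Un[OF sets.Diff[OF sQ Q] Q])
    qed
    also have "\<dots> = emeasure M (shift -` ?Q - ?Q) + emeasure M ?Q"
      using Q sQ by (intro plus_emeasure[symmetric]) auto
    finally have "emeasure M ?Q + 0 = emeasure M ?Q + emeasure M (shift -` ?Q - ?Q)"
      using emeasure_shift[OF Q] by (simp add: add.commute)
    then show ?thesis by (subst (asm) ennreal_add_left_cancel) (auto simp: emeasure_eq_measure)
  qed
  then have "AE \<sigma> in M. \<sigma> \<notin> shift -` ?Q - ?Q" using Q sQ by (intro AE_not_in) (auto simp: null_sets_def)
  with imp show "AE \<sigma> in M. shift \<sigma> \<in> ?Q \<longleftrightarrow> \<sigma> \<in> ?Q" by eventually_elim auto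
qed

text \<open>Recurrence: the vertices accessible from k are closed under edges, hence give an
  invariant set. Membership of a charged vertex in it is constant along paths from j, so with k it
  contains j, which means that j is accessible from k.\<close>

lemma vpos_essential: "vpos j \<Longrightarrow> j \<in> essential S"
  unfolding essential_def
proof safe
  fix k assume v: "vpos j" and jk: "accessible S j k"
  let ?J = "{m. accessible S k m}"
  have "F -` (\<Union>j\<in>?J. cell S j) \<in> invariant_sets M"
    by (rule closed_invariant) (auto intro: accessible_trans accessible_edge)
  then obtain u where u: "AE \<sigma> in M. \<forall>j. F \<sigma> \<in> cell S j \<longrightarrow> (\<sigma> \<in> F -` (\<Union>j\<in>?J. cell S j) \<longleftrightarrow> u j)"
    "\<And>e. vpos (src S e) \<Longrightarrow> u (src S e) = u (tgt S e)" by (rule invariant_set_vertices) blast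
  have uJ: "u m \<longleftrightarrow> m \<in> ?J" if vm: "vpos m" for m
  proof -
    obtain \<sigma> where \<sigma>: "F \<sigma> \<in> cell S m" "\<forall>j. F \<sigma> \<in> cell S j \<longrightarrow> (\<sigma> \<in> F -` (\<Union>j\<in>?J. cell S j) \<longleftrightarrow> u j)"
      using vpos_ex[OF vm u(1)] by blast
    then have "u m \<longleftrightarrow> (\<exists>j\<in>?J. F \<sigma> \<in> cell S j)" by auto
    then show ?thesis using \<sigma>(1) cell_unique by blast
  qed
  have "vpos k \<and> (u k = u j)"
    by (rule accessible_propagate[OF jk, where P="\<lambda>k. vpos k \<and> (u k = u j)"]) (use v u(2) vpos_edge in auto)
  then have "j \<in> ?J" using uJ v by (auto simp: accessible_refl)
  then show "communicate S j k" using jk by (simp add: communicate_def)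
qed

lemma class_cell_invariant: "c \<in> comm_classes S \<Longrightarrow> F -` class_cell S c \<in> invariant_sets M"
  unfolding class_cell_def by (rule closed_invariant) (auto intro: comm_class_closed accessible_edge)

lemma supported_iff: "c \<in> supported_classes S b z M \<longleftrightarrow> c \<in> comm_classes S \<and> 0 < emeasure M (F -` class_cell S c)"
  unfolding supported_classes_def using emeasure_coded[OF sets_class_cell] by simp

text \<open>A class of positive mass has a charged vertex, and charge propagates along paths to the
  whole class.\<close>

lemma supported_vpos: "c \<in> supported_classes S b z M \<Longrightarrow> j \<in> c \<Longrightarrow> vpos j"
proof -
  assume c: "c \<in> supported_classes S b z M" and j: "j \<in> c"
  have cc: "c \<in> comm_classes S" using c supported_iff by blast
  have "\<exists>i\<in>c. vpos i"
  proof (rule ccontr)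
    assume no: "\<not> ?thesis"
    have "AE \<sigma> in M. \<sigma> \<notin> F -` class_cell S c"
      using AE_vpos
    proof eventually_elim
      case (elim \<sigma>)
      then show ?case using no cell_unique unfolding class_cell_def by blast
    qed
    then have "emeasure M (F -` class_cell S c) = 0"
      using sets_F_vimage[OF sets_class_cell, of c]
      by (subst AE_iff_measurable[symmetric, where P="\<lambda>\<sigma>. \<sigma> \<notin> F -` class_cell S c"]) auto
    then show False using c supported_iff by auto
  qed
  then obtain i where "i \<in> c" "vpos i" by blast
  then show ?thesis using vpos_accessible comm_class_accessible[OF cc _ j] by blast
qed

lemma AE_supported: "AE \<sigma> in M. \<exists>c\<in>supported_classes S b z M. F \<sigma> \<in> class_cell S c"
  using AE_vpos
proof eventually_elim
  case (elim \<sigma>)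
  then obtain j where j: "vpos j" "F \<sigma> \<in> cell S j" by blast
  obtain c where c: "c \<in> comm_classes S" "j \<in> c" using comm_class_ex[OF vpos_essential[OF j(1)]] by blast
  have "emeasure M (F -` cell S j) \<le> emeasure M (F -` class_cell S c)"
    using sets_F_vimage[OF sets_class_cell, of c] c(2) by (intro emeasure_mono) (auto simp: class_cell_def)
  then have "c \<in> supported_classes S b z M" using j(1) c(1) unfolding supported_iff vpos_def by auto
  then show ?case using j(2) c(2) unfolding class_cell_def by blast
qed

lemma supported_nonempty: "supported_classes S b z M \<noteq> {}"
proof
  assume "supported_classes S b z M = {}"
  then have "AE \<sigma> in M. False" using AE_supported by simp
  then show False by simp
qed

text \<open>The function \<open>u\<close> of \<open>invariant_set_vertices\<close> is constant along
  edges from charged vertices, hence on a class, all of whose vertices are charged.\<close>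

lemma ergodic_of_class:
  assumes c: "c \<in> comm_classes S" and ae: "AE \<sigma> in M. F \<sigma> \<in> class_cell S c"
  shows "ergodic M"
  unfolding ergodic_def
proof safe
  show "M \<in> shift_invariant" using M unfolding equilibrium_states_def by blast
  fix Q assume Q: "Q \<in> invariant_sets M" and n1: "emeasure M Q \<noteq> 1"
  obtain u where u: "AE \<sigma> in M. \<forall>j. F \<sigma> \<in> cell S j \<longrightarrow> (\<sigma> \<in> Q \<longleftrightarrow> u j)"
    "\<And>e. vpos (src S e) \<Longrightarrow> u (src S e) = u (tgt S e)" using invariant_set_vertices[OF Q] by blast
  have "emeasure M (F -` class_cell S c) = 1"
    using ae sets_F_vimage[OF sets_class_cell, of c] by (simp add: emeasure_eq_measure prob_eq_1)
  then have "c \<in> supported_classes S b z M" using c by (simp add: supported_iff)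
  then have v: "vpos j" if "j \<in> c" for j using supported_vpos that by blast
  have const: "u j = u i" if "i \<in> c" "j \<in> c" for i j
  proof -
    have "j \<in> c \<and> u j = u i"
      by (rule accessible_propagate[OF comm_class_accessible[OF c that], where P="\<lambda>k. k \<in> c \<and> u k = u i"])
         (use that u(2) v comm_class_closed[OF c _ accessible_edge] in auto)
    then show ?thesis ..
  qed
  have Qc: "Q \<in> sets M" using invariant_setsD(1)[OF Q] by simp
  show "emeasure M Q = 0"
  proof (cases "\<exists>i\<in>c. u i")
    case True
    have "AE \<sigma> in M. \<sigma> \<in> Q" using ae u(1) unfolding class_cell_def
      by eventually_elim (use True const in blast)
    then have "emeasure M Q = 1" using Qc by (simp add: emeasure_eq_measure prob_eq_1)
    with n1 show ?thesis by simp
  next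
    case False
    have "AE \<sigma> in M. \<sigma> \<notin> Q" using ae u(1) unfolding class_cell_def
      by eventually_elim (use False in blast)
    then show ?thesis using Qc by (subst AE_iff_measurable[symmetric, where P="\<lambda>\<sigma>. \<sigma> \<notin> Q"]) auto
  qed
qed

text \<open>The source of the measures \<Lambda>. Shift invariance survives because the preimage of
  the class is an invariant set; the conditional weights survive because it coincides almost surely
  with an event of the past.\<close>

lemma conditioned_equilibrium:
  assumes c: "c \<in> supported_classes S b z M"
  defines "\<Lambda> \<equiv> uniform_measure M (F -` class_cell S c)"
  shows "\<Lambda> \<in> equilibrium_states S b z" and "AE \<sigma> in \<Lambda>. F \<sigma> \<in> class_cell S c"
proof -
  let ?A = "F -` class_cell S c"
  have A[measurable]: "?A \<in> sets M" using sets_F_vimage[OF sets_class_cell, of c] by simp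
  have pos: "emeasure M ?A \<noteq> 0" "emeasure M ?A \<noteq> \<infinity>" using c supported_iff by (auto simp: emeasure_eq_measure)
  have cc: "c \<in> comm_classes S" using c supported_iff by blast
  have inv: "AE \<sigma> in M. shift \<sigma> \<in> ?A \<longleftrightarrow> \<sigma> \<in> ?A" by (rule invariant_setsD(2)[OF class_cell_invariant[OF cc]])
  have s\<Lambda>: "sets \<Lambda> = sets codes" unfolding \<Lambda>_def by simp
  have em: "emeasure \<Lambda> B = emeasure M (?A \<inter> B) / emeasure M ?A" if "B \<in> sets codes" for B
    unfolding \<Lambda>_def by (rule emeasure_uniform_measure[OF A]) (use that in simp)
  show "AE \<sigma> in \<Lambda>. F \<sigma> \<in> class_cell S c" unfolding \<Lambda>_def by (rule AE_uniform_measureI[OF A]) simp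
  show "\<Lambda> \<in> equilibrium_states S b z"
    unfolding equilibrium_iff
  proof (intro conjI allI ballI)
    show "sets \<Lambda> = sets codes" by (rule s\<Lambda>)
    show "prob_space \<Lambda>" unfolding \<Lambda>_def by (rule prob_space_uniform_measure[OF pos])
    show "AE \<sigma> in \<Lambda>. \<sigma> \<in> coding_domain S b z"
      unfolding \<Lambda>_def by (rule AE_uniform_measureI[OF A]) (use AE_domain in auto)
    show "distr \<Lambda> \<Lambda> shift = \<Lambda>"
    proof (rule measure_eqI)
      fix B assume "B \<in> sets (distr \<Lambda> \<Lambda> shift)"
      then have B: "B \<in> sets codes" using s\<Lambda> by simp
      then have sB: "shift -` B \<in> sets codes" using measurable_sets[OF measurable_shift] by simp
      have sA: "shift -` (?A \<inter> B) \<in> sets codes" using measurable_sets[OF measurable_shift, of "?A \<inter> B"] A B by simp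
      have "emeasure (distr \<Lambda> \<Lambda> shift) B = emeasure \<Lambda> (shift -` B)"
        using B s\<Lambda> sets_eq_imp_space_eq[OF s\<Lambda>] by (subst emeasure_distr) (auto cong: measurable_cong_sets)
      also have "\<dots> = emeasure M (?A \<inter> shift -` B) / emeasure M ?A" by (rule em[OF sB])
      also have "emeasure M (?A \<inter> shift -` B) = emeasure M (shift -` (?A \<inter> B))"
      proof (rule emeasure_eq_AE)
        show "AE \<sigma> in M. \<sigma> \<in> ?A \<inter> shift -` B \<longleftrightarrow> \<sigma> \<in> shift -` (?A \<inter> B)" using inv by eventually_elim blast
        show "?A \<inter> shift -` B \<in> events" using A sB by (intro sets.Int) simp_all
        show "shift -` (?A \<inter> B) \<in> events" using sA by simp
      qed
      also have "\<dots> = emeasure M (?A \<inter> B)" using A B by (intro emeasure_shift) simp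
      finally show "emeasure (distr \<Lambda> \<Lambda> shift) B = emeasure \<Lambda> B" using em[OF B] by simp
    qed simp
    fix e and B :: "(int \<Rightarrow> 'e option) set" assume B: "B \<in> sets past"
    have BM: "B \<in> sets M" using B sets_past_subset by auto
    \<comment> \<open>The version of the conditioning event that belongs to \<open>past\<close>; it
      may be merged into \<open>B\<close> before \<open>cond\<close> is applied.\<close>
    let ?P = "{\<sigma>. F0 \<sigma> \<in> class_cell S c}"
    have A0: "?P \<in> sets past" using measurable_sets[OF measurable_F0 sets_class_cell, of c] by (simp add: vimage_def)
    have A0M: "?P \<in> sets M" using A0 sets_past_subset by auto
    have Be: "B \<inter> {\<sigma>. \<sigma> 1 = Some e} \<in> sets codes" using BM by auto
    have "emeasure \<Lambda> (B \<inter> {\<sigma>. \<sigma> 1 = Some e}) = emeasure M (?A \<inter> (B \<inter> {\<sigma>. \<sigma> 1 = Some e})) / emeasure M ?A" by (rule em[OF Be])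
    also have "emeasure M (?A \<inter> (B \<inter> {\<sigma>. \<sigma> 1 = Some e})) = emeasure M ((?P \<inter> B) \<inter> {\<sigma>. \<sigma> 1 = Some e})"
    proof (rule emeasure_eq_AE)
      show "AE \<sigma> in M. \<sigma> \<in> ?A \<inter> (B \<inter> {\<sigma>. \<sigma> 1 = Some e}) \<longleftrightarrow> \<sigma> \<in> (?P \<inter> B) \<inter> {\<sigma>. \<sigma> 1 = Some e}"
        using AE_F_eq_F0 by eventually_elim auto
      show "?A \<inter> (B \<inter> {\<sigma>. \<sigma> 1 = Some e}) \<in> events" using sets.Int[OF A, of "B \<inter> {\<sigma>. \<sigma> 1 = Some e}"] Be by (simp only: sets_M)
      show "(?P \<inter> B) \<inter> {\<sigma>. \<sigma> 1 = Some e} \<in> events" using A0M BM by (intro sets.Int) simp_all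
    qed
    also have "\<dots> = (\<integral>\<^sup>+\<sigma>\<in>?P \<inter> B. ennreal (wgt S e (F \<sigma>)) \<partial>M)" by (rule cond) (use A0 B in auto)
    also have "\<dots> = (\<integral>\<^sup>+\<sigma>. (ennreal (wgt S e (F \<sigma>)) * indicator B \<sigma>) * indicator ?A \<sigma> \<partial>M)"
    proof (rule nn_integral_cong_AE)
      show "AE \<sigma> in M. ennreal (wgt S e (F \<sigma>)) * indicator (?P \<inter> B) \<sigma> =
          ennreal (wgt S e (F \<sigma>)) * indicator B \<sigma> * indicator ?A \<sigma>"
        using AE_F_eq_F0 by eventually_elim (auto split: split_indicator)
    qed
    also have "\<dots> / emeasure M ?A = (\<integral>\<^sup>+\<sigma>\<in>B. ennreal (wgt S e (F \<sigma>)) \<partial>\<Lambda>)"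
    proof -
      have "(\<lambda>\<sigma>. ennreal (wgt S e (F \<sigma>)) * indicator B \<sigma>) \<in> borel_measurable M"
        by (intro borel_measurable_times_ennreal borel_measurable_indicator BM) measurable
      then show ?thesis unfolding \<Lambda>_def by (rule nn_integral_uniform_measure[symmetric, OF _ A])
    qed
    finally show "emeasure \<Lambda> (B \<inter> {\<sigma>. \<sigma> 1 = Some e}) = (\<integral>\<^sup>+\<sigma>\<in>B. ennreal (wgt S e (F \<sigma>)) \<partial>\<Lambda>)" .
  qed
qed

end

subsection \<open>The strong law on a communication class\<close>

lemma pred_LIMSEQ:
  fixes f :: "nat \<Rightarrow> 'a \<Rightarrow> real"
  assumes [measurable]: "\<And>n. f n \<in> borel_measurable M"
  shows "Measurable.pred M (\<lambda>x. (\<lambda>n. f n x) \<longlonglongrightarrow> c)"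
proof -
  have "(\<lambda>n. f n x) \<longlonglongrightarrow> c \<longleftrightarrow> (\<forall>j::nat. \<exists>N. \<forall>n\<ge>N. \<bar>f n x - c\<bar> < 1 / real (Suc j))" for x
    unfolding LIMSEQ_iff real_norm_def
  proof (intro iffI allI impI)
    fix r :: real assume *: "\<forall>j::nat. \<exists>N. \<forall>n\<ge>N. \<bar>f n x - c\<bar> < 1 / real (Suc j)" and "0 < r"
    then obtain j where "1 / real (Suc j) < r" using nat_approx_posE by blast
    then show "\<exists>N. \<forall>n\<ge>N. \<bar>f n x - c\<bar> < r" using *[rule_format, of j] by (meson less_trans)
  qed simp
  then show ?thesis by simp
qed

text \<open>Bridges Birkhoff sums from time 0 and averages from time 1, which keep the divisor n:
  the ratio (n + 1)/n tends to 1 and the dropped term vanishes.\<close>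

lemma averages_drop_first:
  fixes s :: "nat \<Rightarrow> real"
  assumes "(\<lambda>n. s n / real n) \<longlonglongrightarrow> c"
  shows "(\<lambda>n. (s (Suc n) - d) / real n) \<longlonglongrightarrow> c"
proof -
  have "(\<lambda>n. s (Suc n) / real (Suc n)) \<longlonglongrightarrow> c" using assms by (simp only: filterlim_sequentially_Suc[of "\<lambda>n. s n / real n"])
  moreover have "(\<lambda>n. 1 + 1 / real n) \<longlonglongrightarrow> 1 + 0" by (intro tendsto_intros lim_const_over_n)
  ultimately have "(\<lambda>n. (1 + 1 / real n) * (s (Suc n) / real (Suc n)) - d / real n) \<longlonglongrightarrow> (1 + 0) * c - 0"
    by (intro tendsto_intros lim_const_over_n)
  then have "(\<lambda>n. (1 + 1 / real n) * (s (Suc n) / real (Suc n)) - d / real n) \<longlonglongrightarrow> c" by simp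
  then show ?thesis
  proof (rule Lim_transform_eventually, intro eventually_sequentiallyI[of 1])
    fix n :: nat assume "1 \<le> n"
    then have "(1 + 1 / real n) = real (Suc n) / real n" by (simp add: field_simps)
    then show "(1 + 1 / real n) * (s (Suc n) / real (Suc n)) - d / real n = (s (Suc n) - d) / real n"
      by (simp add: diff_divide_distrib)
  qed
qed

lemma prob_space_finite_approx:
  assumes "prob_space P" "countable (UNIV :: 'n set)" "sets P = UNIV" "0 < \<epsilon>"
  shows "\<exists>V :: 'n set. finite V \<and> 1 - \<epsilon> < measure P V"
proof -
  interpret prob_space P by fact
  let ?V = "\<lambda>m. from_nat_into UNIV ` {..<m} :: 'n set"
  have sp: "space P = UNIV" using sets.sets_into_space[of UNIV P] assms(3) by auto
  have "(\<lambda>m. measure P (?V m)) \<longlonglongrightarrow> measure P (\<Union>m. ?V m)"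
    by (rule finite_Lim_measure_incseq) (auto simp: assms(3) incseq_def)
  also have "(\<Union>m. ?V m) = space P"
  proof -
    have "(\<Union>m. ?V m) = range (from_nat_into UNIV)" by (auto intro: lessI)
    then show ?thesis using range_from_nat_into[OF _ assms(2)] sp by simp
  qed
  finally have "(\<lambda>m. measure P (?V m)) \<longlonglongrightarrow> 1" by (simp add: prob_space)
  then have "\<forall>\<^sub>F m in sequentially. 1 - \<epsilon> < measure P (?V m)" using assms(4) by (intro order_tendstoD) auto
  then obtain m where "1 - \<epsilon> < measure P (?V m)" by (auto simp: eventually_sequentially)
  then show ?thesis by (intro exI[of _ "?V m"]) auto
qed

context equilibrium
begin

text \<open>Identifies ergodic averages over the shift with Birkhoff sums along the future letters
  from the coded point.\<close>

lemma AE_orbit_shift: "AE \<sigma> in M. \<forall>k. F ((shift ^^ k) \<sigma>) = orbit S (forward \<sigma>) k (F \<sigma>)"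
proof -
  have "AE \<sigma> in M. \<forall>k. \<exists>e. (shift ^^ k) \<sigma> 1 = Some e \<and> F (shift ((shift ^^ k) \<sigma>)) = wmap S e (F ((shift ^^ k) \<sigma>))"
    unfolding AE_all_countable
  proof
    fix k show "AE \<sigma> in M. \<exists>e. (shift ^^ k) \<sigma> 1 = Some e \<and> F (shift ((shift ^^ k) \<sigma>)) = wmap S e (F ((shift ^^ k) \<sigma>))"
      by (rule AE_shift_pow) (use AE_step in \<open>eventually_elim, blast\<close>)
  qed
  then show ?thesis
  proof eventually_elim
    case (elim \<sigma>)
    show ?case
    proof
      fix k show "F ((shift ^^ k) \<sigma>) = orbit S (forward \<sigma>) k (F \<sigma>)"
      proof (induction k)
        case (Suc k)
        obtain e where e: "(shift ^^ k) \<sigma> 1 = Some e" "F (shift ((shift ^^ k) \<sigma>)) = wmap S e (F ((shift ^^ k) \<sigma>))"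
          using elim by blast
        have "forward \<sigma> (Suc k) = Some e" using e(1) by (simp add: shift_pow)
        then show ?case using e(2) Suc by simp
      qed simp
    qed
  qed
qed

text \<open>Conditioning on the past replaces the first letter by its weights, with
  \<open>F0\<close> making the integrand past-measurable. The first form is the limit in the
  theorem; the second turns a pointwise bound on the conditional mean into integrability.\<close>

lemma nn_integral_letter:
  assumes fm[measurable]: "\<And>e. f e \<in> borel_measurable borel" and f0: "\<And>e x. 0 \<le> f e x"
  shows "(\<integral>\<^sup>+\<sigma>. ennreal (fun_ext f (\<sigma> 1) (F \<sigma>)) \<partial>M)
      = (\<Sum>\<^sub>\<infinity>e. \<integral>\<^sup>+y\<in>cell S (src S e). ennreal (wgt S e y * f e y) \<partial>coded S b z M)" (is ?eq1)
    and "(\<integral>\<^sup>+\<sigma>. ennreal (fun_ext f (\<sigma> 1) (F \<sigma>)) \<partial>M)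
      = (\<integral>\<^sup>+\<sigma>. (\<integral>\<^sup>+e. ennreal (wgt S e (F \<sigma>) * f e (F \<sigma>)) \<partial>count_space UNIV) \<partial>M)" (is ?eq2)
proof -
  have "(\<integral>\<^sup>+\<sigma>. ennreal (fun_ext f (\<sigma> 1) (F \<sigma>)) \<partial>M)
    = (\<integral>\<^sup>+\<sigma>. (\<integral>\<^sup>+e. indicator {\<sigma>. \<sigma> 1 = Some e} \<sigma> * ennreal (f e (F0 \<sigma>)) \<partial>count_space UNIV) \<partial>M)"
  proof (rule nn_integral_cong_AE)
    show "AE \<sigma> in M. ennreal (fun_ext f (\<sigma> 1) (F \<sigma>)) = (\<integral>\<^sup>+e. indicator {\<sigma>. \<sigma> 1 = Some e} \<sigma> * ennreal (f e (F0 \<sigma>)) \<partial>count_space UNIV)"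
      using AE_step AE_F_eq_F0
    proof eventually_elim
      case (elim \<sigma>)
      then obtain e where e: "\<sigma> 1 = Some e" by blast
      have "(\<integral>\<^sup>+e'. indicator {\<sigma>. \<sigma> 1 = Some e'} \<sigma> * ennreal (f e' (F0 \<sigma>)) \<partial>count_space UNIV)
        = (\<integral>\<^sup>+e'. ennreal (f e (F \<sigma>)) * indicator {e} e' \<partial>count_space UNIV)"
        using e elim(2) by (intro nn_integral_cong) (auto split: split_indicator)
      also have "\<dots> = ennreal (f e (F \<sigma>))" by (subst nn_integral_cmult_indicator) auto
      finally show ?case using e by simp
    qed
  qed
  also have "\<dots> = (\<integral>\<^sup>+e. (\<integral>\<^sup>+\<sigma>. indicator {\<sigma>. \<sigma> 1 = Some e} \<sigma> * ennreal (f e (F0 \<sigma>)) \<partial>M) \<partial>count_space UNIV)"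
    by (rule nn_integral_count_space_nn_integral) auto
  also have "\<dots> = (\<integral>\<^sup>+e. (\<integral>\<^sup>+\<sigma>. ennreal (wgt S e (F \<sigma>) * f e (F \<sigma>)) \<partial>M) \<partial>count_space UNIV)"
  proof (rule nn_integral_cong)
    fix e
    have "(\<integral>\<^sup>+\<sigma>. indicator {\<sigma>. \<sigma> 1 = Some e} \<sigma> * ennreal (f e (F0 \<sigma>)) \<partial>M) = (\<integral>\<^sup>+\<sigma>. ennreal (wgt S e (F \<sigma>)) * ennreal (f e (F0 \<sigma>)) \<partial>M)"
      by (rule nn_integral_cond) measurable
    also have "\<dots> = (\<integral>\<^sup>+\<sigma>. ennreal (wgt S e (F \<sigma>) * f e (F \<sigma>)) \<partial>M)"
    proof (rule nn_integral_cong_AE)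
      show "AE \<sigma> in M. ennreal (wgt S e (F \<sigma>)) * ennreal (f e (F0 \<sigma>)) = ennreal (wgt S e (F \<sigma>) * f e (F \<sigma>))"
        using AE_F_eq_F0 by eventually_elim (simp add: ennreal_mult')
    qed
    finally show "(\<integral>\<^sup>+\<sigma>. indicator {\<sigma>. \<sigma> 1 = Some e} \<sigma> * ennreal (f e (F0 \<sigma>)) \<partial>M) = (\<integral>\<^sup>+\<sigma>. ennreal (wgt S e (F \<sigma>) * f e (F \<sigma>)) \<partial>M)" .
  qed
  finally have *: "(\<integral>\<^sup>+\<sigma>. ennreal (fun_ext f (\<sigma> 1) (F \<sigma>)) \<partial>M)
    = (\<integral>\<^sup>+e. (\<integral>\<^sup>+\<sigma>. ennreal (wgt S e (F \<sigma>) * f e (F \<sigma>)) \<partial>M) \<partial>count_space UNIV)" .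
  also have "\<dots> = (\<integral>\<^sup>+e. (\<integral>\<^sup>+y\<in>cell S (src S e). ennreal (wgt S e y * f e y) \<partial>coded S b z M) \<partial>count_space UNIV)"
  proof (rule nn_integral_cong)
    fix e
    have "(\<lambda>y. ennreal (wgt S e y * f e y) * indicator (cell S (src S e)) y) \<in> borel_measurable borel" by measurable
    then have "(\<integral>\<^sup>+y\<in>cell S (src S e). ennreal (wgt S e y * f e y) \<partial>coded S b z M)
      = (\<integral>\<^sup>+\<sigma>. ennreal (wgt S e (F \<sigma>) * f e (F \<sigma>)) * indicator (cell S (src S e)) (F \<sigma>) \<partial>M)"
      by (rule nn_integral_coded)
    also have "\<dots> = (\<integral>\<^sup>+\<sigma>. ennreal (wgt S e (F \<sigma>) * f e (F \<sigma>)) \<partial>M)"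
      by (intro nn_integral_cong) (auto split: split_indicator simp: wgt_0)
    finally show "(\<integral>\<^sup>+\<sigma>. ennreal (wgt S e (F \<sigma>) * f e (F \<sigma>)) \<partial>M) = (\<integral>\<^sup>+y\<in>cell S (src S e). ennreal (wgt S e y * f e y) \<partial>coded S b z M)"
      by simp
  qed
  finally show ?eq1 by (subst infsum_ennreal_eq_nn_integral) simp_all
  show ?eq2 unfolding * by (rule nn_integral_count_space_nn_integral[symmetric]) auto
qed

text \<open>Shifting by k + 1 moves the window -k..k onto the future indices 1..2k+1, whose law
  depends on the coded point only. Hence the image measure determines the equilibrium state.\<close>

lemma emeasure_cylinder_coded:
  "emeasure M (cylinder UNIV {- int k..int k} e) =
    (\<integral>\<^sup>+x. ennreal (cyl_prob x (\<lambda>i. e (int i - int (Suc k))) (Suc (2 * k))) \<partial>coded S b z M)"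
proof -
  let ?e = "\<lambda>i. e (int i - int (Suc k))"
  have "(\<forall>i\<in>{- int k..int k}. \<sigma> (i + int (Suc k)) = e i) \<longleftrightarrow> (\<forall>i\<in>{1..Suc (2 * k)}. \<sigma> (int i) = ?e i)" for \<sigma>
  proof (intro iffI ballI)
    fix i assume *: "\<forall>i\<in>{- int k..int k}. \<sigma> (i + int (Suc k)) = e i" and i: "i \<in> {1..Suc (2 * k)}"
    have "int i - int (Suc k) \<in> {- int k..int k}" using i by auto
    from *[rule_format, OF this] show "\<sigma> (int i) = ?e i" by simp
  next
    fix i assume *: "\<forall>i\<in>{1..Suc (2 * k)}. \<sigma> (int i) = ?e i" and i: "i \<in> {- int k..int k}"
    have "nat (i + int (Suc k)) \<in> {1..Suc (2 * k)}" using i by auto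
    from *[rule_format, OF this] show "\<sigma> (i + int (Suc k)) = e i" using i by simp
  qed
  then have "(shift ^^ Suc k) -` cylinder UNIV {- int k..int k} e = UNIV \<inter> {\<sigma>. \<forall>i\<in>{1..Suc (2 * k)}. \<sigma> (int i) = ?e i}"
    unfolding cylinder_eq vimage_def shift_pow by simp
  moreover have "cylinder UNIV {- int k..int k} e \<in> sets codes" by (rule cylinder_in_sets) auto
  ultimately have "emeasure M (cylinder UNIV {- int k..int k} e) = emeasure M (UNIV \<inter> {\<sigma>. \<forall>i\<in>{1..Suc (2 * k)}. \<sigma> (int i) = ?e i})"
    using emeasure_shift_pow[of "cylinder UNIV {- int k..int k} e" "Suc k"] by (simp only:)
  also have "\<dots> = (\<integral>\<^sup>+\<sigma>\<in>UNIV. ennreal (cyl_prob (F \<sigma>) ?e (Suc (2 * k))) \<partial>M)"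
    by (rule emeasure_past_cylinder) (use sets.top[of past] in simp)
  also have "\<dots> = (\<integral>\<^sup>+x. ennreal (cyl_prob x ?e (Suc (2 * k))) \<partial>coded S b z M)"
    by (subst nn_integral_coded) (simp_all del: cyl_prob_Suc)
  finally show ?thesis .
qed

lemma equilibrium_eqI:
  assumes \<Lambda>: "\<Lambda> \<in> equilibrium_states S b z" and eq: "coded S b z \<Lambda> = coded S b z M"
  shows "\<Lambda> = M"
proof -
  interpret L: equilibrium S b z \<Lambda> by unfold_locales (rule \<Lambda>)
  show ?thesis
  proof (rule code_measure_eqI[OF _ _ _ code_windows])
    show "emeasure \<Lambda> (cylinder UNIV {- int k..int k} e) = emeasure M (cylinder UNIV {- int k..int k} e)" for k e
      unfolding L.emeasure_cylinder_coded emeasure_cylinder_coded eq ..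
  qed (auto simp: L.finite_measure_axioms)
qed

end

context ac_equilibrium
begin

context
  fixes c :: "'n set"
  assumes c: "c \<in> comm_classes S" and AE_c: "AE \<sigma> in M. F \<sigma> \<in> class_cell S c"
begin

lemma class_vpos: "j \<in> c \<Longrightarrow> vpos j"
proof -
  have "emeasure M (F -` class_cell S c) = 1"
    using AE_c sets_F_vimage[OF sets_class_cell, of c] by (simp add: emeasure_eq_measure prob_eq_1)
  then have "c \<in> supported_classes S b z M" using c by (simp add: supported_iff)
  then show "j \<in> c \<Longrightarrow> vpos j" by (rule supported_vpos)
qed

lemma strong_law:
  assumes hm: "\<And>d. h d \<in> borel_measurable borel" and int: "integrable M (\<lambda>\<sigma>. h (\<sigma> 1) (F \<sigma>))"
    and same: "same_averages h" and x: "x \<in> class_cell S c"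
  shows "AE \<tau> in path_measure S x. (\<lambda>n. birk h n x \<tau> / n) \<longlonglongrightarrow> (\<integral>\<sigma>. h (\<sigma> 1) (F \<sigma>) \<partial>M)"
proof -
  let ?I = "\<integral>\<sigma>. h (\<sigma> 1) (F \<sigma>) \<partial>M"
  have erg: "emeasure M B = 0 \<or> emeasure M B = 1" if "B \<in> sets M" "shift -` B \<inter> space M = B" for B
  proof -
    have "B \<in> invariant_sets M" using that by (intro invariant_setsI) auto
    then show ?thesis using ergodic_of_class[OF c AE_c] unfolding ergodic_def by blast
  qed
  have sm: "shift \<in> M \<rightarrow>\<^sub>M M" by (simp cong: measurable_cong_sets)
  have "AE \<sigma> in M. (\<lambda>n. (\<Sum>k<n. h ((shift ^^ k) \<sigma> 1) (F ((shift ^^ k) \<sigma>))) / n) \<longlonglongrightarrow> ?I"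
    using pointwise_ergodic[OF sm distr_shift int erg] by simp
  then have ae: "AE \<sigma> in M. (\<lambda>n. birk h n (F \<sigma>) (forward \<sigma>) / n) \<longlonglongrightarrow> ?I"
    using AE_orbit_shift
  proof eventually_elim
    case (elim \<sigma>)
    have "birk h n (F \<sigma>) (forward \<sigma>) = (\<Sum>k<n. h ((shift ^^ k) \<sigma> 1) (F ((shift ^^ k) \<sigma>)))" for n
      unfolding birk_def using elim(2) by (simp add: shift_pow)
    then show ?case using elim(1) by simp
  qed
  let ?Q = "\<lambda>p. (\<lambda>n. birk h n (fst p) (snd p) / n) \<longlonglongrightarrow> ?I"
  \<comment> \<open>Joint measurability in the starting point and the path is what
    \<open>AE_joint\<close> demands in order to disintegrate the limit.\<close>
  have "Measurable.pred (borel \<Otimes>\<^sub>M future) ?Q"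
  proof (rule pred_LIMSEQ)
    fix n
    have "(\<lambda>p. h (snd p (Suc k)) (orbit S (snd p) k (fst p))) \<in> borel_measurable (borel \<Otimes>\<^sub>M future)" for k
      using measurable_letter_orbit_pair[OF hm] by (simp add: split_beta')
    then show "(\<lambda>p. birk h n (fst p) (snd p) / n) \<in> borel_measurable (borel \<Otimes>\<^sub>M future)"
      unfolding birk_def by (intro borel_measurable_divide borel_measurable_sum) auto
  qed
  from AE_joint[OF this] ae have "AE \<sigma> in M. AE \<tau> in path_measure S (F \<sigma>). (\<lambda>n. birk h n (F \<sigma>) \<tau> / n) \<longlonglongrightarrow> ?I" by simp
  \<comment> \<open>The cell of x is charged, so it contains a coded point from which the limit
    holds along almost every path.\<close>
  moreover obtain j where j: "j \<in> c" "x \<in> cell S j" using x by (auto simp: class_cell_def)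
  ultimately obtain \<sigma> where \<sigma>: "F \<sigma> \<in> cell S j" "AE \<tau> in path_measure S (F \<sigma>). (\<lambda>n. birk h n (F \<sigma>) \<tau> / n) \<longlonglongrightarrow> ?I"
    using vpos_ex[OF class_vpos[OF j(1)]] by blast
  have "AE \<tau> in path_measure S x. (\<lambda>n. (birk h n x \<tau> - birk h n (F \<sigma>) \<tau>) / n) \<longlonglongrightarrow> 0"
    using same \<sigma>(1) j(2) unfolding same_averages_def by blast
  then show ?thesis using AE_path_transfer[OF ac j(2) \<sigma>]
  proof eventually_elim
    case (elim \<tau>)
    have "(\<lambda>n. (birk h n x \<tau> - birk h n (F \<sigma>) \<tau>) / n + birk h n (F \<sigma>) \<tau> / n) \<longlonglongrightarrow> 0 + ?I"
      by (intro tendsto_add elim)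
    then show ?case by (simp add: diff_divide_distrib)
  qed
qed

subsection \<open>Uniqueness of the invariant measure\<close>

text \<open>The \<nu>-integral of the expected time averages does not depend on n by invariance,
  while the strong law and dominated convergence give their limit.\<close>

lemma nn_integral_invariant:
  assumes \<nu>: "\<nu> \<in> invariant_measures S" "emeasure \<nu> (class_cell S c) = 1"
    and g[measurable]: "g \<in> borel_measurable borel" and g01: "\<And>x. 0 \<le> g x" "\<And>x. g x \<le> 1" and same: "same_averages (\<lambda>_. g)"
  shows "(\<integral>\<^sup>+x. ennreal (g x) \<partial>\<nu>) = ennreal (\<integral>\<sigma>. g (F \<sigma>) \<partial>M)"
proof -
  have s\<nu>[measurable_cong]: "sets \<nu> = sets borel" and p\<nu>: "prob_space \<nu>" and inv: "adj_op S \<nu> = \<nu>"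
    using \<nu>(1) unfolding invariant_measures_def by auto
  interpret nu: prob_space \<nu> by (rule p\<nu>)
  let ?I = "\<integral>\<sigma>. g (F \<sigma>) \<partial>M" and ?h = "\<lambda>_::'e option. g"
  let ?a = "\<lambda>n x. \<integral>\<^sup>+\<tau>. ennreal (birk ?h n x \<tau> / n) \<partial>path_measure S x"
  have int: "integrable M (\<lambda>\<sigma>. g (F \<sigma>))"
    using g01 by (intro integrable_const_bound[where B=1]) auto
  have b01: "0 \<le> birk ?h n x \<tau> / n" "birk ?h n x \<tau> / n \<le> 1" for n x \<tau>
  proof -
    show "0 \<le> birk ?h n x \<tau> / n" unfolding birk_def by (intro divide_nonneg_nonneg sum_nonneg g01) simp
    have "birk ?h n x \<tau> \<le> n" unfolding birk_def using sum_bounded_above[of "{..<n}" "\<lambda>k. g (orbit S \<tau> k x)" 1] g01 by simp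
    then show "birk ?h n x \<tau> / n \<le> 1" by (cases "n = 0") (auto simp: divide_le_eq_1)
  qed
  have lim: "(\<lambda>n. ?a n x) \<longlonglongrightarrow> ennreal ?I" if x: "x \<in> class_cell S c" for x
  proof -
    have "(\<lambda>n. ?a n x) \<longlonglongrightarrow> (\<integral>\<^sup>+\<tau>. ennreal ?I \<partial>path_measure S x)"
    proof (rule nn_integral_dominated_convergence[where w="\<lambda>_. 1"])
      show "(\<lambda>\<tau>. ennreal (birk ?h n x \<tau> / n)) \<in> borel_measurable (path_measure S x)" for n
        by (rule measurable_path_cong) measurable
      show "AE \<tau> in path_measure S x. ennreal (birk ?h n x \<tau> / n) \<le> 1" for n
        using b01 by (auto simp: ennreal_le_1)
      show "AE \<tau> in path_measure S x. (\<lambda>n. ennreal (birk ?h n x \<tau> / n)) \<longlonglongrightarrow> ennreal ?I"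
        using strong_law[OF _ _ same x] int g by (auto elim!: eventually_mono intro: tendsto_ennrealI)
    qed (auto simp: path.emeasure_space_1)
    then show ?thesis by (simp add: path.emeasure_space_1)
  qed
  have gk: "(\<lambda>x. \<integral>\<^sup>+\<tau>. ennreal (g (orbit S \<tau> k x)) \<partial>path_measure S x) \<in> borel_measurable borel" for k
    by (rule measurable_path_nn_integral) (use measurable_compose[OF measurable_orbit_pair, of "\<lambda>x. ennreal (g x)"] in \<open>simp add: split_beta'\<close>)
  have a_eq: "?a n x = ennreal (1 / n) * (\<Sum>k<n. \<integral>\<^sup>+\<tau>. ennreal (g (orbit S \<tau> k x)) \<partial>path_measure S x)" for n x
  proof -
    have om: "(\<lambda>\<tau>. ennreal (g (orbit S \<tau> k x))) \<in> borel_measurable (path_measure S x)" for k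
      by (rule measurable_path_cong[OF measurable_orbit_finite]) simp
    have "?a n x = (\<integral>\<^sup>+\<tau>. ennreal (1 / n) * (\<Sum>k<n. ennreal (g (orbit S \<tau> k x))) \<partial>path_measure S x)"
    proof (rule nn_integral_cong)
      fix \<tau>
      have "(\<Sum>k<n. ennreal (g (orbit S \<tau> k x))) = ennreal (birk ?h n x \<tau>)"
        unfolding birk_def by (rule sum_ennreal) (rule g01)
      then show "ennreal (birk ?h n x \<tau> / n) = ennreal (1 / n) * (\<Sum>k<n. ennreal (g (orbit S \<tau> k x)))"
        by (simp add: ennreal_mult'[symmetric])
    qed
    also have "\<dots> = ennreal (1 / n) * (\<integral>\<^sup>+\<tau>. (\<Sum>k<n. ennreal (g (orbit S \<tau> k x))) \<partial>path_measure S x)"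
      by (rule nn_integral_cmult) (intro borel_measurable_sum om)
    also have "(\<integral>\<^sup>+\<tau>. (\<Sum>k<n. ennreal (g (orbit S \<tau> k x))) \<partial>path_measure S x) = (\<Sum>k<n. \<integral>\<^sup>+\<tau>. ennreal (g (orbit S \<tau> k x)) \<partial>path_measure S x)"
      by (rule nn_integral_sum) (rule om)
    finally show ?thesis .
  qed
  have am: "?a n \<in> borel_measurable \<nu>" for n
    unfolding a_eq using gk by (simp cong: measurable_cong_sets)
  have "(adj_op S ^^ k) \<nu> = \<nu>" for k by (induction k) (simp_all add: inv)
  then have each: "(\<integral>\<^sup>+x. (\<integral>\<^sup>+\<tau>. ennreal (g (orbit S \<tau> k x)) \<partial>path_measure S x) \<partial>\<nu>) = (\<integral>\<^sup>+x. ennreal (g x) \<partial>\<nu>)" for k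
    using nn_integral_adj_op_iterate[OF s\<nu>, of "\<lambda>x. ennreal (g x)" k] by simp
  have avg: "(\<integral>\<^sup>+x. ?a n x \<partial>\<nu>) = (\<integral>\<^sup>+x. ennreal (g x) \<partial>\<nu>)" if n: "1 \<le> n" for n :: nat
  proof -
    have "(\<integral>\<^sup>+x. ?a n x \<partial>\<nu>) = ennreal (1 / n) * (\<Sum>k<n. \<integral>\<^sup>+x. (\<integral>\<^sup>+\<tau>. ennreal (g (orbit S \<tau> k x)) \<partial>path_measure S x) \<partial>\<nu>)"
      unfolding a_eq using gk by (simp add: nn_integral_cmult nn_integral_sum cong: measurable_cong_sets)
    also have "\<dots> = (ennreal (1 / n) * ennreal n) * (\<integral>\<^sup>+x. ennreal (g x) \<partial>\<nu>)"
      unfolding each by (simp add: mult.assoc ennreal_of_nat_eq_real_of_nat)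
    also have "ennreal (1 / n) * ennreal n = 1" using n by (simp add: ennreal_mult'[symmetric])
    finally show ?thesis by simp
  qed
  have AEc: "AE x in \<nu>. x \<in> class_cell S c"
    using \<nu>(2) nu.prob_eq_1[of "class_cell S c"] by (simp add: nu.emeasure_eq_measure s\<nu>)
  have "(\<lambda>n. \<integral>\<^sup>+x. ?a n x \<partial>\<nu>) \<longlonglongrightarrow> (\<integral>\<^sup>+x. ennreal ?I \<partial>\<nu>)"
  proof (rule nn_integral_dominated_convergence[where w="\<lambda>_. 1"])
    show "AE x in \<nu>. ?a n x \<le> 1" for n
    proof (rule AE_I2)
      fix x
      have "?a n x \<le> (\<integral>\<^sup>+\<tau>. 1 \<partial>path_measure S x)" using b01 by (intro nn_integral_mono) (simp add: ennreal_le_1)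
      then show "?a n x \<le> 1" by (simp add: path.emeasure_space_1)
    qed
    show "AE x in \<nu>. (\<lambda>n. ?a n x) \<longlonglongrightarrow> ennreal ?I" using AEc by eventually_elim (rule lim)
  qed (auto simp: nu.emeasure_space_1 am)
  moreover have "(\<lambda>n. \<integral>\<^sup>+x. ?a n x \<partial>\<nu>) \<longlonglongrightarrow> (\<integral>\<^sup>+x. ennreal (g x) \<partial>\<nu>)"
    by (rule tendsto_eventually) (use avg in \<open>auto intro: eventually_sequentiallyI[of 1]\<close>)
  ultimately have "(\<integral>\<^sup>+x. ennreal (g x) \<partial>\<nu>) = (\<integral>\<^sup>+x. ennreal ?I \<partial>\<nu>)" by (rule LIMSEQ_unique[rotated])
  then show ?thesis by (simp add: nu.emeasure_space_1)
qed

lemma emeasure_coded_class: "emeasure (coded S b z M) (class_cell S c) = 1"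
  using AE_c sets_F_vimage[OF sets_class_cell, of c]
  by (simp add: emeasure_coded emeasure_eq_measure prob_eq_1)

text \<open>The functions \<open>max 0 (1 - real m * infdist x D)\<close> have Lipschitz constant m
  and converge to the indicator of the closed set D. Their integrals agree for both measures, and
  closed sets generate the Borel sets.\<close>

lemma invariant_unique:
  assumes \<nu>: "\<nu> \<in> invariant_measures S" "emeasure \<nu> (class_cell S c) = 1"
  shows "\<nu> = coded S b z M"
proof -
  have s\<nu>: "sets \<nu> = sets borel" and p\<nu>: "prob_space \<nu>" using \<nu>(1) unfolding invariant_measures_def by auto
  interpret nu: prob_space \<nu> by (rule p\<nu>)
  have spn: "space \<nu> = UNIV" using sets_eq_imp_space_eq[OF s\<nu>] by simp
  have approx: "(\<lambda>m. \<integral>\<^sup>+x. ennreal (max 0 (1 - real m * infdist x D)) \<partial>\<kappa>) \<longlonglongrightarrow> emeasure \<kappa> D"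
    if D: "closed D" "D \<noteq> {}" and \<kappa>: "sets \<kappa> = sets borel" "prob_space \<kappa>" for D and \<kappa> :: "'k measure"
  proof -
    interpret kap: prob_space \<kappa> by (rule \<kappa>(2))
    have "(\<lambda>m. \<integral>\<^sup>+x. ennreal (max 0 (1 - real m * infdist x D)) \<partial>\<kappa>) \<longlonglongrightarrow> (\<integral>\<^sup>+x. indicator D x \<partial>\<kappa>)"
    proof (rule nn_integral_dominated_convergence[where w="\<lambda>_. 1"])
      have "(\<lambda>x. infdist x D) \<in> borel_measurable borel" by (intro borel_measurable_continuous_onI continuous_intros)
      then show "(\<lambda>x. ennreal (max 0 (1 - real m * infdist x D))) \<in> borel_measurable \<kappa>" for m
        using \<kappa>(1) by (simp cong: measurable_cong_sets)
      show "AE x in \<kappa>. ennreal (max 0 (1 - real m * infdist x D)) \<le> 1" for m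
        by (rule AE_I2) (auto simp: ennreal_le_1 infdist_nonneg)
      show "AE x in \<kappa>. (\<lambda>m. ennreal (max 0 (1 - real m * infdist x D))) \<longlonglongrightarrow> indicator D x"
      proof (rule AE_I2)
        fix x
        show "(\<lambda>m. ennreal (max 0 (1 - real m * infdist x D))) \<longlonglongrightarrow> indicator D x"
        proof (cases "x \<in> D")
          case False
          then have pos: "0 < infdist x D" using D infdist_pos_not_in_closed by blast
          obtain N :: nat where N: "1 / infdist x D \<le> real N" using real_arch_simple by blast
          have "max 0 (1 - real m * infdist x D) = 0" if "N \<le> m" for m
          proof -
            have "1 / infdist x D \<le> real m" using N that by linarith
            then show ?thesis using pos by (simp add: field_simps)
          qed
          then show ?thesis using False by (intro tendsto_eventually eventually_sequentiallyI[of N]) simp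
        qed simp
      qed
      show "indicator D \<in> borel_measurable \<kappa>" by (rule borel_measurable_indicator) (use D \<kappa>(1) in \<open>simp add: borel_closed\<close>)
    qed (auto simp: kap.emeasure_space_1)
    then show ?thesis using D \<kappa>(1) by (simp add: borel_closed)
  qed
  have pM: "prob_space (coded S b z M)" using coded_invariant unfolding invariant_measures_def by blast
  have closed: "emeasure \<nu> D = emeasure (coded S b z M) D" if D: "closed D" for D
  \<comment> \<open>\<open>infdist\<close> to the empty set is 0 by convention, so the approximation
    is used for nonempty D.\<close>
  proof (cases "D = {}")
    case False
    have "(\<integral>\<^sup>+x. ennreal (max 0 (1 - real m * infdist x D)) \<partial>\<nu>) = (\<integral>\<^sup>+x. ennreal (max 0 (1 - real m * infdist x D)) \<partial>coded S b z M)" for m :: nat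
    proof -
      let ?g = "\<lambda>x. max 0 (1 - real m * infdist x D)"
      have "(\<lambda>x. infdist x D) \<in> borel_measurable borel" by (intro borel_measurable_continuous_onI continuous_intros)
      then have g: "?g \<in> borel_measurable borel" by measurable
      have g01: "0 \<le> ?g x" "?g x \<le> 1" for x by (auto simp: infdist_nonneg)
      have "\<bar>?g u - ?g v\<bar> \<le> real m * dist u v" for u v
      proof -
        have "\<bar>?g u - ?g v\<bar> \<le> \<bar>real m * infdist v D - real m * infdist u D\<bar>" by (auto simp: max_def)
        also have "\<dots> = real m * \<bar>infdist v D - infdist u D\<bar>" by (simp add: abs_mult right_diff_distrib[symmetric])
        also have "\<dots> \<le> real m * dist u v" using infdist_triangle_abs[of v D u] by (intro mult_left_mono) (auto simp: dist_commute)
        finally show ?thesis .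
      qed
      then have same: "same_averages (\<lambda>_. ?g)" by (rule same_averages_Lipschitz[OF ctr]) simp
      show ?thesis
        using nn_integral_invariant[OF \<nu> g g01 same] nn_integral_invariant[OF coded_invariant emeasure_coded_class g g01 same] by simp
    qed
    then show ?thesis using approx[OF D False s\<nu> p\<nu>] approx[OF D False sets_coded pM] LIMSEQ_unique by simp
  qed simp
  show ?thesis
  proof (rule measure_eqI_generator_eq[where E="Collect closed" and \<Omega>=UNIV and A="\<lambda>_. UNIV"])
    show "Int_stable (Collect closed :: 'k set set)" by (auto simp: Int_stable_def)
    show "sets \<nu> = sigma_sets UNIV (Collect closed)" "sets (coded S b z M) = sigma_sets UNIV (Collect closed)"
      using s\<nu> by (simp_all add: borel_eq_closed)
    show "emeasure \<nu> UNIV \<noteq> \<infinity>" by (simp add: nu.emeasure_eq_measure)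
  qed (use closed in auto)
qed

lemma equilibrium_unique:
  assumes \<Lambda>: "\<Lambda> \<in> equilibrium_states S b z" "emeasure (coded S b z \<Lambda>) (class_cell S c) = 1"
  shows "\<Lambda> = M"
proof -
  interpret L: equilibrium S b z \<Lambda> by unfold_locales (rule \<Lambda>)
  show ?thesis by (rule equilibrium_eqI[OF \<Lambda>(1) invariant_unique[OF L.coded_invariant \<Lambda>(2)]])
qed

subsection \<open>Generating points\<close>

text \<open>By the strong law for cell indicators the occupation measures converge at every vertex
  to the image of M on the vertices. The limit is a probability measure, so no mass escapes and the
  sequence is tight.\<close>

lemma class_generating:
  assumes x: "x \<in> class_cell S c"
  shows "generating_point S x"
proof -
  define p where "p n j = ennreal (1 / real n) * (\<Sum>k=1..n. emeasure ((adj_op S ^^ k) (return borel x)) (cell S j))" for n j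
  have occ: "occupation S x n = point_measure UNIV (p n)" for n
    unfolding occupation_def p_def ..
  have law: "emeasure ((adj_op S ^^ k) (return borel x)) (cell S j) = (\<integral>\<^sup>+\<tau>. indicator (cell S j) (orbit S \<tau> k x) \<partial>path_measure S x)" for k j
  proof -
    have gm: "(\<lambda>y. \<integral>\<^sup>+\<tau>. indicator (cell S j) (orbit S \<tau> k y) \<partial>path_measure S y) \<in> borel_measurable borel"
      by (rule measurable_path_nn_integral) (use measurable_compose[OF measurable_orbit_pair, of "indicator (cell S j)"] in \<open>simp add: split_beta'\<close>)
    have "sets ((adj_op S ^^ k) (return borel x)) = sets borel" by (cases k) auto
    then have "emeasure ((adj_op S ^^ k) (return borel x)) (cell S j) = (\<integral>\<^sup>+y. indicator (cell S j) y \<partial>(adj_op S ^^ k) (return borel x))"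
      by (subst nn_integral_indicator) auto
    also have "\<dots> = (\<integral>\<^sup>+y. (\<integral>\<^sup>+\<tau>. indicator (cell S j) (orbit S \<tau> k y) \<partial>path_measure S y) \<partial>return borel x)"
      by (rule nn_integral_adj_op_iterate) auto
    also have "\<dots> = (\<integral>\<^sup>+\<tau>. indicator (cell S j) (orbit S \<tau> k x) \<partial>path_measure S x)"
      by (rule nn_integral_return[OF _ gm]) simp
    finally show ?thesis .
  qed
  have om: "(\<lambda>\<tau>. indicator (cell S j) (orbit S \<tau> k x) :: ennreal) \<in> borel_measurable (path_measure S x)" for j k
    by (rule measurable_path_cong[OF measurable_orbit_finite]) simp
  let ?h = "\<lambda>j (_::'e option). indicator (cell S j) :: 'k \<Rightarrow> real"
  \<comment> \<open>Occupation counts times 1..n, Birkhoff sums count from time 0; so the initial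
    term is removed from the sum of length \<open>Suc n\<close>.\<close>
  have p_eq: "p n j = (\<integral>\<^sup>+\<tau>. ennreal ((birk (?h j) (Suc n) x \<tau> - indicator (cell S j) x) / n) \<partial>path_measure S x)" for n j
  proof -
    have "p n j = (\<integral>\<^sup>+\<tau>. ennreal (1 / n) * (\<Sum>k=1..n. indicator (cell S j) (orbit S \<tau> k x)) \<partial>path_measure S x)"
      unfolding p_def law using om by (simp add: nn_integral_cmult nn_integral_sum)
    also have "\<dots> = (\<integral>\<^sup>+\<tau>. ennreal ((birk (?h j) (Suc n) x \<tau> - indicator (cell S j) x) / n) \<partial>path_measure S x)"
    proof (rule nn_integral_cong)
      fix \<tau>
      have "birk (?h j) (Suc n) x \<tau> = indicator (cell S j) x + (\<Sum>k<n. indicator (cell S j) (orbit S \<tau> (Suc k) x))"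
        unfolding birk_def by (subst sum.lessThan_Suc_shift) simp
      moreover have "(\<Sum>k<n. indicator (cell S j) (orbit S \<tau> (Suc k) x)) = (\<Sum>k=1..n. indicator (cell S j) (orbit S \<tau> k x) :: real)"
        by (rule sum.reindex_bij_witness[of _ "\<lambda>k. k - 1" Suc]) auto
      moreover have "(\<Sum>k=1..n. indicator (cell S j) (orbit S \<tau> k x) :: ennreal) = ennreal (\<Sum>k=1..n. indicator (cell S j) (orbit S \<tau> k x))"
        by (subst sum_ennreal[symmetric]) (auto simp: ennreal_indicator)
      ultimately show "ennreal (1 / n) * (\<Sum>k=1..n. indicator (cell S j) (orbit S \<tau> k x))
        = ennreal ((birk (?h j) (Suc n) x \<tau> - indicator (cell S j) x) / n)"
        by (simp add: ennreal_mult'[symmetric])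
    qed
    finally show ?thesis .
  qed
  have p_lim: "(\<lambda>n. p n j) \<longlonglongrightarrow> emeasure M (F -` cell S j)" for j
  proof -
    have int: "integrable M (\<lambda>\<sigma>. indicator (cell S j) (F \<sigma>) :: real)"
      by (intro integrable_const_bound[where B=1]) (auto split: split_indicator)
    have I: "(\<integral>\<sigma>. indicator (cell S j) (F \<sigma>) \<partial>M) = measure M (F -` cell S j)"
    proof -
      have "(\<lambda>\<sigma>. indicator (cell S j) (F \<sigma>)) = (indicator (F -` cell S j) :: _ \<Rightarrow> real)" by (auto split: split_indicator)
      then show ?thesis using sets_F_vimage[OF sets_cell, of j] by simp
    qed
    have "(\<lambda>n. p n j) \<longlonglongrightarrow> (\<integral>\<^sup>+\<tau>. ennreal (measure M (F -` cell S j)) \<partial>path_measure S x)"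
      unfolding p_eq
    proof (rule nn_integral_dominated_convergence[where w="\<lambda>_. 1"])
      show "(\<lambda>\<tau>. ennreal ((birk (?h j) (Suc n) x \<tau> - indicator (cell S j) x) / n)) \<in> borel_measurable (path_measure S x)" for n
        by (rule measurable_path_cong) measurable
      show "AE \<tau> in path_measure S x. ennreal ((birk (?h j) (Suc n) x \<tau> - indicator (cell S j) x) / n) \<le> 1" for n
      proof (rule AE_I2)
        fix \<tau>
        have "birk (?h j) (Suc n) x \<tau> - indicator (cell S j) x = (\<Sum>k<n. indicator (cell S j) (orbit S \<tau> (Suc k) x))"
          unfolding birk_def by (subst sum.lessThan_Suc_shift) simp
        also have "\<dots> \<le> real n"
          using sum_bounded_above[of "{..<n}" "\<lambda>k. indicator (cell S j) (orbit S \<tau> (Suc k) x) :: real" 1] by (simp add: indicator_le_1 del: orbit.simps)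
        finally show "ennreal ((birk (?h j) (Suc n) x \<tau> - indicator (cell S j) x) / n) \<le> 1"
          by (cases "n = 0") (auto simp: ennreal_le_1 divide_le_eq_1)
      qed
      have "AE \<tau> in path_measure S x. (\<lambda>n. birk (?h j) n x \<tau> / n) \<longlonglongrightarrow> measure M (F -` cell S j)"
        using strong_law[OF _ _ same_averages_indicator_cell[of j] x] int unfolding I by simp
      then show "AE \<tau> in path_measure S x. (\<lambda>n. ennreal ((birk (?h j) (Suc n) x \<tau> - indicator (cell S j) x) / n))
          \<longlonglongrightarrow> ennreal (measure M (F -` cell S j))"
        by eventually_elim (intro tendsto_ennrealI averages_drop_first)
    qed (auto simp: path.emeasure_space_1)
    then show ?thesis by (simp add: path.emeasure_space_1 emeasure_eq_measure)
  qed
  have one: "(\<integral>\<^sup>+j. indicator (cell S j) y \<partial>count_space UNIV) = (1::ennreal)" for y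
  proof -
    obtain i where i: "y \<in> cell S i" using ex_cell by blast
    have "(\<integral>\<^sup>+j. indicator (cell S j) y \<partial>count_space UNIV) = (\<integral>\<^sup>+j. indicator {i} j \<partial>count_space UNIV)"
      using i cell_unique by (intro nn_integral_cong) (auto split: split_indicator)
    then show ?thesis by simp
  qed
  have prob_occ: "prob_space (occupation S x n)" if n: "1 \<le> n" for n
  proof (rule prob_spaceI)
    have "emeasure (occupation S x n) UNIV = (\<integral>\<^sup>+j. p n j \<partial>count_space UNIV)"
      unfolding occ point_measure_def by (subst emeasure_density) auto
    also have "\<dots> = ennreal (1 / n) * (\<Sum>k=1..n. (\<integral>\<^sup>+j. (\<integral>\<^sup>+\<tau>. indicator (cell S j) (orbit S \<tau> k x) \<partial>path_measure S x) \<partial>count_space UNIV))"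
      unfolding p_def law by (simp add: nn_integral_cmult nn_integral_sum)
    also have "(\<lambda>k. \<integral>\<^sup>+j. (\<integral>\<^sup>+\<tau>. indicator (cell S j) (orbit S \<tau> k x) \<partial>path_measure S x) \<partial>count_space UNIV) = (\<lambda>_. 1)"
    proof
      fix k
      have "(\<integral>\<^sup>+j. (\<integral>\<^sup>+\<tau>. indicator (cell S j) (orbit S \<tau> k x) \<partial>path_measure S x) \<partial>count_space UNIV)
        = (\<integral>\<^sup>+\<tau>. (\<integral>\<^sup>+j. indicator (cell S j) (orbit S \<tau> k x) \<partial>count_space UNIV) \<partial>path_measure S x)"
        by (rule nn_integral_count_space_nn_integral[symmetric]) (auto intro: countable_vertices om)
      then show "(\<integral>\<^sup>+j. (\<integral>\<^sup>+\<tau>. indicator (cell S j) (orbit S \<tau> k x) \<partial>path_measure S x) \<partial>count_space UNIV) = 1"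
        by (simp add: one path.emeasure_space_1)
    qed
    also have "ennreal (1 / n) * (\<Sum>k=1..n. 1) = 1"
      using n by (simp add: ennreal_of_nat_eq_real_of_nat ennreal_mult'[symmetric])
    finally show "emeasure (occupation S x n) (space (occupation S x n)) = 1" by (simp add: occ space_point_measure)
  qed
  have sets_occ: "sets (occupation S x n) = UNIV" for n by (simp add: occ sets_point_measure)
  define q where "q = point_measure UNIV (\<lambda>j. emeasure M (F -` cell S j))"
  have sets_q: "sets q = UNIV" by (simp add: q_def sets_point_measure)
  have prob_q: "prob_space q"
  proof (rule prob_spaceI)
    have "emeasure q UNIV = (\<integral>\<^sup>+j. emeasure M (F -` cell S j) \<partial>count_space UNIV)"
      unfolding q_def point_measure_def by (subst emeasure_density) auto
    also have "\<dots> = emeasure M (\<Union>j. F -` cell S j)"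
      using sets_F_vimage[OF sets_cell] disjoint_cells
      by (intro emeasure_UN_countable[symmetric] countable_vertices) (auto simp: disjoint_family_on_def)
    also have "(\<Union>j. F -` cell S j) = space M" using ex_cell by auto
    finally show "emeasure q (space q) = 1" using emeasure_space_1 by (simp add: q_def space_point_measure)
  qed
  show ?thesis unfolding generating_point_def
  proof (intro allI impI)
    fix \<epsilon> :: real assume \<epsilon>: "0 < \<epsilon>"
    \<comment> \<open>A finite set carrying more than 1 - \<epsilon> of the limit measure.\<close>
    obtain V0 where V0: "finite V0" "1 - \<epsilon> < measure q V0"
      using prob_space_finite_approx[OF prob_q countable_vertices sets_q \<epsilon>] by blast
    have sum_q: "measure q V0 = (\<Sum>j\<in>V0. measure M (F -` cell S j))"
      unfolding measure_def q_def using V0(1)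
      by (simp add: emeasure_point_measure_finite2 emeasure_eq_measure sum_ennreal sum_nonneg)
    have "(\<lambda>n. \<Sum>j\<in>V0. p n j) \<longlonglongrightarrow> (\<Sum>j\<in>V0. emeasure M (F -` cell S j))" by (intro tendsto_sum p_lim)
    moreover have "(\<Sum>j\<in>V0. emeasure M (F -` cell S j)) = ennreal (measure q V0)"
      unfolding sum_q by (simp add: emeasure_eq_measure sum_ennreal)
    \<comment> \<open>\<open>ennreal\<close> maps negative numbers to 0, so the case \<epsilon> > 1
      is carried along as a separate disjunct.\<close>
    moreover have "ennreal (1 - \<epsilon>) < ennreal (measure q V0) \<or> 1 - \<epsilon> < 0"
      using V0(2) by (cases "1 - \<epsilon> < 0") (auto simp: ennreal_less_iff)
    ultimately have ev: "\<forall>\<^sub>F n in sequentially. 1 - \<epsilon> < 0 \<or> ennreal (1 - \<epsilon>) < (\<Sum>j\<in>V0. p n j)"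
      using order_tendstoD(1)[of "\<lambda>n. \<Sum>j\<in>V0. p n j" _ sequentially "ennreal (1 - \<epsilon>)"] by (auto elim: eventually_mono)
    have sum_occ: "ennreal (measure (occupation S x n) V0) = (\<Sum>j\<in>V0. p n j)" if n: "1 \<le> n" for n
    proof -
      interpret o: prob_space "occupation S x n" by (rule prob_occ[OF n])
      have "ennreal (o.prob V0) = emeasure (occupation S x n) V0" by (simp add: o.emeasure_eq_measure)
      also have "\<dots> = (\<Sum>j\<in>V0. p n j)" unfolding occ using V0(1) by (simp add: emeasure_point_measure_finite2)
      finally show ?thesis .
    qed
    obtain N where N: "\<And>n. N \<le> n \<Longrightarrow> 1 - \<epsilon> < 0 \<or> ennreal (1 - \<epsilon>) < (\<Sum>j\<in>V0. p n j)"
      using ev unfolding eventually_sequentially by blast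
    have large: "1 - \<epsilon> < measure (occupation S x n) V0 \<or> 1 - \<epsilon> < 0" if "N \<le> n" "1 \<le> n" for n
      using N[OF that(1)] sum_occ[OF that(2)] by (metis ennreal_less_iff ennreal_lessI not_less)
    have "\<exists>V. finite V \<and> 1 - \<epsilon> < measure (occupation S x n) V" if "1 \<le> n" for n
      by (rule prob_space_finite_approx[OF prob_occ[OF that] countable_vertices sets_occ \<epsilon>])
    then obtain W where W: "\<And>n. 1 \<le> n \<Longrightarrow> finite (W n) \<and> 1 - \<epsilon> < measure (occupation S x n) (W n)" by metis
    \<comment> \<open>After time N the set \<open>V0\<close> suffices; each of the finitely many
      times up to N contributes a finite set of its own.\<close>
    let ?V = "V0 \<union> (\<Union>n\<in>{1..N}. W n)"
    show "\<exists>V. finite V \<and> (\<forall>n\<ge>1. emeasure (occupation S x n) (UNIV - V) < ennreal \<epsilon>)"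
    proof (intro exI[of _ ?V] conjI allI impI)
      show "finite ?V" using V0(1) W by auto
      fix n :: nat assume n: "1 \<le> n"
      interpret o: prob_space "occupation S x n" by (rule prob_occ[OF n])
      have spo: "space (occupation S x n) = UNIV" by (simp add: occ space_point_measure)
      have "1 - \<epsilon> < o.prob ?V"
      proof (cases "n \<le> N")
        case True
        have "o.prob (W n) \<le> o.prob ?V" using True n by (intro o.finite_measure_mono) (auto simp: sets_occ)
        then show ?thesis using W[OF n] by linarith
      next
        case False
        have "o.prob V0 \<le> o.prob ?V" by (intro o.finite_measure_mono) (auto simp: sets_occ)
        moreover have "0 \<le> o.prob ?V" by simp
        moreover have "1 - \<epsilon> < o.prob V0 \<or> 1 - \<epsilon> < 0" by (rule large) (use False n in auto)
        ultimately show ?thesis by linarith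
      qed
      moreover have "o.prob (UNIV - ?V) = 1 - o.prob ?V" using o.prob_compl[of ?V] by (simp add: spo sets_occ)
      ultimately show "emeasure (occupation S x n) (UNIV - ?V) < ennreal \<epsilon>"
        unfolding o.emeasure_eq_measure by (intro ennreal_lessI \<epsilon>) simp
    qed
  qed
qed

end

end

subsection \<open>The ergodic decomposition\<close>

lemma countable_comm_classes: "countable (UNIV :: 'n set) \<Longrightarrow> countable (comm_classes (S :: ('k, 'e, 'n) markov))"
  unfolding comm_classes_def quotient_def
  using countable_subset[OF subset_UNIV] by (intro countable_UN) auto

text \<open>The supported classes cover almost everything and are disjoint. Under M conditioned on
  one class, ergodicity makes \<open>Q\<close> trivial, so \<open>B\<close> and \<open>Q\<close> are
  independent there and the mass factorises class by class.\<close>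

lemma (in ac_equilibrium) ergodic_decomposition:
  defines "\<Lambda> \<equiv> \<lambda>c. uniform_measure M (F -` class_cell S c)"
  assumes B: "B \<in> sets codes" and Q: "Q \<in> invariant_sets M"
  shows "emeasure M (B \<inter> Q) =
    (\<Sum>\<^sub>\<infinity>c\<in>supported_classes S b z M. emeasure M (F -` class_cell S c \<inter> Q) * emeasure (\<Lambda> c) B)"
proof -
  let ?I = "supported_classes S b z M" and ?A = "\<lambda>c. F -` class_cell S c"
  have cI: "countable ?I"
    by (rule countable_subset[OF _ countable_comm_classes[OF countable_vertices]]) (auto simp: supported_iff)
  have Qc: "Q \<in> sets M" using invariant_setsD(1)[OF Q] by simp
  have BM: "B \<in> sets M" using B by simp
  have A: "?A c \<in> sets M" for c using sets_F_vimage[OF sets_class_cell, of c] by simp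
  have "emeasure M (B \<inter> Q) = emeasure M (\<Union>c\<in>?I. ?A c \<inter> (B \<inter> Q))"
  proof (rule emeasure_eq_AE)
    show "AE \<sigma> in M. \<sigma> \<in> B \<inter> Q \<longleftrightarrow> \<sigma> \<in> (\<Union>c\<in>?I. ?A c \<inter> (B \<inter> Q))"
      using AE_supported by eventually_elim auto
    show "B \<inter> Q \<in> events" by (rule sets.Int[OF BM Qc])
    show "(\<Union>c\<in>?I. ?A c \<inter> (B \<inter> Q)) \<in> events"
      using sets.Int[OF A sets.Int[OF BM Qc]] by (intro sets.countable_UN'[OF cI]) blast
  qed
  also have "\<dots> = (\<integral>\<^sup>+c. emeasure M (?A c \<inter> (B \<inter> Q)) \<partial>count_space ?I)"
  proof (rule emeasure_UN_countable[OF _ cI])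
    show "?A c \<inter> (B \<inter> Q) \<in> events" for c by (rule sets.Int[OF A sets.Int[OF BM Qc]])
    show "disjoint_family_on (\<lambda>c. ?A c \<inter> (B \<inter> Q)) ?I"
      unfolding disjoint_family_on_def using class_cell_unique[OF msys] supported_iff by blast
  qed
  also have "\<dots> = (\<integral>\<^sup>+c. emeasure M (?A c \<inter> Q) * emeasure (\<Lambda> c) B \<partial>count_space ?I)"
  proof (rule nn_integral_cong)
    fix c assume "c \<in> space (count_space ?I)"
    then have c: "c \<in> ?I" by simp
    have cc: "c \<in> comm_classes S" using c supported_iff by blast
    have pos: "emeasure M (?A c) \<noteq> 0" "emeasure M (?A c) \<noteq> \<infinity>" using c supported_iff by (auto simp: emeasure_eq_measure)
    interpret L: ac_equilibrium S b z "\<Lambda> c" a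
      by unfold_locales (use conditioned_equilibrium(1)[OF c] ctr ac in \<open>simp_all add: \<Lambda>_def\<close>)
    have AEL: "AE \<sigma> in \<Lambda> c. F \<sigma> \<in> class_cell S c" unfolding \<Lambda>_def by (rule conditioned_equilibrium(2)[OF c])
    have em: "emeasure M (?A c) * emeasure (\<Lambda> c) X = emeasure M (?A c \<inter> X)" if "X \<in> sets M" for X
    proof -
      have "emeasure (\<Lambda> c) X = emeasure M (?A c \<inter> X) / emeasure M (?A c)"
        unfolding \<Lambda>_def by (rule emeasure_uniform_measure[OF A that])
      then show ?thesis using pos by (simp add: ennreal_times_divide mult.commute[of "emeasure M (?A c)"] mult_divide_eq_ennreal)
    qed
    have "Q \<in> invariant_sets (\<Lambda> c)"
    proof (rule L.invariant_setsI)
      show "Q \<in> sets codes" using Qc by simp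
      show "AE \<sigma> in \<Lambda> c. shift \<sigma> \<in> Q \<longleftrightarrow> \<sigma> \<in> Q"
        unfolding \<Lambda>_def by (rule AE_uniform_measureI[OF A]) (use invariant_setsD(2)[OF Q] in \<open>auto elim: eventually_mono\<close>)
    qed
    then consider "emeasure (\<Lambda> c) Q = 0" | "emeasure (\<Lambda> c) Q = 1"
      using L.ergodic_of_class[OF cc AEL] unfolding ergodic_def by blast
    then show "emeasure M (?A c \<inter> (B \<inter> Q)) = emeasure M (?A c \<inter> Q) * emeasure (\<Lambda> c) B"
    proof cases
      case 1
      then have "emeasure M (?A c \<inter> Q) = 0" using em[OF Qc] by simp
      moreover from this have "emeasure M (?A c \<inter> (B \<inter> Q)) = 0"
        using emeasure_mono[of "?A c \<inter> (B \<inter> Q)" "?A c \<inter> Q" M] sets.Int[OF A Qc] by auto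
      ultimately show ?thesis by simp
    next
      case 2
      then have "AE \<sigma> in \<Lambda> c. \<sigma> \<in> Q" using Qc by (simp add: L.emeasure_eq_measure L.prob_eq_1)
      then have "emeasure (\<Lambda> c) (B \<inter> Q) = emeasure (\<Lambda> c) B"
        using BM sets.Int[OF BM Qc] by (intro emeasure_eq_AE) (auto elim: eventually_mono)
      then show ?thesis using em[OF Qc] em[OF BM] em[OF sets.Int[OF BM Qc]] 2 by simp
    qed
  qed
  also have "\<dots> = (\<Sum>\<^sub>\<infinity>c\<in>?I. emeasure M (?A c \<inter> Q) * emeasure (\<Lambda> c) B)"
    by (rule infsum_ennreal_eq_nn_integral[OF cI, symmetric])
  finally show ?thesis .
qed

text \<open>Adapts \<open>strong_law\<close> to the averages of the theorem: K gives integrability,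
  the limit becomes a sum over edges, and the sum starts at time 1.\<close>

lemma (in ac_equilibrium) strong_law_limit:
  assumes c: "c \<in> comm_classes S" and AE_c: "AE \<sigma> in M. F \<sigma> \<in> class_cell S c"
    and fm: "\<And>e. f e \<in> borel_measurable borel" and f0: "\<And>e x. 0 \<le> f e x"
    and same: "same_averages (fun_ext f)"
    and bound: "\<And>x. (\<integral>\<^sup>+e. ennreal (wgt S e x * f e x) \<partial>count_space UNIV) \<le> ennreal K"
    and x: "x \<in> class_cell S c"
  shows "AE \<tau> in path_measure S x.
    (\<lambda>n. ennreal ((1 / real n) * (\<Sum>k=1..n. fun_ext f (\<tau> (k + 1)) (orbit S \<tau> k x))))
      \<longlonglongrightarrow> (\<Sum>\<^sub>\<infinity>e. \<integral>\<^sup>+y\<in>cell S (src S e). ennreal (wgt S e y * f e y) \<partial>coded S b z M)"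
proof -
  let ?\<psi> = "\<lambda>\<sigma>. fun_ext f (\<sigma> 1) (F \<sigma>)"
  have hm: "fun_ext f d \<in> borel_measurable borel" for d using fm by (cases d) auto
  have h0: "0 \<le> fun_ext f d x" for d x using f0 by (cases d) auto
  have "?\<psi> \<in> borel_measurable codes"
    by (rule measurable_compose_countable[of "\<lambda>d \<sigma>. fun_ext f d (F \<sigma>)"]) (auto intro: measurable_compose[OF measurable_F hm])
  then have \<psi>m: "?\<psi> \<in> borel_measurable M" by (simp cong: measurable_cong_sets)
  have "(\<integral>\<^sup>+\<sigma>. ennreal (?\<psi> \<sigma>) \<partial>M) \<le> (\<integral>\<^sup>+\<sigma>. ennreal K \<partial>M)"
    unfolding nn_integral_letter(2)[OF fm f0] by (intro nn_integral_mono bound)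
  also have "\<dots> < \<infinity>" by (simp add: emeasure_space_1[unfolded space_M])
  finally have int: "integrable M ?\<psi>" using \<psi>m h0 by (intro integrableI_nonneg) auto
  have I: "ennreal (\<integral>\<sigma>. ?\<psi> \<sigma> \<partial>M) = (\<Sum>\<^sub>\<infinity>e. \<integral>\<^sup>+y\<in>cell S (src S e). ennreal (wgt S e y * f e y) \<partial>coded S b z M)"
    unfolding nn_integral_letter(1)[OF fm f0, symmetric] using int h0 by (intro nn_integral_eq_integral[symmetric]) auto
  show ?thesis
    using strong_law[OF c AE_c hm int same x]
  proof eventually_elim
    case (elim \<tau>)
    have "(\<Sum>k=1..n. fun_ext f (\<tau> (k + 1)) (orbit S \<tau> k x)) = birk (fun_ext f) (Suc n) x \<tau> - fun_ext f (\<tau> 1) x" for n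
    proof -
      have "birk (fun_ext f) (Suc n) x \<tau> = fun_ext f (\<tau> 1) x + (\<Sum>k<n. fun_ext f (\<tau> (Suc (Suc k))) (orbit S \<tau> (Suc k) x))"
        unfolding birk_def by (subst sum.lessThan_Suc_shift) (simp add: One_nat_def)
      moreover have "(\<Sum>k<n. fun_ext f (\<tau> (Suc (Suc k))) (orbit S \<tau> (Suc k) x)) = (\<Sum>k=1..n. fun_ext f (\<tau> (k + 1)) (orbit S \<tau> k x))"
        by (rule sum.reindex_bij_witness[of _ "\<lambda>k. k - 1" Suc]) (auto simp: One_nat_def)
      ultimately show ?thesis by simp
    qed
    then show ?case
      unfolding I[symmetric] using averages_drop_first[OF elim] by (intro tendsto_ennrealI) simp
  qed
qed

theorem theorem4:
  fixes S :: "('k::complete_space, 'e::countable, 'n) markov"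
    and a :: real
    and b :: "'n \<Rightarrow> 'k"
    and z :: 'n
    and M :: "(int \<Rightarrow> 'e option) measure"
    and f :: "'e \<Rightarrow> 'k \<Rightarrow> real"
  assumes "markov_system S"
    and "uniformly_continuous_system S"
    and "contractive S a"
    and "absolutely_continuous_system S"
    and "\<And>i. b i \<in> cell S i"
    and "M \<in> equilibrium_states S b z"
    and "\<And>e. f e \<in> borel_measurable borel"
    and "\<And>e x. 0 \<le> f e x"
    and "((\<exists>\<alpha>. 0 < \<alpha> \<and> \<alpha> < 1 \<and>
             uniformly_continuous_along S a \<alpha> (\<lambda>x. \<Sum>\<^sub>\<infinity>e. wgt S e x * f e x)) \<and>
          (\<exists>c. \<forall>x. (\<Sum>\<^sub>\<infinity>e. ennreal (wgt S e x * (f e x)\<^sup>2)) \<le> ennreal c))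
       \<or> ((\<forall>e x. f e x = (if x \<in> cell S (src S e) then - ln (wgt S e x) else 0)) \<and>
          (\<exists>c. \<forall>x. (\<Sum>\<^sub>\<infinity>e. ennreal (- (wgt S e x * ln (wgt S e x)))) \<le> ennreal c))"
  defines "I\<^sub>M \<equiv> supported_classes S b z M"
    and "F \<equiv> coding_map S b z"
    and "C \<equiv> class_cell S"
  shows "I\<^sub>M \<noteq> {} \<and>
    (\<exists>\<Lambda> :: 'n set \<Rightarrow> (int \<Rightarrow> 'e option) measure.
       (\<forall>i\<in>I\<^sub>M.
          \<Lambda> i \<in> equilibrium_states S b z \<and> emeasure (coded S b z (\<Lambda> i)) (C i) = 1 \<and>
          (\<forall>\<Lambda>'\<in>equilibrium_states S b z. emeasure (coded S b z \<Lambda>') (C i) = 1 \<longrightarrow> \<Lambda>' = \<Lambda> i) \<and>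
          ergodic (\<Lambda> i) \<and>
          F -` C i \<in> invariant_sets M \<and>
          {\<mu> \<in> invariant_measures S. emeasure \<mu> (C i) = 1} = {coded S b z (\<Lambda> i)}) \<and>
       (\<forall>B\<in>sets (code_borel UNIV). \<forall>Q\<in>invariant_sets M.
          emeasure M (B \<inter> Q) = (\<Sum>\<^sub>\<infinity>i\<in>I\<^sub>M. emeasure M (F -` C i \<inter> Q) * emeasure (\<Lambda> i) B)) \<and>
       (\<forall>x\<in>(\<Union>i\<in>I\<^sub>M. C i).
          AE \<sigma> in path_measure S x.
            (\<lambda>n. ennreal ((1 / real n) * (\<Sum>k=1..n. fun_ext f (\<sigma> (k + 1)) (orbit S \<sigma> k x))))
              \<longlonglongrightarrow> (\<Sum>\<^sub>\<infinity>i\<in>I\<^sub>M. indicator (C i) x *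
                   (\<Sum>\<^sub>\<infinity>e. \<integral>\<^sup>+y\<in>cell S (src S e). ennreal (wgt S e y * f e y) \<partial>coded S b z (\<Lambda> i))))) \<and>
    I\<^sub>M \<subseteq> generating_classes S \<and>
    ((\<exists>c. generating_classes S = {c}) \<longrightarrow> ergodic M \<and> equilibrium_states S b z = {M})"
proof -
  interpret msys S by (rule msys.intro) fact
  interpret msys_code S b z by unfold_locales fact+
  have eqI: "ac_equilibrium S b z \<Lambda> a" if "\<Lambda> \<in> equilibrium_states S b z" for \<Lambda>
    by unfold_locales (fact that assms)+
  interpret E: ac_equilibrium S b z M a by (rule eqI) fact
  \<comment> \<open>Both cases are reduced to what the strong law uses: asymptotically equal
    averages within a cell, and a bounded conditional mean, which yields integrability.\<close>
  have "same_averages (fun_ext f) \<and> (\<exists>K. \<forall>x. (\<integral>\<^sup>+e. ennreal (wgt S e x * f e x) \<partial>count_space UNIV) \<le> ennreal K)"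
    using assms(9)
  proof (elim disjE conjE exE)
    fix \<alpha> c assume \<alpha>: "0 < \<alpha>" "\<alpha> < 1" and uc: "uniformly_continuous_along S a \<alpha> (\<lambda>x. \<Sum>\<^sub>\<infinity>e. wgt S e x * f e x)"
      and c: "\<forall>x. (\<Sum>\<^sub>\<infinity>e. ennreal (wgt S e x * (f e x)\<^sup>2)) \<le> ennreal c"
    \<comment> \<open>\<open>ennreal c\<close> is 0 for negative c, whereas the estimates of case
      (a) are stated for a nonnegative constant; hence \<open>max 0 c\<close>.\<close>
    have f2: "(\<integral>\<^sup>+e. ennreal (wgt S e x) * ennreal ((f e x)\<^sup>2) \<partial>count_space UNIV) \<le> ennreal (max 0 c)" for x
    proof -
      have "(\<integral>\<^sup>+e. ennreal (wgt S e x) * ennreal ((f e x)\<^sup>2) \<partial>count_space UNIV) = (\<Sum>\<^sub>\<infinity>e. ennreal (wgt S e x * (f e x)\<^sup>2))"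
        by (subst infsum_ennreal_eq_nn_integral) (simp_all add: ennreal_mult')
      also have "\<dots> \<le> ennreal c" using c by blast
      also have "\<dots> \<le> ennreal (max 0 c)" by (rule ennreal_leI) simp
      finally show ?thesis .
    qed
    have "same_averages (fun_ext f)"
    proof (rule same_averages_case_a[OF assms(7,8) _ f2 assms(3) \<alpha> _ assms(4)])
      have "cmean f = (\<lambda>x. \<Sum>\<^sub>\<infinity>e. wgt S e x * f e x)"
        by (rule ext, rule cmean_def[OF assms(7,8) _ f2]) simp
      then show "uniformly_continuous_along S a \<alpha> (cmean f)" using uc by simp
    qed simp
    moreover have "(\<integral>\<^sup>+e. ennreal (wgt S e x * f e x) \<partial>count_space UNIV) \<le> ennreal (1 + max 0 c)" for x
      by (rule nn_integral_wgt_f_bound[OF assms(7,8) _ f2]) simp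
    ultimately show ?thesis by blast
  next
    fix c assume f: "\<forall>e x. f e x = (if x \<in> cell S (src S e) then - ln (wgt S e x) else 0)"
      and c: "\<forall>x. (\<Sum>\<^sub>\<infinity>e. ennreal (- (wgt S e x * ln (wgt S e x)))) \<le> ennreal c"
    have "(\<integral>\<^sup>+e. ennreal (wgt S e x * f e x) \<partial>count_space UNIV) \<le> ennreal c" for x
    proof -
      \<comment> \<open>Off the source cell the weight is 0 and both sides vanish.\<close>
      have "wgt S e x * f e x = - (wgt S e x * ln (wgt S e x))" for e using f by (simp add: wgt_0)
      then have "(\<integral>\<^sup>+e. ennreal (wgt S e x * f e x) \<partial>count_space UNIV) = (\<Sum>\<^sub>\<infinity>e. ennreal (- (wgt S e x * ln (wgt S e x))))"
        by (subst infsum_ennreal_eq_nn_integral) simp_all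
      then show ?thesis using c by simp
    qed
    then show ?thesis using same_averages_case_b[OF assms(4)] f by blast
  qed
  then obtain K where same: "same_averages (fun_ext f)"
    and K: "\<And>x. (\<integral>\<^sup>+e. ennreal (wgt S e x * f e x) \<partial>count_space UNIV) \<le> ennreal K" by blast
  define \<Lambda> where "\<Lambda> = (\<lambda>c. uniform_measure M (coding_map S b z -` class_cell S c))"
  have cls: "c \<in> comm_classes S" if "c \<in> I\<^sub>M" for c using that E.supported_iff unfolding I\<^sub>M_def by blast
  have \<Lambda>E: "\<Lambda> c \<in> equilibrium_states S b z" and \<Lambda>A: "AE \<sigma> in \<Lambda> c. coding_map S b z \<sigma> \<in> class_cell S c"
    if "c \<in> I\<^sub>M" for c
    using E.conditioned_equilibrium[of c] that unfolding I\<^sub>M_def \<Lambda>_def by auto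
  have classes: "\<Lambda> c \<in> equilibrium_states S b z \<and> emeasure (coded S b z (\<Lambda> c)) (C c) = 1 \<and>
      (\<forall>\<Lambda>'\<in>equilibrium_states S b z. emeasure (coded S b z \<Lambda>') (C c) = 1 \<longrightarrow> \<Lambda>' = \<Lambda> c) \<and>
      ergodic (\<Lambda> c) \<and> F -` C c \<in> invariant_sets M \<and>
      {\<mu> \<in> invariant_measures S. emeasure \<mu> (C c) = 1} = {coded S b z (\<Lambda> c)}" if c: "c \<in> I\<^sub>M" for c
  proof -
    interpret L: ac_equilibrium S b z "\<Lambda> c" a by (rule eqI[OF \<Lambda>E[OF c]])
    note mass = L.emeasure_coded_class[OF cls[OF c] \<Lambda>A[OF c]]
    have "{\<mu> \<in> invariant_measures S. emeasure \<mu> (C c) = 1} = {coded S b z (\<Lambda> c)}"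
      using L.invariant_unique[OF cls[OF c] \<Lambda>A[OF c]] L.coded_invariant mass unfolding C_def by blast
    then show ?thesis
      using \<Lambda>E[OF c] mass L.equilibrium_unique[OF cls[OF c] \<Lambda>A[OF c]] L.ergodic_of_class[OF cls[OF c] \<Lambda>A[OF c]]
        E.class_cell_invariant[OF cls[OF c]]
      unfolding C_def F_def by blast
  qed
  have decomposition: "emeasure M (B \<inter> Q) = (\<Sum>\<^sub>\<infinity>i\<in>I\<^sub>M. emeasure M (F -` C i \<inter> Q) * emeasure (\<Lambda> i) B)"
    if "B \<in> sets (code_borel UNIV)" "Q \<in> invariant_sets M" for B Q
    using E.ergodic_decomposition[of B Q] that unfolding sets_code_borel_UNIV I\<^sub>M_def C_def F_def \<Lambda>_def by simp
  have law: "AE \<sigma> in path_measure S x.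
      (\<lambda>n. ennreal ((1 / real n) * (\<Sum>k=1..n. fun_ext f (\<sigma> (k + 1)) (orbit S \<sigma> k x))))
        \<longlonglongrightarrow> (\<Sum>\<^sub>\<infinity>i\<in>I\<^sub>M. indicator (C i) x *
             (\<Sum>\<^sub>\<infinity>e. \<integral>\<^sup>+y\<in>cell S (src S e). ennreal (wgt S e y * f e y) \<partial>coded S b z (\<Lambda> i)))"
    if "x \<in> (\<Union>i\<in>I\<^sub>M. C i)" for x
  proof -
    let ?l = "\<lambda>i. \<Sum>\<^sub>\<infinity>e. \<integral>\<^sup>+y\<in>cell S (src S e). ennreal (wgt S e y * f e y) \<partial>coded S b z (\<Lambda> i)"
    from that obtain c where c: "c \<in> I\<^sub>M" and x: "x \<in> class_cell S c" unfolding C_def by blast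
    interpret L: ac_equilibrium S b z "\<Lambda> c" a by (rule eqI[OF \<Lambda>E[OF c]])
    \<comment> \<open>Class cells are disjoint, so the indicator leaves a single summand.\<close>
    have "(\<Sum>\<^sub>\<infinity>i\<in>I\<^sub>M. indicator (C i) x * ?l i) = (\<Sum>\<^sub>\<infinity>i\<in>{c}. indicator (C i) x * ?l i)"
      using c x class_cell_unique[OF assms(1) cls cls[OF c]] unfolding C_def
      by (intro infsum_cong_neutral) (auto split: split_indicator)
    also have "\<dots> = ?l c" using x unfolding C_def by simp
    finally show ?thesis
      using L.strong_law_limit[OF cls[OF c] \<Lambda>A[OF c] assms(7,8) same K x] by simp
  qed
  have supp_gen: "supported_classes S b z \<Lambda>' \<subseteq> generating_classes S" if \<Lambda>': "\<Lambda>' \<in> equilibrium_states S b z" for \<Lambda>'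
  proof
    fix c assume c: "c \<in> supported_classes S b z \<Lambda>'"
    interpret L': ac_equilibrium S b z \<Lambda>' a by (rule eqI[OF \<Lambda>'])
    have cc: "c \<in> comm_classes S" using c L'.supported_iff by blast
    \<comment> \<open>\<open>class_generating\<close> speaks of a state carried by one class, so it
      is applied to \<Lambda>' conditioned on that class.\<close>
    interpret L: ac_equilibrium S b z "uniform_measure \<Lambda>' (coding_map S b z -` class_cell S c)" a
      by (rule eqI[OF L'.conditioned_equilibrium(1)[OF c]])
    have "class_cell S c \<noteq> {}" using c L'.supported_iff by auto
    then obtain x j where x: "x \<in> cell S j" "j \<in> c" unfolding class_cell_def by blast
    then have "x \<in> class_cell S c" unfolding class_cell_def by blast
    then have "generating_point S x" by (rule L.class_generating[OF cc L'.conditioned_equilibrium(2)[OF c]])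
    then show "c \<in> generating_classes S"
      using x cc unfolding generating_classes_def generating_vertex_def by blast
  qed
  \<comment> \<open>Every equilibrium state has a supported class, and supported classes are
    generating; so all states sit on the one class c, where uniqueness and ergodicity are
    available.\<close>
  have single: "ergodic M \<and> equilibrium_states S b z = {M}" if g: "generating_classes S = {c}" for c
  proof -
    have AEc: "AE \<sigma> in \<Lambda>'. coding_map S b z \<sigma> \<in> class_cell S c" and cc: "c \<in> comm_classes S"
      if \<Lambda>': "\<Lambda>' \<in> equilibrium_states S b z" for \<Lambda>'
    proof -
      interpret L': ac_equilibrium S b z \<Lambda>' a by (rule eqI[OF \<Lambda>'])
      have s: "supported_classes S b z \<Lambda>' = {c}" using supp_gen[OF \<Lambda>'] L'.supported_nonempty g by auto
      show "AE \<sigma> in \<Lambda>'. coding_map S b z \<sigma> \<in> class_cell S c" using L'.AE_supported unfolding s by simp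
      show "c \<in> comm_classes S" using s L'.supported_iff by blast
    qed
    have "\<Lambda>' = M" if \<Lambda>': "\<Lambda>' \<in> equilibrium_states S b z" for \<Lambda>'
    proof -
      interpret L': ac_equilibrium S b z \<Lambda>' a by (rule eqI[OF \<Lambda>'])
      show ?thesis
        by (rule E.equilibrium_unique[OF cc[OF assms(6)] AEc[OF assms(6)] \<Lambda>' L'.emeasure_coded_class[OF cc[OF assms(6)] AEc[OF \<Lambda>']]])
    qed
    then show ?thesis using E.ergodic_of_class[OF cc[OF assms(6)] AEc[OF assms(6)]] assms(6) by blast
  qed
  show ?thesis
  proof (intro conjI exI[of _ \<Lambda>])
    show "I\<^sub>M \<noteq> {}" using E.supported_nonempty unfolding I\<^sub>M_def .
    show "I\<^sub>M \<subseteq> generating_classes S" using supp_gen[OF assms(6)] unfolding I\<^sub>M_def .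
    show "(\<exists>c. generating_classes S = {c}) \<longrightarrow> ergodic M \<and> equilibrium_states S b z = {M}"
      by (intro impI, elim exE, rule single)
  qed (intro ballI classes decomposition law; assumption)+
qed

end
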